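(* Let $\varphi$ be a hyperbolic automorphism of $\mathbb{D}$ with Denjoy-Wolff point $a\in\partial\mathbb{D}$ and the other fixed point $b\in\partial\mathbb{D}$. Assume that $\psi\in H^\infty(\mathbb{D})$ is not identically zero and is continuous at the points $a$ and $b$. If the weighted composition operator $C_{\psi,\varphi}$ on $H^2(\mathbb{D})$ is not invertible, then the spectrum of $C_{\psi,\varphi}$ on $H^2(\mathbb{D})$ is $$\left\{\lambda\in\mathbb{C} : |\lambda|\leqslant\max\{|\psi(a)|\varphi'(a)^{-1/2},\,|\psi(b)|\varphi'(b)^{-1/2}\}\right\}.$$
   Context: $\mathbb{D}$ is the open unit disk in $\mathbb{C}$. $H^2(\mathbb{D})$ is the Hardy-Hilbert space of analytic functions $f$ on $\mathbb{D}$ with $\|f\|^2=\sup_{0<r<1}\int_0^{2\pi}|f(re^{i\theta})|^2\frac{d\theta}{2\pi}<\infty$. $H^\infty(\mathbb{D})$ is the space of bounded analytic functions on $\mathbb{D}$. For an automorphism $\varphi$ of $\mathbb{D}$ and $\psi\in H^\infty(\mathbb{D})$, $C_{\psi,\varphi}$ is the bounded operator $C_{\psi,\varphi}f=\psi\cdot(f\circ\varphi)$. An automorphism of $\mathbb{D}$ (extended analytically to a neighbourhood of $\overline{\mathbb{D}}$) is hyperbolic if it has two distinct fixed points on $\partial\mathbb{D}$; its derivatives at these points are positive. Its Denjoy-Wolff point is the fixed point to which its iterates converge uniformly on compact subsets of $\mathbb{D}$. For $c\in\partial\mathbb{D}$, "$\psi$ is continuous at $c$" means that the limit of $\psi(z)$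 as $z\to c$, $z\in\mathbb{D}$, exists; this limit is denoted $\psi(c)$. *)

theory Defs
  imports "HOL-Complex_Analysis.Complex_Analysis"
begin

abbreviation unit_disc :: "complex set" (\<open>\<D>\<close>) where
  "\<D> \<equiv> ball 0 1"

abbreviation unit_circle :: "complex set" (\<open>\<T>\<close>) where
  "\<T> \<equiv> sphere 0 1"


definition circle_mean :: "(complex \<Rightarrow> complex) \<Rightarrow> real \<Rightarrow> real" where
  "circle_mean f r =
     integral {0..2 * pi} (\<lambda>\<theta>. (cmod (f (of_real r * cis \<theta>)))\<^sup>2 / (2 * pi))"

text \<open>
  A function on the disc is represented by the total function that extends it by zero outside
  the disc, so that equality of elements of the Hardy space is equality of total functions.
\<close>

definition hardy_space :: "(complex \<Rightarrow> complex) set" (\<open>H\<^sup>2\<close>) where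
  "H\<^sup>2 = {f. f holomorphic_on \<D> \<and> bdd_above (circle_mean f ` {0<..<1}) \<and> (\<forall>z. z \<notin> \<D> \<longrightarrow> f z = 0)}"

definition hardy_norm :: "(complex \<Rightarrow> complex) \<Rightarrow> real" where
  "hardy_norm f = sqrt (SUP r\<in>{0<..<1}. circle_mean f r)"

definition bounded_holomorphic :: "(complex \<Rightarrow> complex) set" (\<open>H\<^sup>\<infinity>\<close>) where
  "H\<^sup>\<infinity> = {g. g holomorphic_on \<D> \<and> bounded (g ` \<D>)}"


text \<open>
  Operators on the Hardy space are total maps on functions, of which only the values on
  \<open>H\<^sup>2\<close> are relevant. Scalars are complex.
\<close>

type_synonym operator = "(complex \<Rightarrow> complex) \<Rightarrow> (complex \<Rightarrow> complex)"

definition hardy_bounded_operator :: "operator \<Rightarrow> bool" where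
  "hardy_bounded_operator T \<longleftrightarrow>
     (\<forall>f\<in>H\<^sup>2. T f \<in> H\<^sup>2) \<and>
     (\<forall>f\<in>H\<^sup>2. \<forall>g\<in>H\<^sup>2. T (\<lambda>z. f z + g z) = (\<lambda>z. T f z + T g z)) \<and>
     (\<forall>c. \<forall>f\<in>H\<^sup>2. T (\<lambda>z. c * f z) = (\<lambda>z. c * T f z)) \<and>
     (\<exists>K. \<forall>f\<in>H\<^sup>2. hardy_norm (T f) \<le> K * hardy_norm f)"

definition hardy_invertible :: "operator \<Rightarrow> bool" where
  "hardy_invertible T \<longleftrightarrow> hardy_bounded_operator T \<and>
     (\<exists>S. hardy_bounded_operator S \<and> (\<forall>f\<in>H\<^sup>2. S (T f) = f \<and> T (S f) = f))"

definition hardy_spectrum :: "operator \<Rightarrow> complex set" where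
  "hardy_spectrum T = {\<mu>. \<not> hardy_invertible (\<lambda>f z. T f z - \<mu> * f z)}"

definition weighted_composition :: "(complex \<Rightarrow> complex) \<Rightarrow> (complex \<Rightarrow> complex) \<Rightarrow> operator" where
  "weighted_composition \<psi> \<phi> f = (\<lambda>z. if z \<in> \<D> then \<psi> z * f (\<phi> z) else 0)"


text \<open>
  Every automorphism of the disc extends analytically to a neighbourhood of the closed disc;
  the total function \<open>\<phi>\<close> stands for this extension, so that its values and derivatives
  on the circle are those of the extension.
\<close>

definition disc_automorphism :: "(complex \<Rightarrow> complex) \<Rightarrow> bool" where
  "disc_automorphism \<phi> \<longleftrightarrow> \<phi> analytic_on cball 0 1 \<and> bij_betw \<phi> \<D> \<D>"

text \<open>The fixed point set on the circle is exactly a pair; this rules out the identity.\<close>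

definition hyperbolic_automorphism :: "(complex \<Rightarrow> complex) \<Rightarrow> bool" where
  "hyperbolic_automorphism \<phi> \<longleftrightarrow> disc_automorphism \<phi> \<and>
     (\<exists>p q. p \<noteq> q \<and> {z \<in> \<T>. \<phi> z = z} = {p, q})"

definition denjoy_wolff_point :: "(complex \<Rightarrow> complex) \<Rightarrow> complex \<Rightarrow> bool" where
  "denjoy_wolff_point \<phi> a \<longleftrightarrow> a \<in> cball 0 1 \<and> \<phi> a = a \<and>
     (\<forall>K. compact K \<and> K \<subseteq> \<D> \<longrightarrow> uniform_limit K (\<lambda>n. \<phi> ^^ n) (\<lambda>_. a) sequentially)"


text \<open>
  For a boundary point \<open>c\<close>, the total function \<open>\<psi>\<close> may take an arbitrary value at \<open>c\<close>;
  continuity at \<open>c\<close> and the value there refer to the limit from inside the disc.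
\<close>

definition continuous_at_boundary :: "(complex \<Rightarrow> complex) \<Rightarrow> complex \<Rightarrow> bool" where
  "continuous_at_boundary \<psi> c \<longleftrightarrow> (\<exists>l. (\<psi> \<longlongrightarrow> l) (at c within \<D>))"

definition boundary_value :: "(complex \<Rightarrow> complex) \<Rightarrow> complex \<Rightarrow> complex" where
  "boundary_value \<psi> c = Lim (at c within \<D>) \<psi>"

end

theory Submission
  imports Defs
begin

text \<open>
  Write \<open>T\<close> for the operator and put
  \<open>W z = \<bar>\<psi> z\<bar>\<^sup>2 (1 - \<bar>z\<bar>\<^sup>2) / (1 - \<bar>\<phi> z\<bar>\<^sup>2)\<close>. For an automorphism the quotient
  \<open>(1 - \<bar>\<phi> z\<bar>\<^sup>2) / (1 - \<bar>z\<bar>\<^sup>2)\<close> is \<open>\<bar>\<phi>' z\<bar>\<close>, so \<open>W\<close> tends to \<open>\<bar>\<psi> c\<bar>\<^sup>2 / \<phi>' c\<close> at a fixed point \<open>c\<close>,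
  and the radius \<open>R\<close> in the theorem is the square root of the larger of the two limits.

  The norms of the powers of \<open>T\<close> can be read off from \<open>W\<close>. \<open>T ^^ n\<close> is again a weighted composition
  operator, and the function belonging to it is the product of \<open>W\<close> along the first \<open>n\<close> points of an
  orbit. Since \<open>\<phi>'\<^sup>1\<^sup>/\<^sup>2 f \<circ> \<phi>\<close> has the norm of \<open>f\<close>, the squared norm of \<open>T ^^ n\<close> is at most the
  supremum of these products (\<open>T_power_norm_le\<close>); reproducing kernels show that it is at least as
  large (\<open>T_power_norm_lower\<close>). In the coordinate \<open>u z = (1 - cnj a z) / (1 - cnj b z)\<close> the map \<open>\<phi>\<close>
  is multiplication by some \<open>s\<close> between 0 and 1, so every orbit spends a bounded number of steps away
  from \<open>a\<close> and \<open>b\<close>, and the products are \<open>O(r ^ (2 * n))\<close> uniformly for each \<open>r > R\<close>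
  (\<open>orbit_product_bound\<close>). The Neumann series puts the spectrum inside the disc of radius \<open>R\<close>. On the
  other hand orbits that stay near \<open>a\<close> or \<open>b\<close> for \<open>n\<close> steps show that a bound
  \<open>norm (T ^^ n) \<le> C r ^ n\<close> forces \<open>R \<le> r\<close>.

  It remains to see that the spectrum fills the disc. The powers \<open>u powr (\<i> \<theta>)\<close> with real \<open>\<theta>\<close> are
  bounded above and below, and multiplication by them conjugates \<open>T\<close> to \<open>s powr (\<i> \<theta>) T\<close>. Hence the
  spectrum is invariant under rotations. If some \<open>\<mu> \<noteq> 0\<close> is not in the spectrum, then neither
  is any point of the circle through \<open>\<mu>\<close> with centre 0, and the Riesz projection \<open>P\<close> of that
  circle commutes with all these multiplications. An operator that does so is multiplication
  by a function; as \<open>P\<close> is idempotent the function has values 0 and 1, and being holomorphic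
  it is constant. So \<open>P = 0\<close> or \<open>P = I\<close> (\<open>projection_zero_or_id\<close>). If \<open>P = 0\<close>, then \<open>T\<close> is invertible;
  if \<open>P = I\<close>, then \<open>norm (T ^^ n) \<le> C \<bar>\<mu>\<bar> ^ n\<close> and therefore \<open>R \<le> \<bar>\<mu>\<bar>\<close> (\<open>resolvent_dichotomy\<close>). A
  non-invertible \<open>T\<close> thus has no resolvent point with \<open>\<bar>\<mu>\<bar> < R\<close>, and none with \<open>\<bar>\<mu>\<bar> = R\<close> because
  the resolvent set is open.
\<close>

section \<open>Taylor coefficients and circle means\<close>

definition taylor_coeff :: "(complex \<Rightarrow> complex) \<Rightarrow> nat \<Rightarrow> complex" where
  "taylor_coeff f n = (deriv ^^ n) f 0 / fact n"

lemma taylor_coeff_sums: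
  assumes "f holomorphic_on ball 0 R" "cmod z < R"
  shows "(\<lambda>n. taylor_coeff f n * z ^ n) sums f z"
  using holomorphic_power_series[OF assms(1), of z] assms(2) by (simp add: taylor_coeff_def)

lemma taylor_coeff_unique:
  assumes "0 < R" and f: "\<And>z. cmod z < R \<Longrightarrow> (\<lambda>n. a n * z ^ n) sums f z"
  shows "taylor_coeff f = a"
proof (rule ccontr)
  assume "taylor_coeff f \<noteq> a"
  define d where "d n = taylor_coeff f n - a n" for n
  from \<open>taylor_coeff f \<noteq> a\<close> obtain m where m: "d m \<noteq> 0" by (auto simp: d_def fun_eq_iff)
  have "f holomorphic_on ball 0 R"
    using power_series_holomorphic[of 0 R a f] f by simp
  hence d0: "(\<lambda>n. d n * (z - 0) ^ n) sums 0" if "cmod (z - 0) < R" for z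
    using sums_diff[OF taylor_coeff_sums[of f R z] f[of z]] that by (simp add: d_def algebra_simps)
  have "d 0 = 0" using d0[of 0] \<open>0 < R\<close> by simp
  with m have "0 < m" by (cases m) auto
  from powser_0_nonzero[of R 0 d "\<lambda>_. 0" m, OF \<open>0 < R\<close> d0 _ m \<open>0 < m\<close>]
  obtain s where s: "0 < s" "\<And>z. z \<in> cball 0 s - {0::complex} \<Longrightarrow> (0::complex) \<noteq> 0"
    by blast
  show False using s(2)[of "of_real s"] s(1) by simp
qed

lemma disc_pos: "z \<in> \<D> \<Longrightarrow> 0 < 1 - (cmod z)\<^sup>2"
  by (simp add: power_less_one_iff abs_square_less_1)

lemma moebius_denominator_nonzero:
  assumes "cmod \<alpha> < 1" "cmod z \<le> 1"
  shows "1 - cnj \<alpha> * z \<noteq> 0"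
proof
  assume "1 - cnj \<alpha> * z = 0"
  hence "cmod \<alpha> * cmod z = 1" by (metis complex_mod_cnj eq_iff_diff_eq_0 norm_mult norm_one)
  moreover have "cmod \<alpha> * cmod z \<le> cmod \<alpha> * 1" using assms by (intro mult_left_mono) auto
  ultimately show False using assms by simp
qed

lemma poisson_mean:
  assumes h: "h holomorphic_on cball 0 1" and \<alpha>: "cmod \<alpha> < 1"
  shows "((\<lambda>\<theta>. h (cis \<theta>) * of_real ((1 - (cmod \<alpha>)\<^sup>2) / (cmod (1 - cnj \<alpha> * cis \<theta>))\<^sup>2))
           has_integral (of_real (2 * pi) * h \<alpha>)) {0..2 * pi}"
proof -
  note nz = moebius_denominator_nonzero[OF \<alpha>]
  (* Cauchy's formula at \<alpha> applies to this f: on the circle z - \<alpha> is z times the conjugate of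
       1 - cnj \<alpha> * z, which turns f z / (z - \<alpha>) into the Poisson kernel times h. *)
  define f where "f z = h z * of_real (1 - (cmod \<alpha>)\<^sup>2) / (1 - cnj \<alpha> * z)" for z
  have "f holomorphic_on cball 0 1"
    unfolding f_def using nz by (intro holomorphic_intros h) auto
  from Cauchy_integral_circlepath_simple[OF this, of \<alpha>] \<alpha>
  have "((\<lambda>u. f u / (u - \<alpha>)) has_contour_integral (2 * of_real pi * \<i> * f \<alpha>)) (part_circlepath 0 1 0 (2 * pi))"
    by (simp add: circlepath_def)
  hence "((\<lambda>t. f (cis t) / (cis t - \<alpha>) * \<i> * cis t) has_integral 2 * of_real pi * \<i> * f \<alpha>) {0..2*pi}"
    by (subst (asm) has_contour_integral_part_circlepath_iff) auto
  hence "((\<lambda>t. -\<i> * (f (cis t) / (cis t - \<alpha>) * \<i> * cis t)) has_integral - \<i> * (2 * of_real pi * \<i> * f \<alpha>)) {0..2*pi}"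
    by (rule has_integral_mult_right)
  moreover have "-\<i> * (f (cis t) / (cis t - \<alpha>) * \<i> * cis t) =
      h (cis t) * of_real ((1 - (cmod \<alpha>)\<^sup>2) / (cmod (1 - cnj \<alpha> * cis t))\<^sup>2)" for t
  proof -
    have c: "cis t - \<alpha> = cis t * cnj (1 - cnj \<alpha> * cis t)"
      by (simp add: algebra_simps flip: cis_inverse) (simp add: cis_mult cis_cnj mult.assoc flip: cis_inverse)
    define w where "w = 1 - cnj \<alpha> * cis t"
    have "w \<noteq> 0" using nz[of "cis t"] by (simp add: w_def)
    have sq: "of_real ((cmod w)\<^sup>2) = w * cnj w" by (rule complex_norm_square)
    show ?thesis unfolding f_def c of_real_divide w_def[symmetric] sq
      using \<open>w \<noteq> 0\<close> by (simp add: divide_simps) (simp add: algebra_simps)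
  qed
  moreover have "- \<i> * (2 * of_real pi * \<i> * f \<alpha>) = of_real (2 * pi) * h \<alpha>"
  proof -
    have "of_real (1 - (cmod \<alpha>)\<^sup>2) = 1 - cnj \<alpha> * \<alpha>"
      by (simp only: of_real_diff of_real_1 complex_norm_square) (simp add: mult.commute)
    moreover have "1 - cnj \<alpha> * \<alpha> \<noteq> 0" using nz[of \<alpha>] \<alpha> by simp
    ultimately show ?thesis by (simp add: f_def)
  qed
  ultimately show ?thesis by (simp only:)
qed

text \<open>
  On the circle \<open>cnj z = 1 / z\<close>, so \<open>\<bar>f\<bar>\<^sup>2\<close> is a real trigonometric polynomial and hence the
  real part of a polynomial. The point of \<open>H\<close> is that any mean which reproduces the values of
  holomorphic functions computes the energy of a polynomial, also after composition with a
  Moebius map.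
\<close>

lemma polynomial_energy_function:
  "\<exists>H. H holomorphic_on UNIV \<and> H 0 = of_real (\<Sum>k<N. (cmod (a k))\<^sup>2) \<and>
     (\<forall>z. cmod z = 1 \<longrightarrow> Re (H z) = (cmod (\<Sum>k<N. a k * z ^ k))\<^sup>2)"
proof (induction N arbitrary: a)
  case 0
  show ?case by (intro exI[of _ "\<lambda>_. 0"]) auto
next
  case (Suc N)
  obtain H where H: "H holomorphic_on UNIV" "H 0 = of_real (\<Sum>k<N. (cmod (a (Suc k)))\<^sup>2)"
    "\<And>z. cmod z = 1 \<Longrightarrow> Re (H z) = (cmod (\<Sum>k<N. a (Suc k) * z ^ k))\<^sup>2"
    using Suc.IH[of "\<lambda>k. a (Suc k)"] by blast
  define g where "g z = (\<Sum>k<N. a (Suc k) * z ^ k)" for z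
  have split: "(\<Sum>k<Suc N. a k * z ^ k) = a 0 + z * g z" for z
    by (simp add: sum.lessThan_Suc_shift g_def sum_distrib_left mult_ac del: sum.lessThan_Suc)
  show ?case
  proof (intro exI[of _ "\<lambda>z. of_real ((cmod (a 0))\<^sup>2) + H z + 2 * cnj (a 0) * (z * g z)"] conjI allI impI)
    show "(\<lambda>z. of_real ((cmod (a 0))\<^sup>2) + H z + 2 * cnj (a 0) * (z * g z)) holomorphic_on UNIV"
      unfolding g_def by (intro holomorphic_intros H)
    show "of_real ((cmod (a 0))\<^sup>2) + H 0 + 2 * cnj (a 0) * (0 * g 0) = of_real (\<Sum>k<Suc N. (cmod (a k))\<^sup>2)"
      by (simp add: H sum.lessThan_Suc_shift del: sum.lessThan_Suc)
    fix z :: complex assume z: "cmod z = 1"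
    have "(cmod (a 0 + z * g z))\<^sup>2 = (cmod (a 0))\<^sup>2 + (cmod (z * g z))\<^sup>2 + 2 * Re (cnj (a 0) * (z * g z))"
      by (simp only: cmod_power2) (simp add: power2_eq_square algebra_simps)
    with H(3)[OF z] z split[of z] show "Re (of_real ((cmod (a 0))\<^sup>2) + H z + 2 * cnj (a 0) * (z * g z)) = (cmod (\<Sum>k<Suc N. a k * z ^ k))\<^sup>2"
      by (simp add: norm_mult g_def del: sum.lessThan_Suc)
  qed
qed

text \<open>
  The case of interest is a disc automorphism \<open>m\<close>, for which the Poisson kernel of its zero \<open>\<alpha>\<close> is
  \<open>\<bar>m'\<bar>\<close> on the circle: then \<open>f \<mapsto> m'\<^sup>1\<^sup>/\<^sup>2 f \<circ> m\<close> preserves the norm of polynomials. The function \<open>m = id\<close>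
  gives Parseval's identity.
\<close>

lemma circle_mean_moebius_polynomial:
  assumes \<alpha>: "cmod \<alpha> < 1" and m: "m holomorphic_on cball 0 1" "m \<alpha> = 0" "\<And>z. cmod z = 1 \<Longrightarrow> cmod (m z) = 1"
  shows "((\<lambda>\<theta>. (cmod (\<Sum>k<N. a k * m (cis \<theta>) ^ k))\<^sup>2 * ((1 - (cmod \<alpha>)\<^sup>2) / (cmod (1 - cnj \<alpha> * cis \<theta>))\<^sup>2))
           has_integral (2 * pi * (\<Sum>k<N. (cmod (a k))\<^sup>2))) {0..2 * pi}"
proof -
  obtain H where H: "H holomorphic_on UNIV" "H 0 = of_real (\<Sum>k<N. (cmod (a k))\<^sup>2)"
    "\<And>z. cmod z = 1 \<Longrightarrow> Re (H z) = (cmod (\<Sum>k<N. a k * z ^ k))\<^sup>2"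
    using polynomial_energy_function by blast
  have "(\<lambda>z. H (m z)) holomorphic_on cball 0 1"
    using holomorphic_on_compose_gen[OF m(1) H(1)] by (simp add: o_def)
  from has_integral_Re[OF poisson_mean[OF this \<alpha>]] show ?thesis
    using H m by (simp del: of_real_sum of_real_divide)
qed

lemma circle_mean_polynomial:
  "circle_mean (\<lambda>z. \<Sum>k<N. a k * z ^ k) r = (\<Sum>k<N. (cmod (a k))\<^sup>2 * r ^ (2 * k))"
proof -
  have "((\<lambda>\<theta>. (cmod (\<Sum>k<N. (a k * of_real r ^ k) * cis \<theta> ^ k))\<^sup>2)
           has_integral (2 * pi * (\<Sum>k<N. (cmod (a k * of_real r ^ k))\<^sup>2))) {0..2 * pi}"
    using circle_mean_moebius_polynomial[of 0 "\<lambda>z. z" "\<lambda>k. a k * of_real r ^ k" N] by simp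
  from has_integral_divide[OF this, of "2 * pi"] have
    "((\<lambda>\<theta>. (cmod (\<Sum>k<N. (a k * of_real r ^ k) * cis \<theta> ^ k))\<^sup>2 / (2 * pi))
           has_integral (\<Sum>k<N. (cmod (a k * of_real r ^ k))\<^sup>2)) {0..2 * pi}" by simp
  hence "circle_mean (\<lambda>z. \<Sum>k<N. a k * z ^ k) r = (\<Sum>k<N. (cmod (a k * of_real r ^ k))\<^sup>2)"
    unfolding circle_mean_def by (intro integral_unique) (simp add: power_mult_distrib mult_ac)
  also have "\<dots> = (\<Sum>k<N. (cmod (a k))\<^sup>2 * r ^ (2 * k))"
  proof (intro sum.cong refl)
    fix k
    have "(\<bar>r\<bar> ^ k)\<^sup>2 = r ^ (2 * k)" by (metis power2_abs power_abs power_mult mult.commute)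
    thus "(cmod (a k * of_real r ^ k))\<^sup>2 = (cmod (a k))\<^sup>2 * r ^ (2 * k)"
      by (simp add: norm_mult norm_power power_mult_distrib)
  qed
  finally show ?thesis .
qed

lemma parseval_circle_mean:
  assumes f: "f holomorphic_on ball 0 R" and r: "0 \<le> r" "r < R"
  shows "(\<lambda>n. (cmod (taylor_coeff f n))\<^sup>2 * r ^ (2 * n)) sums circle_mean f r"
proof -
  let ?a = "taylor_coeff f"
  have R: "0 < R" using r by linarith
  define r' where "r' = (r + R) / 2"
  have r': "r < r'" "r' < R" "0 < r'" using r by (auto simp: r'_def)
  have "summable (\<lambda>n. ?a n * of_real r' ^ n)"
    using taylor_coeff_sums[OF f, of "of_real r'"] r' by (auto simp: sums_iff)
  hence sm: "summable (\<lambda>n. norm (?a n) * r ^ n)"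
    using powser_insidea[of ?a "of_real r'" "of_real r"] r r' by (simp add: norm_mult norm_power)
  have ul: "uniform_limit UNIV (\<lambda>n \<theta>. \<Sum>k<n. ?a k * (of_real r * cis \<theta>) ^ k) (\<lambda>\<theta>. f (of_real r * cis \<theta>)) sequentially"
  proof -
    have "uniform_limit UNIV (\<lambda>n \<theta>. \<Sum>k<n. ?a k * (of_real r * cis \<theta>) ^ k) (\<lambda>\<theta>. \<Sum>k. ?a k * (of_real r * cis \<theta>) ^ k) sequentially"
      by (rule Weierstrass_m_test[OF _ sm]) (use r in \<open>auto simp: norm_mult norm_power\<close>)
    moreover have "(\<Sum>k. ?a k * (of_real r * cis \<theta>) ^ k) = f (of_real r * cis \<theta>)" for \<theta>
      using taylor_coeff_sums[OF f, of "of_real r * cis \<theta>"] r by (simp add: sums_iff norm_mult)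
    ultimately show ?thesis by simp
  qed
  have contf: "continuous_on UNIV (\<lambda>\<theta>. f (of_real r * cis \<theta>))"
    by (rule continuous_on_compose2[OF holomorphic_on_imp_continuous_on[OF f]])
       (use r in \<open>auto intro!: continuous_intros simp: norm_mult\<close>)
  have "uniform_limit {0..2*pi} (\<lambda>n \<theta>. (cmod (\<Sum>k<n. ?a k * (of_real r * cis \<theta>) ^ k))\<^sup>2 / (2 * pi))
          (\<lambda>\<theta>. (cmod (f (of_real r * cis \<theta>)))\<^sup>2 / (2 * pi)) sequentially"
  proof -
    have bf: "bounded ((\<lambda>\<theta>. cmod (f (of_real r * cis \<theta>))) ` {0..2*pi})"
      by (intro compact_imp_bounded compact_continuous_image continuous_on_norm continuous_on_subset[OF contf]) auto
    have u: "uniform_limit {0..2*pi} (\<lambda>n \<theta>. cmod (\<Sum>k<n. ?a k * (of_real r * cis \<theta>) ^ k))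
          (\<lambda>\<theta>. cmod (f (of_real r * cis \<theta>))) sequentially"
      by (intro uniform_limit_norm uniform_limit_on_subset[OF ul]) auto
    from uniform_lim_mult[OF u u bf bf] show ?thesis
      unfolding power2_eq_square divide_inverse
      by (intro bounded_linear.uniform_limit[OF bounded_linear_mult_left])
  qed
  moreover have "\<And>n. continuous_on {0..2*pi} (\<lambda>\<theta>. (cmod (\<Sum>k<n. ?a k * (of_real r * cis \<theta>) ^ k))\<^sup>2 / (2 * pi))"
    by (intro continuous_intros) auto
  ultimately obtain I J where IJ: "\<And>n. ((\<lambda>\<theta>. (cmod (\<Sum>k<n. ?a k * (of_real r * cis \<theta>) ^ k))\<^sup>2 / (2 * pi)) has_integral I n) {0..2*pi}"
     "((\<lambda>\<theta>. (cmod (f (of_real r * cis \<theta>)))\<^sup>2 / (2 * pi)) has_integral J) {0..2*pi}" "I \<longlonglongrightarrow> J"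
    by (rule uniform_limit_integral) auto
  have "I n = (\<Sum>k<n. (cmod (?a k))\<^sup>2 * r ^ (2 * k))" for n
    using integral_unique[OF IJ(1)[of n]] circle_mean_polynomial[of ?a n r] by (simp add: circle_mean_def)
  moreover have "J = circle_mean f r"
    using integral_unique[OF IJ(2)] by (simp add: circle_mean_def)
  ultimately show ?thesis using IJ(3) unfolding sums_def by presburger
qed

lemma circle_mean_nonneg: "0 \<le> circle_mean f r"
  unfolding circle_mean_def
  by (cases "(\<lambda>\<theta>. (cmod (f (of_real r * cis \<theta>)))\<^sup>2 / (2 * pi)) integrable_on {0..2 * pi}")
     (simp_all add: integral_nonneg not_integrable_integral)

lemma hardy_norm_nonneg: "f \<in> H\<^sup>2 \<Longrightarrow> 0 \<le> hardy_norm f"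
  unfolding hardy_norm_def hardy_space_def
  by (auto intro!: order.trans[OF circle_mean_nonneg cSUP_upper[of "1/2"]])

lemma hardy_coeff_partial_sum_le:
  assumes "f \<in> H\<^sup>2"
  shows "(\<Sum>n<N. (cmod (taylor_coeff f n))\<^sup>2) \<le> (hardy_norm f)\<^sup>2"
proof -
  have f: "f holomorphic_on ball 0 1" and bdd: "bdd_above (circle_mean f ` {0<..<1})"
    using assms by (auto simp: hardy_space_def)
  have le: "(\<Sum>n<N. (cmod (taylor_coeff f n))\<^sup>2 * r ^ (2 * n)) \<le> (SUP r\<in>{0<..<1}. circle_mean f r)" if "r \<in> {0<..<1}" for r
  proof -
    have "(\<Sum>n<N. (cmod (taylor_coeff f n))\<^sup>2 * r ^ (2 * n)) \<le> circle_mean f r"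
      using parseval_circle_mean[OF f, of r] that
      by (intro sum_le_suminf[THEN order.trans]) (auto simp: sums_iff)
    also have "\<dots> \<le> (SUP r\<in>{0<..<1}. circle_mean f r)"
      by (rule cSUP_upper[OF that bdd])
    finally show ?thesis .
  qed
  have "((\<lambda>r. \<Sum>n<N. (cmod (taylor_coeff f n))\<^sup>2 * r ^ (2 * n)) \<longlongrightarrow> (\<Sum>n<N. (cmod (taylor_coeff f n))\<^sup>2 * 1 ^ (2 * n))) (at_left (1::real))"
    by (intro tendsto_intros)
  moreover have "eventually (\<lambda>r. (\<Sum>n<N. (cmod (taylor_coeff f n))\<^sup>2 * r ^ (2 * n)) \<le> (SUP r\<in>{0<..<1}. circle_mean f r)) (at_left (1::real))"
    by (rule eventually_mono[OF eventually_at_left_real[of 0 1]]) (auto intro: le)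
  ultimately have "(\<Sum>n<N. (cmod (taylor_coeff f n))\<^sup>2 * 1 ^ (2 * n)) \<le> (SUP r\<in>{0<..<1}. circle_mean f r)"
    by (rule tendsto_upperbound) simp
  moreover have "0 \<le> (SUP r\<in>{0<..<1}. circle_mean f r)"
    using le[of "1/2"] by (intro order.trans[OF _ le[of "1/2"]]) (auto intro!: sum_nonneg)
  ultimately show ?thesis by (simp add: hardy_norm_def)
qed

lemma hardy_memI_circle_mean:
  assumes f: "f holomorphic_on \<D>" "\<And>z. z \<notin> \<D> \<Longrightarrow> f z = 0" and B: "0 \<le> B"
    and le: "\<And>r. 0 < r \<Longrightarrow> r < 1 \<Longrightarrow> circle_mean f r \<le> B\<^sup>2"
  shows "f \<in> H\<^sup>2" and "hardy_norm f \<le> B"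
proof -
  have "bdd_above (circle_mean f ` {0<..<1})"
    unfolding bdd_above_def by (intro exI[of _ "B\<^sup>2"]) (use le in auto)
  thus "f \<in> H\<^sup>2" using f by (simp add: hardy_space_def)
  have "(SUP r\<in>{0<..<1}. circle_mean f r) \<le> B\<^sup>2"
    by (rule cSUP_least) (auto intro: le)
  thus "hardy_norm f \<le> B" unfolding hardy_norm_def using B
    by (metis abs_of_nonneg real_sqrt_abs real_sqrt_le_mono)
qed

lemma hardy_memI:
  assumes f: "f holomorphic_on \<D>" "\<And>z. z \<notin> \<D> \<Longrightarrow> f z = 0" and B: "0 \<le> B"
    and le: "\<And>N. (\<Sum>n<N. (cmod (taylor_coeff f n))\<^sup>2) \<le> B\<^sup>2"
  shows "f \<in> H\<^sup>2" and "hardy_norm f \<le> B"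
proof -
  have "circle_mean f r \<le> B\<^sup>2" if "0 < r" "r < 1" for r
  proof -
    have "(\<Sum>n<N. (cmod (taylor_coeff f n))\<^sup>2 * r ^ (2 * n)) \<le> B\<^sup>2" for N
      by (rule order.trans[OF sum_mono le]) (use that in \<open>auto intro!: mult_right_le_one_le power_le_one\<close>)
    moreover have "(\<lambda>N. \<Sum>n<N. (cmod (taylor_coeff f n))\<^sup>2 * r ^ (2 * n)) \<longlonglongrightarrow> circle_mean f r"
      using parseval_circle_mean[OF f(1), of r] that by (simp add: sums_def)
    ultimately show ?thesis by (intro LIMSEQ_le_const2) auto
  qed
  from hardy_memI_circle_mean[OF f B this] show "f \<in> H\<^sup>2" "hardy_norm f \<le> B" by auto
qed

section \<open>The Hardy space as a Banach space\<close>

lemma taylor_coeff_add: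
  assumes "f holomorphic_on \<D>" "g holomorphic_on \<D>"
  shows "taylor_coeff (\<lambda>z. f z + g z) = (\<lambda>n. taylor_coeff f n + taylor_coeff g n)"
  by (rule taylor_coeff_unique[of 1])
     (auto simp: ring_distribs intro!: sums_add taylor_coeff_sums[of _ 1] assms)

lemma taylor_coeff_cmult:
  assumes "f holomorphic_on \<D>"
  shows "taylor_coeff (\<lambda>z. c * f z) = (\<lambda>n. c * taylor_coeff f n)"
  by (rule taylor_coeff_unique[of 1])
     (auto simp: mult.assoc intro!: sums_mult taylor_coeff_sums[of _ 1] assms)

lemma hardy_add:
  assumes "f \<in> H\<^sup>2" "g \<in> H\<^sup>2"
  shows "(\<lambda>z. f z + g z) \<in> H\<^sup>2" "hardy_norm (\<lambda>z. f z + g z) \<le> hardy_norm f + hardy_norm g"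
proof -
  have hol: "f holomorphic_on \<D>" "g holomorphic_on \<D>" using assms by (auto simp: hardy_space_def)
  have le: "(\<Sum>n<N. (cmod (taylor_coeff (\<lambda>z. f z + g z) n))\<^sup>2) \<le> (hardy_norm f + hardy_norm g)\<^sup>2" for N
  proof -
    have L2: "L2_set (\<lambda>n. cmod (taylor_coeff h n)) {..<N} \<le> hardy_norm h" if "h \<in> H\<^sup>2" for h
      unfolding L2_set_def using hardy_coeff_partial_sum_le[OF that, of N] hardy_norm_nonneg[OF that]
      by (intro real_le_lsqrt sum_nonneg) auto
    have "L2_set (\<lambda>n. cmod (taylor_coeff (\<lambda>z. f z + g z) n)) {..<N}
        \<le> L2_set (\<lambda>n. cmod (taylor_coeff f n) + cmod (taylor_coeff g n)) {..<N}"
      unfolding taylor_coeff_add[OF hol] by (intro L2_set_mono norm_triangle_ineq) auto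
    also have "\<dots> \<le> hardy_norm f + hardy_norm g"
      using L2_set_triangle_ineq[of "\<lambda>n. cmod (taylor_coeff f n)" "\<lambda>n. cmod (taylor_coeff g n)" "{..<N}"] L2[OF assms(1)] L2[OF assms(2)]
      by linarith
    finally show ?thesis unfolding L2_set_def by (rule sqrt_le_D)
  qed
  have *: "(\<lambda>z. f z + g z) holomorphic_on \<D>" "\<And>z. z \<notin> \<D> \<Longrightarrow> f z + g z = 0"
     "0 \<le> hardy_norm f + hardy_norm g"
    using assms by (auto simp: hardy_space_def intro!: holomorphic_intros add_nonneg_nonneg hardy_norm_nonneg)
  show "(\<lambda>z. f z + g z) \<in> H\<^sup>2" "hardy_norm (\<lambda>z. f z + g z) \<le> hardy_norm f + hardy_norm g"
    using hardy_memI[OF * le] by auto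
qed

lemma hardy_cmult:
  assumes "f \<in> H\<^sup>2"
  shows "(\<lambda>z. c * f z) \<in> H\<^sup>2" "hardy_norm (\<lambda>z. c * f z) = cmod c * hardy_norm f"
proof -
  have *: "(\<lambda>z. c * f z) \<in> H\<^sup>2 \<and> hardy_norm (\<lambda>z. c * f z) \<le> cmod c * hardy_norm f" if f: "f \<in> H\<^sup>2" for c f
  proof -
    have hol: "f holomorphic_on \<D>" using f by (auto simp: hardy_space_def)
    have le: "(\<Sum>n<N. (cmod (taylor_coeff (\<lambda>z. c * f z) n))\<^sup>2) \<le> (cmod c * hardy_norm f)\<^sup>2" for N
      unfolding taylor_coeff_cmult[OF hol] norm_mult power_mult_distrib sum_distrib_left[symmetric]
      by (intro mult_left_mono hardy_coeff_partial_sum_le f) auto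
    have "(\<lambda>z. c * f z) holomorphic_on \<D>" "\<And>z. z \<notin> \<D> \<Longrightarrow> c * f z = 0" "0 \<le> cmod c * hardy_norm f"
      using f by (auto simp: hardy_space_def intro!: holomorphic_intros mult_nonneg_nonneg hardy_norm_nonneg[OF f])
    from hardy_memI[OF this le] show ?thesis by auto
  qed
  show "(\<lambda>z. c * f z) \<in> H\<^sup>2" using * assms by blast
  show "hardy_norm (\<lambda>z. c * f z) = cmod c * hardy_norm f"
  proof (cases "c = 0")
    case True
    have "hardy_norm (\<lambda>z. c * f z) \<le> 0" using *[of f c] assms True by simp
    moreover have "0 \<le> hardy_norm (\<lambda>z. c * f z)" using * assms by (intro hardy_norm_nonneg) auto
    ultimately show ?thesis using True by simp
  next
    case False
    have "hardy_norm (\<lambda>z. inverse c * (c * f z)) \<le> cmod (inverse c) * hardy_norm (\<lambda>z. c * f z)"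
      using *[of "\<lambda>z. c * f z" "inverse c"] *[of f c] assms by blast
    also have "(\<lambda>z. inverse c * (c * f z)) = f" using False by (auto simp: fun_eq_iff)
    finally have "cmod c * hardy_norm f \<le> hardy_norm (\<lambda>z. c * f z)"
      using False by (simp add: norm_divide field_simps)
    with *[of f c] assms show ?thesis by force
  qed
qed

lemma hardy_zero: "(\<lambda>_. 0) \<in> H\<^sup>2"
proof -
  have t: "taylor_coeff (\<lambda>_. 0) = (\<lambda>_. 0)" by (rule taylor_coeff_unique[of 1]) auto
  show ?thesis by (rule hardy_memI[of _ 0]) (auto simp: t)
qed

text \<open>
  Cauchy-Schwarz for the Taylor series against the geometric series.
\<close>

lemma hardy_eval_bound:
  assumes f: "f \<in> H\<^sup>2" and z: "z \<in> \<D>"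
  shows "cmod (f z) * sqrt (1 - (cmod z)\<^sup>2) \<le> hardy_norm f"
proof -
  have z1: "(cmod z)\<^sup>2 < 1" using z by (simp add: power_less_one_iff abs_square_less_1)
  have "cmod (\<Sum>n<N. taylor_coeff f n * z ^ n) \<le> hardy_norm f * sqrt (1 / (1 - (cmod z)\<^sup>2))" for N
  proof -
    have "cmod (\<Sum>n<N. taylor_coeff f n * z ^ n) \<le> (\<Sum>n<N. \<bar>cmod (taylor_coeff f n)\<bar> * \<bar>cmod z ^ n\<bar>)"
      by (rule sum_norm_le) (simp add: norm_mult norm_power)
    also have "\<dots> \<le> L2_set (\<lambda>n. cmod (taylor_coeff f n)) {..<N} * L2_set (\<lambda>n. cmod z ^ n) {..<N}"
      by (rule L2_set_mult_ineq)
    also have "\<dots> \<le> hardy_norm f * sqrt (1 / (1 - (cmod z)\<^sup>2))"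
    proof (rule mult_mono)
      show "L2_set (\<lambda>n. cmod (taylor_coeff f n)) {..<N} \<le> hardy_norm f"
        unfolding L2_set_def using hardy_coeff_partial_sum_le[OF f, of N] hardy_norm_nonneg[OF f]
        by (intro real_le_lsqrt sum_nonneg) auto
      have "(\<lambda>n. ((cmod z)\<^sup>2) ^ n) sums (1 / (1 - (cmod z)\<^sup>2))"
        using z1 by (intro geometric_sums) auto
      hence "(\<Sum>n<N. ((cmod z)\<^sup>2) ^ n) \<le> 1 / (1 - (cmod z)\<^sup>2)"
        by (metis finite_lessThan sum_le_suminf sums_iff zero_le_power zero_le_power2)
      thus "L2_set (\<lambda>n. cmod z ^ n) {..<N} \<le> sqrt (1 / (1 - (cmod z)\<^sup>2))"
        unfolding L2_set_def by (intro real_sqrt_le_mono) (simp add: power_mult[symmetric] mult.commute)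
    qed (use hardy_norm_nonneg[OF f] in \<open>auto simp: L2_set_nonneg\<close>)
    finally show ?thesis .
  qed
  moreover have "(\<lambda>N. cmod (\<Sum>n<N. taylor_coeff f n * z ^ n)) \<longlonglongrightarrow> cmod (f z)"
    using taylor_coeff_sums[of f 1 z] f z by (intro tendsto_norm) (auto simp: hardy_space_def sums_def)
  ultimately have "cmod (f z) \<le> hardy_norm f * sqrt (1 / (1 - (cmod z)\<^sup>2))"
    by (intro LIMSEQ_le_const2) auto
  thus ?thesis using z1 by (simp add: real_sqrt_divide field_simps)
qed

text \<open>
  As a type the Hardy space has a Banach space of bounded linear maps, in which Neumann series
  converge and continuous families of operators can be integrated.
\<close>

typedef hardy = "H\<^sup>2" morphisms hfun Hardy
  using hardy_zero by blast

lemma hardy_eqI: "(\<And>z. z \<in> \<D> \<Longrightarrow> hfun f z = hfun g z) \<Longrightarrow> f = g"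
  by (rule hfun_inject[THEN iffD1], rule ext) (use hfun[of f] hfun[of g] in \<open>force simp: hardy_space_def\<close>)

lemma hfun_outside: "z \<notin> \<D> \<Longrightarrow> hfun f z = 0"
  using hfun[of f] by (auto simp: hardy_space_def)

lemma hfun_holomorphic: "hfun f holomorphic_on \<D>"
  using hfun[of f] by (auto simp: hardy_space_def)

instantiation hardy :: real_normed_vector
begin

definition zero_hardy where "0 = Hardy (\<lambda>_. 0)"
definition plus_hardy where "f + g = Hardy (\<lambda>z. hfun f z + hfun g z)"
definition uminus_hardy where "- f = Hardy (\<lambda>z. (-1) * hfun f z)"
definition minus_hardy where "f - g = Hardy (\<lambda>z. hfun f z + (-1) * hfun g z)"
definition scaleR_hardy where "r *\<^sub>R f = Hardy (\<lambda>z. of_real r * hfun f z)"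
definition norm_hardy where "norm f = hardy_norm (hfun f)"
definition dist_hardy :: "hardy \<Rightarrow> hardy \<Rightarrow> real" where "dist_hardy f g = norm (f - g)"
definition sgn_hardy :: "hardy \<Rightarrow> hardy" where "sgn_hardy f = inverse (norm f) *\<^sub>R f"
definition uniformity_hardy :: "(hardy \<times> hardy) filter"
  where "uniformity_hardy = (INF e\<in>{0 <..}. principal {(x, y). dist x y < e})"
definition open_hardy :: "hardy set \<Rightarrow> bool"
  where "open_hardy S = (\<forall>x\<in>S. \<forall>\<^sub>F (x', y) in uniformity. x' = x \<longrightarrow> y \<in> S)"

lemma hfun_0: "hfun 0 z = 0"
  by (simp add: zero_hardy_def Hardy_inverse hardy_zero)
lemma hfun_add: "hfun (f + g) z = hfun f z + hfun g z"
  by (simp add: plus_hardy_def Hardy_inverse hardy_add hfun)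
lemma hfun_uminus: "hfun (- f) z = - hfun f z"
  using hardy_cmult(1)[OF hfun, of "-1" f] by (simp add: uminus_hardy_def Hardy_inverse)
lemma hfun_diff: "hfun (f - g) z = hfun f z - hfun g z"
  using hardy_add(1)[OF hfun[of f] hardy_cmult(1)[OF hfun[of g], of "-1"]] by (simp add: minus_hardy_def Hardy_inverse)
lemma hfun_scaleR: "hfun (r *\<^sub>R f) z = of_real r * hfun f z"
  by (simp add: scaleR_hardy_def Hardy_inverse hardy_cmult hfun)

instance
proof
  fix f g h :: hardy and r s :: real
  show "dist f g = norm (f - g)" by (fact dist_hardy_def)
  show "sgn f = inverse (norm f) *\<^sub>R f" by (fact sgn_hardy_def)
  show "uniformity = (INF e\<in>{0<..}. principal {(x::hardy, y). dist x y < e})" by (fact uniformity_hardy_def)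
  show "open U \<longleftrightarrow> (\<forall>x\<in>U. \<forall>\<^sub>F (x', y) in uniformity. x' = x \<longrightarrow> y \<in> U)" for U :: "hardy set" by (fact open_hardy_def)
  show "norm (f + g) \<le> norm f + norm g"
    using hardy_add(2)[OF hfun hfun, of f g] by (simp add: norm_hardy_def hfun_add[abs_def])
  show "norm (r *\<^sub>R f) = \<bar>r\<bar> * norm f"
    using hardy_cmult(2)[OF hfun, of "of_real r" f] by (simp add: norm_hardy_def hfun_scaleR[abs_def])
  show "norm f = 0 \<longleftrightarrow> f = 0"
  proof
    assume "norm f = 0"
    have "hfun f z = 0" if z: "z \<in> \<D>" for z
    proof -
      have "(cmod z)\<^sup>2 < 1" using z by (simp add: power_less_one_iff abs_square_less_1)
      thus ?thesis using hardy_eval_bound[OF hfun z, of f] \<open>norm f = 0\<close> by (simp add: norm_hardy_def mult_le_0_iff)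
    qed
    thus "f = 0" by (intro hardy_eqI) (simp add: hfun_0)
  next
    assume "f = 0"
    thus "norm f = 0" using hardy_cmult(2)[OF hfun, of 0 "f"] by (simp add: norm_hardy_def hfun_0[abs_def])
  qed
qed (auto intro!: hardy_eqI simp: hfun_0 hfun_add hfun_uminus hfun_diff hfun_scaleR algebra_simps)

end

lemmas hfun_simps = hfun_0 hfun_add hfun_uminus hfun_diff hfun_scaleR

abbreviation hcoeff :: "hardy \<Rightarrow> nat \<Rightarrow> complex" where
  "hcoeff f \<equiv> taylor_coeff (hfun f)"

lemma hcoeff_diff: "hcoeff (f - g) n = hcoeff f n - hcoeff g n"
proof -
  have "hfun (f - g) = (\<lambda>z. hfun f z + (-1) * hfun g z)" by (simp add: hfun_diff fun_eq_iff)
  thus ?thesis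
    using taylor_coeff_add[OF hfun_holomorphic[of f], of "\<lambda>z. (-1) * hfun g z"] taylor_coeff_cmult[OF hfun_holomorphic[of g], of "-1"]
    by (simp add: hfun_holomorphic holomorphic_on_minus)
qed

lemma hcoeff_sums: "z \<in> \<D> \<Longrightarrow> (\<lambda>n. hcoeff f n * z ^ n) sums hfun f z"
  by (rule taylor_coeff_sums[OF hfun_holomorphic]) simp

lemma hcoeff_eqI: "(\<And>n. hcoeff f n = hcoeff g n) \<Longrightarrow> f = g"
  using hcoeff_sums[of _ f] hcoeff_sums[of _ g] by (intro hardy_eqI) (simp add: sums_iff)

lemma hcoeff_partial_sum_le: "(\<Sum>n<N. (cmod (hcoeff f n))\<^sup>2) \<le> (norm f)\<^sup>2"
  using hardy_coeff_partial_sum_le[OF hfun] by (simp add: norm_hardy_def)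

lemma norm_hardy_le:
  assumes "0 \<le> B" "\<And>N. (\<Sum>n<N. (cmod (hcoeff f n))\<^sup>2) \<le> B\<^sup>2"
  shows "norm f \<le> B"
  unfolding norm_hardy_def using assms by (intro hardy_memI hfun_holomorphic hfun_outside)

lemma hcoeff_norm_sums: "(\<lambda>n. (cmod (hcoeff f n))\<^sup>2) sums (norm f)\<^sup>2"
proof -
  have sm: "summable (\<lambda>n. (cmod (hcoeff f n))\<^sup>2)"
    by (rule bounded_imp_summable[of _ "(norm f)\<^sup>2"]) (use hcoeff_partial_sum_le[of f "Suc _"] in \<open>auto simp: lessThan_Suc_atMost\<close>)
  let ?S = "\<Sum>n. (cmod (hcoeff f n))\<^sup>2"
  have "0 \<le> ?S" by (intro suminf_nonneg sm) auto
  have "norm f \<le> sqrt ?S"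
  proof (rule norm_hardy_le)
    show "(\<Sum>n<N. (cmod (hcoeff f n))\<^sup>2) \<le> (sqrt ?S)\<^sup>2" for N
      using \<open>0 \<le> ?S\<close> sm by (simp add: sum_le_suminf)
  qed (use \<open>0 \<le> ?S\<close> in auto)
  hence "(norm f)\<^sup>2 \<le> ?S" using \<open>0 \<le> ?S\<close> by (metis norm_ge_zero power2_le_imp_le power_mono real_sqrt_pow2)
  moreover have "?S \<le> (norm f)\<^sup>2" by (intro suminf_le_const sm hcoeff_partial_sum_le)
  ultimately show ?thesis using sm by (simp add: sums_iff)
qed

lemma norm_hcoeff_le: "cmod (hcoeff f n) \<le> norm f"
proof (rule power2_le_imp_le)
  have "(cmod (hcoeff f n))\<^sup>2 \<le> (\<Sum>k<Suc n. (cmod (hcoeff f k))\<^sup>2)"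
    by (rule member_le_sum) auto
  also have "\<dots> \<le> (norm f)\<^sup>2" by (rule hcoeff_partial_sum_le)
  finally show "(cmod (hcoeff f n))\<^sup>2 \<le> (norm f)\<^sup>2" .
qed auto

lemma norm_hfun_le: "z \<in> \<D> \<Longrightarrow> cmod (hfun f z) * sqrt (1 - (cmod z)\<^sup>2) \<le> norm f"
  using hardy_eval_bound[OF hfun] by (simp add: norm_hardy_def)

lemma hardy_of_coeffs:
  assumes B: "\<And>N. (\<Sum>n<N. (cmod (a n))\<^sup>2) \<le> B"
  obtains f where "hcoeff f = a"
proof -
  have B0: "0 \<le> B" using B[of 0] by simp
  define f where "f z = (if z \<in> \<D> then \<Sum>n. a n * z ^ n else 0)" for z
  have a: "cmod (a n) \<le> sqrt B" for n
  proof (rule real_le_rsqrt)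
    have "(cmod (a n))\<^sup>2 \<le> (\<Sum>k<Suc n. (cmod (a k))\<^sup>2)" by (rule member_le_sum) auto
    thus "(cmod (a n))\<^sup>2 \<le> B" using B[of "Suc n"] by linarith
  qed
  have s: "(\<lambda>n. a n * z ^ n) sums f z" if "cmod z < 1" for z
  proof -
    have "summable (\<lambda>n. a n * z ^ n)"
    proof (rule summable_comparison_test')
      show "summable (\<lambda>n. sqrt B * cmod z ^ n)" using that by (intro summable_mult summable_geometric) auto
      show "norm (a n * z ^ n) \<le> sqrt B * cmod z ^ n" for n
        using a by (auto simp: norm_mult norm_power intro!: mult_right_mono)
    qed
    thus ?thesis using that by (auto simp: f_def intro: summable_sums)
  qed
  have t: "taylor_coeff f = a" by (rule taylor_coeff_unique[of 1]) (auto intro: s)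
  have "f \<in> H\<^sup>2"
  proof (rule hardy_memI[of _ "sqrt B"])
    show "f holomorphic_on \<D>" using power_series_holomorphic[of 0 1 a f] s by simp
  qed (use B B0 in \<open>auto simp: t f_def\<close>)
  thus ?thesis using that[of "Hardy f"] t by (simp add: Hardy_inverse)
qed

text \<open>
  Taylor coefficients of a Cauchy sequence converge one by one, and the norm passes to the
  limit through the finite partial sums.
\<close>

instance hardy :: banach
proof
  fix X :: "nat \<Rightarrow> hardy" assume X: "Cauchy X"
  have "Cauchy (\<lambda>k. hcoeff (X k) n)" for n
  proof (rule CauchyI)
    fix e :: real assume "0 < e"
    then obtain M where "\<forall>m\<ge>M. \<forall>k\<ge>M. norm (X m - X k) < e" using CauchyD[OF X] by blast
    moreover have "norm (hcoeff (X m) n - hcoeff (X k) n) \<le> norm (X m - X k)" for m k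
      using norm_hcoeff_le[of "X m - X k" n] by (simp add: hcoeff_diff)
    ultimately show "\<exists>M. \<forall>m\<ge>M. \<forall>k\<ge>M. norm (hcoeff (X m) n - hcoeff (X k) n) < e"
      by (meson order.strict_trans1)
  qed
  hence "\<exists>l. (\<lambda>k. hcoeff (X k) n) \<longlonglongrightarrow> l" for n
    by (simp add: Cauchy_convergent convergentD)
  then obtain a where a: "\<And>n. (\<lambda>k. hcoeff (X k) n) \<longlonglongrightarrow> a n" by metis
  obtain B where B: "\<And>k. norm (X k) \<le> B" using Cauchy_Bseq[OF X] by (auto simp: Bseq_def)
  have "(\<Sum>n<N. (cmod (a n))\<^sup>2) \<le> B\<^sup>2" for N
  proof (rule LIMSEQ_le_const2)
    show "(\<lambda>k. \<Sum>n<N. (cmod (hcoeff (X k) n))\<^sup>2) \<longlonglongrightarrow> (\<Sum>n<N. (cmod (a n))\<^sup>2)"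
      by (intro tendsto_intros a)
    show "\<exists>M. \<forall>k\<ge>M. (\<Sum>n<N. (cmod (hcoeff (X k) n))\<^sup>2) \<le> B\<^sup>2"
      using hcoeff_partial_sum_le B by (meson norm_ge_zero order_trans power_mono)
  qed
  then obtain f where f: "hcoeff f = a" by (rule hardy_of_coeffs)
  have "X \<longlonglongrightarrow> f"
  proof (rule LIMSEQ_I)
    fix e :: real assume e: "0 < e"
    then obtain M where M: "\<And>m k. m \<ge> M \<Longrightarrow> k \<ge> M \<Longrightarrow> norm (X m - X k) < e / 2" using CauchyD[OF X, of "e / 2"] by auto
    have "norm (X m - f) \<le> e / 2" if "m \<ge> M" for m
    proof (rule norm_hardy_le)
      fix N
      show "(\<Sum>n<N. (cmod (hcoeff (X m - f) n))\<^sup>2) \<le> (e / 2)\<^sup>2"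
        unfolding hcoeff_diff f
      proof (rule LIMSEQ_le_const2)
        show "(\<lambda>k. \<Sum>n<N. (cmod (hcoeff (X m) n - hcoeff (X k) n))\<^sup>2) \<longlonglongrightarrow> (\<Sum>n<N. (cmod (hcoeff (X m) n - a n))\<^sup>2)"
          by (intro tendsto_intros a)
        show "\<exists>M. \<forall>k\<ge>M. (\<Sum>n<N. (cmod (hcoeff (X m) n - hcoeff (X k) n))\<^sup>2) \<le> (e / 2)\<^sup>2"
        proof (intro exI[of _ M] allI impI)
          fix k assume "M \<le> k"
          have "(norm (X m - X k))\<^sup>2 \<le> (e / 2)\<^sup>2"
            using M[OF \<open>m \<ge> M\<close> \<open>M \<le> k\<close>] by (intro power_mono) auto
          thus "(\<Sum>n<N. (cmod (hcoeff (X m) n - hcoeff (X k) n))\<^sup>2) \<le> (e / 2)\<^sup>2"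
            using hcoeff_partial_sum_le[where N = N and f = "X m - X k"] by (simp add: hcoeff_diff)
        qed
      qed
    qed (use e in auto)
    thus "\<exists>M. \<forall>m\<ge>M. norm (X m - f) < e" using e by (intro exI[of _ M]) force
  qed
  thus "convergent X" by (auto simp: convergent_def)
qed

section \<open>Polynomials and reproducing kernels\<close>

definition hpoly :: "(nat \<Rightarrow> complex) \<Rightarrow> nat \<Rightarrow> hardy" where
  "hpoly a N = Hardy (\<lambda>z. if z \<in> \<D> then \<Sum>k<N. a k * z ^ k else 0)"

abbreviation hmono :: "nat \<Rightarrow> hardy" where
  "hmono k \<equiv> hpoly (\<lambda>j. if j = k then 1 else 0) (Suc k)"

lemma
  shows hfun_hpoly: "z \<in> \<D> \<Longrightarrow> hfun (hpoly a N) z = (\<Sum>k<N. a k * z ^ k)"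
    and hcoeff_hpoly: "hcoeff (hpoly a N) n = (if n < N then a n else 0)"
proof -
  have "(\<Sum>n<M. (cmod (if n < N then a n else 0))\<^sup>2) \<le> (\<Sum>n<N. (cmod (a n))\<^sup>2)" for M
  proof -
    have "(\<Sum>n<M. (cmod (if n < N then a n else 0))\<^sup>2) = (\<Sum>n\<in>{..<M} \<inter> {..<N}. (cmod (a n))\<^sup>2)"
      by (subst sum.inter_restrict) (auto intro!: sum.cong)
    also have "\<dots> \<le> (\<Sum>n<N. (cmod (a n))\<^sup>2)" by (rule sum_mono2) auto
    finally show ?thesis .
  qed
  then obtain f where f: "hcoeff f = (\<lambda>n. if n < N then a n else 0)" by (rule hardy_of_coeffs)
  have fz: "hfun f z = (\<Sum>k<N. a k * z ^ k)" if "z \<in> \<D>" for z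
  proof -
    have "(\<lambda>n. hcoeff f n * z ^ n) sums (\<Sum>k<N. hcoeff f k * z ^ k)"
      by (rule sums_finite) (auto simp: f)
    from sums_unique2[OF hcoeff_sums[OF that] this] show ?thesis by (simp add: f)
  qed
  have "hfun f = (\<lambda>z. if z \<in> \<D> then \<Sum>k<N. a k * z ^ k else 0)"
    using fz hfun_outside by (intro ext) auto
  hence h: "hpoly a N = f" unfolding hpoly_def by (metis hfun_inverse)
  show "hcoeff (hpoly a N) n = (if n < N then a n else 0)" by (simp add: h f)
  show "z \<in> \<D> \<Longrightarrow> hfun (hpoly a N) z = (\<Sum>k<N. a k * z ^ k)" by (simp add: h fz)
qed

lemma hfun_hmono: "z \<in> \<D> \<Longrightarrow> hfun (hmono k) z = z ^ k"
  by (simp add: hfun_hpoly if_distrib[of "\<lambda>x. x * _"] cong: if_cong)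

lemma norm_hpoly: "(norm (hpoly a N))\<^sup>2 = (\<Sum>k<N. (cmod (a k))\<^sup>2)"
proof -
  have "(\<lambda>n. (cmod (hcoeff (hpoly a N) n))\<^sup>2) sums (\<Sum>n<N. (cmod (hcoeff (hpoly a N) n))\<^sup>2)"
    by (rule sums_finite) (auto simp: hcoeff_hpoly)
  from sums_unique2[OF hcoeff_norm_sums this] show ?thesis by (simp add: hcoeff_hpoly)
qed

lemma hpoly_tendsto: "(\<lambda>N. hpoly (hcoeff f) N) \<longlonglongrightarrow> f"
proof -
  have n: "(norm (hpoly (hcoeff f) N - f))\<^sup>2 = (norm f)\<^sup>2 - (\<Sum>n<N. (cmod (hcoeff f n))\<^sup>2)" for N
  proof -
    let ?p = "hpoly (hcoeff f) N"
    have eq: "(cmod (hcoeff f n))\<^sup>2 - (cmod (hcoeff ?p n))\<^sup>2 = (cmod (hcoeff (?p - f) n))\<^sup>2" for n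
      by (cases "n < N") (simp_all add: hcoeff_diff hcoeff_hpoly)
    have "(\<lambda>n. (cmod (hcoeff f n))\<^sup>2 - (cmod (hcoeff ?p n))\<^sup>2) sums ((norm f)\<^sup>2 - (norm ?p)\<^sup>2)"
      by (rule sums_diff[OF hcoeff_norm_sums hcoeff_norm_sums])
    hence "(norm (?p - f))\<^sup>2 = (norm f)\<^sup>2 - (norm ?p)\<^sup>2"
      unfolding eq by (rule sums_unique2[OF hcoeff_norm_sums])
    thus ?thesis by (simp only: norm_hpoly)
  qed
  have "(\<lambda>N. (norm f)\<^sup>2 - (\<Sum>n<N. (cmod (hcoeff f n))\<^sup>2)) \<longlonglongrightarrow> (norm f)\<^sup>2 - (norm f)\<^sup>2"
    by (intro tendsto_diff tendsto_const hcoeff_norm_sums[unfolded sums_def])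
  hence "(\<lambda>N. (norm (hpoly (hcoeff f) N - f))\<^sup>2) \<longlonglongrightarrow> 0"
    by (simp only: n diff_self)
  hence "(\<lambda>N. norm (hpoly (hcoeff f) N - f)) \<longlonglongrightarrow> 0"
    by (subst (asm) power_tendsto_0_iff) simp_all
  thus ?thesis by (rule LIM_zero_cancel[OF tendsto_norm_zero_cancel])
qed

text \<open>
  The function is the reproducing kernel of the point \<open>w\<close>; its size at \<open>w\<close> attains the
  evaluation bound.
\<close>

lemma hardy_kernel:
  assumes w: "w \<in> \<D>"
  obtains k where "\<And>z. z \<in> \<D> \<Longrightarrow> hfun k z = 1 / (1 - cnj w * z)" "(norm k)\<^sup>2 = 1 / (1 - (cmod w)\<^sup>2)"
proof -
  have w1: "(cmod w)\<^sup>2 < 1" using w by (simp add: power_less_one_iff abs_square_less_1)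
  have s: "(\<lambda>n. (cmod (cnj w ^ n))\<^sup>2) sums (1 / (1 - (cmod w)\<^sup>2))"
  proof -
    have "(\<lambda>n. ((cmod w)\<^sup>2) ^ n) sums (1 / (1 - (cmod w)\<^sup>2))"
      using w1 by (intro geometric_sums) auto
    thus ?thesis by (simp add: norm_power power_mult[symmetric] mult.commute)
  qed
  have "(\<Sum>n<N. (cmod (cnj w ^ n))\<^sup>2) \<le> (\<Sum>n. (cmod (cnj w ^ n))\<^sup>2)" for N
    by (rule sum_le_suminf[OF sums_summable[OF s]]) auto
  hence "(\<Sum>n<N. (cmod (cnj w ^ n))\<^sup>2) \<le> 1 / (1 - (cmod w)\<^sup>2)" for N
    unfolding sums_unique[OF s, symmetric] .
  then obtain k where k: "hcoeff k = (\<lambda>n. cnj w ^ n)" by (rule hardy_of_coeffs)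
  show ?thesis
  proof (rule that)
    show "(norm k)\<^sup>2 = 1 / (1 - (cmod w)\<^sup>2)"
      using sums_unique2[OF hcoeff_norm_sums[of k]] s k by simp
    fix z :: complex assume z: "z \<in> \<D>"
    have "cmod (cnj w * z) < 1 * 1" unfolding norm_mult using w z by (intro mult_strict_mono') auto
    hence "(\<lambda>n. (cnj w * z) ^ n) sums (1 / (1 - cnj w * z))" by (intro geometric_sums) simp
    thus "hfun k z = 1 / (1 - cnj w * z)"
      using sums_unique2[OF hcoeff_sums[OF z, of k]] by (simp add: k power_mult_distrib)
  qed
qed

section \<open>Automorphisms of the disc\<close>

definition disc_bijection :: "(complex \<Rightarrow> complex) \<Rightarrow> bool" where
  "disc_bijection \<phi> \<longleftrightarrow> \<phi> holomorphic_on \<D> \<and> bij_betw \<phi> \<D> \<D>"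

lemma disc_bijection_id: "disc_bijection (\<lambda>z. z)"
  by (simp add: disc_bijection_def bij_betw_def)

lemma disc_bijection_in_disc: "disc_bijection \<phi> \<Longrightarrow> z \<in> \<D> \<Longrightarrow> \<phi> z \<in> \<D>"
  unfolding disc_bijection_def bij_betw_def by blast

lemma disc_bijection_compose:
  assumes "disc_bijection \<phi>" "disc_bijection \<eta>"
  shows "disc_bijection (\<phi> \<circ> \<eta>)"
  using assms holomorphic_on_compose_gen[of \<eta> \<D> \<phi> \<D>] bij_betw_trans[of \<eta> \<D> \<D> \<phi> \<D>]
  unfolding disc_bijection_def by (metis bij_betw_imp_surj_on order_refl)

lemma disc_bijection_funpow: "disc_bijection \<phi> \<Longrightarrow> disc_bijection (\<phi> ^^ n)"
  by (induction n) (auto intro: disc_bijection_compose disc_bijection_id simp: id_def)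

text \<open>
  Composed with a Moebius map that moves 0 to its zero, the bijection fixes 0, and the Schwarz
  lemma applies to it and to its inverse.
\<close>

lemma disc_bijection_moebius:
  assumes "disc_bijection \<phi>"
  obtains \<alpha> c where "cmod \<alpha> < 1" "cmod c = 1" "\<And>z. z \<in> \<D> \<Longrightarrow> \<phi> z = c * (z - \<alpha>) / (1 - cnj \<alpha> * z)"
proof -
  have hol: "\<phi> holomorphic_on \<D>" and inj: "inj_on \<phi> \<D>" and im: "\<phi> ` \<D> = \<D>"
    using assms by (auto simp: disc_bijection_def bij_betw_def)
  obtain \<psi> where "\<psi> holomorphic_on \<phi> ` \<D>" and \<psi>2: "\<And>z. z \<in> \<D> \<Longrightarrow> \<psi> (\<phi> z) = z"
    by (rule holomorphic_has_inverse[OF hol _ inj]) auto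
  hence \<psi>: "\<psi> holomorphic_on \<D>" "\<And>z. z \<in> \<D> \<Longrightarrow> \<psi> (\<phi> z) = z" by (simp_all add: im)
  have \<psi>D: "\<psi> z \<in> \<D>" if "z \<in> \<D>" for z using that \<psi>(2) im by (metis image_iff)
  have "0 \<in> \<phi> ` \<D>" unfolding im by simp
  then obtain \<alpha> where \<alpha>: "\<alpha> \<in> \<D>" "\<phi> \<alpha> = 0" by (metis imageE)
  let ?M = "Moebius_function 0"
  have M: "?M w holomorphic_on \<D>" "?M w ` \<D> \<subseteq> \<D>" if "w \<in> \<D>" for w
    using that Moebius_function_holomorphic[of w 0] Moebius_function_norm_lt_1[of w] by auto
  have M': "?M \<alpha> (?M (-\<alpha>) z) = z" "?M (-\<alpha>) (?M \<alpha> z) = z" if "z \<in> \<D>" for z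
    using Moebius_function_compose that \<alpha> by auto
  have m\<alpha>: "-\<alpha> \<in> \<D>" using \<alpha> by simp
  define g where "g = \<phi> \<circ> ?M (-\<alpha>)"
  define h where "h = ?M \<alpha> \<circ> \<psi>"
  have gh: "g holomorphic_on \<D>" unfolding g_def by (intro holomorphic_on_compose_gen[OF M(1) hol] M m\<alpha>)
  have hh: "h holomorphic_on \<D>" unfolding h_def
    by (rule holomorphic_on_compose_gen[OF \<psi>(1) M(1)]) (use \<alpha> \<psi>D in auto)
  have M0: "?M (-\<alpha>) 0 = \<alpha>" "?M \<alpha> \<alpha> = 0" by (simp_all add: Moebius_function_simple)
  have g0: "g 0 = 0" "h 0 = 0" using M0 \<alpha> \<psi>(2)[OF \<alpha>(1)] by (simp_all add: g_def h_def)
  have gD: "cmod (g z) < 1" if "cmod z < 1" for z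
  proof -
    have "?M (-\<alpha>) z \<in> \<D>" using M(2)[OF m\<alpha>] that by (metis image_subset_iff mem_ball_0)
    hence "\<phi> (?M (-\<alpha>) z) \<in> \<D>" using im by blast
    thus ?thesis by (simp add: g_def)
  qed
  have hD: "cmod (h z) < 1" if "cmod z < 1" for z
  proof -
    have "\<psi> z \<in> \<D>" using \<psi>D that by simp
    hence "?M \<alpha> (\<psi> z) \<in> \<D>" using M(2)[OF \<alpha>(1)] by blast
    thus ?thesis by (simp add: h_def)
  qed
  have hg: "h (g z) = z" if "z \<in> \<D>" for z
  proof -
    have "?M (-\<alpha>) z \<in> \<D>" using M(2)[OF m\<alpha>] that by blast
    thus ?thesis using M'(1)[OF that] \<psi>(2) by (simp add: g_def h_def)
  qed
  let ?x = "1/2 :: complex"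
  have "cmod (g ?x) = cmod ?x"
  proof (rule antisym)
    show "cmod (g ?x) \<le> cmod ?x" by (rule Schwarz_Lemma(1)[OF gh g0(1) gD]) auto
    (* The same lemma for the inverse of g gives equality, so g is a rotation. *)
    have "cmod (h (g ?x)) \<le> cmod (g ?x)" by (rule Schwarz_Lemma(1)[OF hh g0(2) hD]) (auto intro: gD)
    thus "cmod ?x \<le> cmod (g ?x)" by (subst (asm) hg) auto
  qed
  hence "\<exists>c. (\<forall>z. cmod z < 1 \<longrightarrow> g z = c * z) \<and> cmod c = 1"
    by (intro Schwarz_Lemma(3)[OF gh g0(1) gD, of 0]) (auto intro!: exI[of _ ?x])
  then obtain c where c: "\<And>z. z \<in> \<D> \<Longrightarrow> g z = c * z" "cmod c = 1" by auto
  show ?thesis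
  proof (rule that[of \<alpha> c])
    fix z :: complex assume z: "z \<in> \<D>"
    have "?M \<alpha> z \<in> \<D>" using M(2)[OF \<alpha>(1)] z by blast
    from c(1)[OF this] show "\<phi> z = c * (z - \<alpha>) / (1 - cnj \<alpha> * z)"
      using M'(2)[OF z] by (simp add: g_def Moebius_function_simple)
  qed (use \<alpha> c in auto)
qed

text \<open>
  The first factor on the right is the modulus of the derivative of the Moebius map.
\<close>

lemma moebius_norm_identity:
  assumes "cmod \<alpha> < 1" "cmod c = 1" "cmod z \<le> 1"
  shows "1 - (cmod (c * (z - \<alpha>) / (1 - cnj \<alpha> * z)))\<^sup>2 = (1 - (cmod \<alpha>)\<^sup>2) / (cmod (1 - cnj \<alpha> * z))\<^sup>2 * (1 - (cmod z)\<^sup>2)"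
proof -
  have nz: "cmod (1 - cnj \<alpha> * z) \<noteq> 0" using moebius_denominator_nonzero[OF assms(1,3)] by simp
  have alg: "1 - (x / n)\<^sup>2 = p / n\<^sup>2 * q" if "n\<^sup>2 - x\<^sup>2 = p * q" "n \<noteq> 0" for n x p q :: real
  proof -
    have "1 - (x / n)\<^sup>2 = (n\<^sup>2 - x\<^sup>2) / n\<^sup>2" using that(2) by (simp add: power_divide diff_divide_distrib)
    also have "\<dots> = p / n\<^sup>2 * q" by (simp only: that(1) times_divide_eq_left)
    finally show ?thesis .
  qed
  have sq: "(cmod (1 - cnj \<alpha> * z))\<^sup>2 - (cmod (z - \<alpha>))\<^sup>2 = (1 - (cmod \<alpha>)\<^sup>2) * (1 - (cmod z)\<^sup>2)"
    by (simp only: cmod_power2) (simp add: power2_eq_square algebra_simps)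
  have quot: "cmod (c * (z - \<alpha>) / (1 - cnj \<alpha> * z)) = cmod (z - \<alpha>) / cmod (1 - cnj \<alpha> * z)"
    unfolding norm_mult norm_divide assms(2) by simp
  show ?thesis unfolding quot by (rule alg[OF sq nz])
qed

section \<open>Weighted composition operators\<close>

lemma circle_mean_integrable:
  assumes "f holomorphic_on \<D>" "0 \<le> r" "r < 1"
  shows "(\<lambda>\<theta>. (cmod (f (of_real r * cis \<theta>)))\<^sup>2 / (2 * pi)) integrable_on {0..2*pi}"
  by (intro integrable_continuous_interval continuous_intros continuous_on_compose2[OF holomorphic_on_imp_continuous_on[OF assms(1)]])
     (use assms in \<open>auto simp: norm_mult\<close>)

lemma circle_mean_le:
  assumes "f holomorphic_on \<D>" "h holomorphic_on \<D>" "0 \<le> r" "r < 1"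
    and le: "\<And>z. z \<in> \<D> \<Longrightarrow> (cmod (f z))\<^sup>2 \<le> C * (cmod (h z))\<^sup>2"
  shows "circle_mean f r \<le> C * circle_mean h r"
proof -
  have "circle_mean f r \<le> integral {0..2*pi} (\<lambda>\<theta>. C * ((cmod (h (of_real r * cis \<theta>)))\<^sup>2 / (2 * pi)))"
    unfolding circle_mean_def
    by (rule integral_le)
       (use circle_mean_integrable[OF assms(1,3,4)] integrable_on_cmult_left[OF circle_mean_integrable[OF assms(2-4)], of C] le assms(3,4)
        in \<open>auto simp: norm_mult divide_right_mono\<close>)
  thus ?thesis by (simp add: circle_mean_def)
qed

text \<open>
  The hypothesis on \<open>g\<close> says that \<open>\<bar>g\<bar>\<^sup>2 \<le> B\<^sup>2 \<bar>\<phi>'\<bar>\<close>, so the function is dominated by \<open>B\<close> times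
  the isometric image of the polynomial. The condition is written without derivatives
  because in this form it telescopes along orbits.
\<close>

lemma weighted_composition_hpoly:
  assumes \<phi>: "disc_bijection \<phi>" and g: "g holomorphic_on \<D>" and B: "0 \<le> B"
    and bound: "\<And>z. z \<in> \<D> \<Longrightarrow> (cmod (g z))\<^sup>2 * (1 - (cmod z)\<^sup>2) \<le> B\<^sup>2 * (1 - (cmod (\<phi> z))\<^sup>2)"
  shows "weighted_composition g \<phi> (hfun (hpoly a N)) \<in> H\<^sup>2"
    and "hardy_norm (weighted_composition g \<phi> (hfun (hpoly a N))) \<le> B * norm (hpoly a N)"
proof -
  obtain \<alpha> c where \<alpha>: "cmod \<alpha> < 1" and c: "cmod c = 1"
    and \<phi>eq: "\<And>z. z \<in> \<D> \<Longrightarrow> \<phi> z = c * (z - \<alpha>) / (1 - cnj \<alpha> * z)"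
    using disc_bijection_moebius[OF \<phi>] by blast
  define m where "m z = c * (z - \<alpha>) / (1 - cnj \<alpha> * z)" for z
  (* F is a square root of the derivative of \<phi> times the composition; it is holomorphic past the
       circle, so Parseval's identity holds up to radius 1 and the circle means of F increase to the energy of the polynomial. *)
  define F where "F z = of_real (sqrt (1 - (cmod \<alpha>)\<^sup>2)) / (1 - cnj \<alpha> * z) * (\<Sum>k<N. a k * m z ^ k)" for z
  define R where "R = 2 / (1 + cmod \<alpha>)"
  let ?w = "weighted_composition g \<phi> (hfun (hpoly a N))"
  have \<alpha>2: "(cmod \<alpha>)\<^sup>2 < 1" using \<alpha> by (simp add: power_less_one_iff abs_square_less_1)
  have \<alpha>1: "0 < 1 + cmod \<alpha>" by (simp add: add_pos_nonneg)
  have R: "1 < R" using \<alpha> \<alpha>1 unfolding R_def by (simp add: less_divide_eq)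
  have nz: "1 - cnj \<alpha> * z \<noteq> 0" if "cmod z < R" for z
  proof
    assume "1 - cnj \<alpha> * z = 0"
    hence e: "cmod \<alpha> * cmod z = 1" by (metis complex_mod_cnj eq_iff_diff_eq_0 norm_mult norm_one)
    hence "cmod \<alpha> \<noteq> 0" by auto
    hence "cmod \<alpha> * cmod z < cmod \<alpha> * R" using that by (intro mult_strict_left_mono) auto
    also have "\<dots> \<le> 1" using \<alpha> \<alpha>1 unfolding R_def by (simp add: divide_le_eq)
    finally show False using e by simp
  qed
  have holF: "F holomorphic_on ball 0 R"
    unfolding F_def m_def using nz by (intro holomorphic_intros) auto
  have FD: "F holomorphic_on \<D>" by (rule holomorphic_on_subset[OF holF]) (use R in auto)
  have m1: "cmod (m z) = 1" if "cmod z = 1" for z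
  proof -
    have "1 - (cmod (m z))\<^sup>2 = 0" using moebius_norm_identity[OF \<alpha> c, of z] that by (simp add: m_def)
    hence "(cmod (m z))\<^sup>2 = 1\<^sup>2" by simp
    thus ?thesis by (simp only: power2_eq_iff_nonneg norm_ge_zero zero_le_one)
  qed
  have holm: "m holomorphic_on cball 0 1"
    unfolding m_def using nz R by (intro holomorphic_intros) auto
  have ma: "m \<alpha> = 0" by (simp add: m_def)
  have F1: "circle_mean F 1 = (norm (hpoly a N))\<^sup>2"
  proof -
    have eq: "(cmod (F (of_real 1 * cis \<theta>)))\<^sup>2 / (2 * pi) =
        (cmod (\<Sum>k<N. a k * m (cis \<theta>) ^ k))\<^sup>2 * ((1 - (cmod \<alpha>)\<^sup>2) / (cmod (1 - cnj \<alpha> * cis \<theta>))\<^sup>2) / (2 * pi)" for \<theta>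
      using \<alpha>2 unfolding F_def norm_mult norm_divide by (simp add: power_mult_distrib power_divide)
    show ?thesis unfolding circle_mean_def eq norm_hpoly
      using has_integral_divide[OF circle_mean_moebius_polynomial[OF \<alpha> holm ma m1], of a N "2 * pi"]
      by (intro integral_unique) simp
  qed
  have Fr: "circle_mean F r \<le> circle_mean F 1" if "0 < r" "r < 1" for r
  proof (rule sums_le)
    show "(\<lambda>n. (cmod (taylor_coeff F n))\<^sup>2 * r ^ (2 * n)) sums circle_mean F r"
      using that R by (intro parseval_circle_mean[OF holF]) auto
    show "(\<lambda>n. (cmod (taylor_coeff F n))\<^sup>2 * 1 ^ (2 * n)) sums circle_mean F 1"
      using R by (intro parseval_circle_mean[OF holF]) auto
    show "(cmod (taylor_coeff F n))\<^sup>2 * r ^ (2 * n) \<le> (cmod (taylor_coeff F n))\<^sup>2 * 1 ^ (2 * n)" for n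
      using that by (intro mult_left_mono power_mono) auto
  qed
  have holw: "?w holomorphic_on \<D>"
  proof -
    have "(\<lambda>z. g z * (\<Sum>k<N. a k * \<phi> z ^ k)) holomorphic_on \<D>"
      using \<phi> by (intro holomorphic_intros g) (auto simp: disc_bijection_def)
    thus ?thesis
      by (rule holomorphic_transform)
         (use disc_bijection_in_disc[OF \<phi>] in \<open>simp add: weighted_composition_def hfun_hpoly\<close>)
  qed
  have le: "(cmod (?w z))\<^sup>2 \<le> B\<^sup>2 * (cmod (F z))\<^sup>2" if z: "z \<in> \<D>" for z
  proof -
    let ?d = "cmod (1 - cnj \<alpha> * z)" and ?S = "cmod (\<Sum>k<N. a k * \<phi> z ^ k)"
    have z1: "0 < 1 - (cmod z)\<^sup>2" using z by (simp add: power_less_one_iff abs_square_less_1)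
    have d: "?d > 0" using nz[of z] z R by simp
    have "(cmod (g z))\<^sup>2 * (1 - (cmod z)\<^sup>2) \<le> B\<^sup>2 * ((1 - (cmod \<alpha>)\<^sup>2) / ?d\<^sup>2 * (1 - (cmod z)\<^sup>2))"
      using bound[OF z] moebius_norm_identity[OF \<alpha> c, of z] z by (simp add: \<phi>eq[OF z])
    hence "(cmod (g z))\<^sup>2 \<le> B\<^sup>2 * ((1 - (cmod \<alpha>)\<^sup>2) / ?d\<^sup>2)"
      using z1 by (simp only: mult.assoc[symmetric] mult_le_cancel_right_pos)
    hence "(cmod (g z))\<^sup>2 * ?S\<^sup>2 \<le> B\<^sup>2 * ((1 - (cmod \<alpha>)\<^sup>2) / ?d\<^sup>2) * ?S\<^sup>2"
      by (rule mult_right_mono) auto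
    moreover have "(cmod (?w z))\<^sup>2 = (cmod (g z))\<^sup>2 * ?S\<^sup>2"
      using z disc_bijection_in_disc[OF \<phi> z] by (simp add: weighted_composition_def hfun_hpoly norm_mult power_mult_distrib)
    moreover have "(cmod (F z))\<^sup>2 = (1 - (cmod \<alpha>)\<^sup>2) / ?d\<^sup>2 * ?S\<^sup>2"
      using \<alpha>2 unfolding F_def norm_mult norm_divide \<phi>eq[OF z] m_def[symmetric]
      by (simp add: power_mult_distrib power_divide)
    ultimately show ?thesis by (simp add: mult.assoc)
  qed
  have "circle_mean ?w r \<le> (B * norm (hpoly a N))\<^sup>2" if "0 < r" "r < 1" for r
  proof -
    have "circle_mean ?w r \<le> B\<^sup>2 * circle_mean F r"
      using that by (intro circle_mean_le holw FD le) auto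
    also have "\<dots> \<le> B\<^sup>2 * circle_mean F 1" using Fr[OF that] by (intro mult_left_mono) auto
    finally show ?thesis by (simp add: F1 power_mult_distrib)
  qed
  from hardy_memI_circle_mean[OF holw _ _ this]
  show "?w \<in> H\<^sup>2" "hardy_norm ?w \<le> B * norm (hpoly a N)"
    using B by (auto simp: weighted_composition_def)
qed

lemma hpoly_diff: "hpoly a N - hpoly b M = hpoly (\<lambda>n. (if n < N then a n else 0) - (if n < M then b n else 0)) (max N M)"
  by (rule hcoeff_eqI) (auto simp: hcoeff_diff hcoeff_hpoly)

lemma tendsto_hfun:
  assumes "X \<longlonglongrightarrow> f" "z \<in> \<D>"
  shows "(\<lambda>n. hfun (X n) z) \<longlonglongrightarrow> hfun f z"
proof -
  have z1: "0 < sqrt (1 - (cmod z)\<^sup>2)" using assms(2) by (simp add: power_less_one_iff abs_square_less_1)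
  have "(\<lambda>n. norm (X n - f)) \<longlonglongrightarrow> 0"
    using assms(1) by (intro tendsto_norm_zero) (simp add: LIM_zero_iff)
  hence "(\<lambda>n. norm (X n - f) / sqrt (1 - (cmod z)\<^sup>2)) \<longlonglongrightarrow> 0"
    by (rule tendsto_divide_zero)
  moreover have "norm (hfun (X n) z - hfun f z) \<le> norm (X n - f) / sqrt (1 - (cmod z)\<^sup>2)" for n
    using norm_hfun_le[OF assms(2), of "X n - f"] z1 by (simp add: hfun_diff pos_le_divide_eq)
  ultimately have "(\<lambda>n. hfun (X n) z - hfun f z) \<longlonglongrightarrow> 0"
    by (rule Lim_null_comparison[OF always_eventually[OF allI], rotated])
  thus ?thesis by (rule LIM_zero_cancel)
qed

text \<open>
  The bound for polynomials makes the images of the Taylor polynomials a Cauchy sequence,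
  whose limit is identified by its values in the disc.
\<close>

lemma weighted_composition_bound:
  assumes \<phi>: "disc_bijection \<phi>" and g: "g holomorphic_on \<D>" and B: "0 \<le> B"
    and bound: "\<And>z. z \<in> \<D> \<Longrightarrow> (cmod (g z))\<^sup>2 * (1 - (cmod z)\<^sup>2) \<le> B\<^sup>2 * (1 - (cmod (\<phi> z))\<^sup>2)"
  shows "weighted_composition g \<phi> (hfun f) \<in> H\<^sup>2"
    and "hardy_norm (weighted_composition g \<phi> (hfun f)) \<le> B * norm f"
proof -
  note poly = weighted_composition_hpoly[OF \<phi> g B bound]
  define P where "P N = hpoly (hcoeff f) N" for N
  define X where "X N = Hardy (weighted_composition g \<phi> (hfun (P N)))" for N
  have hX: "hfun (X N) = weighted_composition g \<phi> (hfun (P N))" for N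
    unfolding X_def P_def by (rule Hardy_inverse[OF poly(1)])
  have P: "P \<longlonglongrightarrow> f" unfolding P_def by (rule hpoly_tendsto)
  have diff: "norm (X N - X M) \<le> B * norm (P N - P M)" for N M
  proof -
    have X: "hfun (X N - X M) = weighted_composition g \<phi> (hfun (P N - P M))"
      by (rule ext) (simp add: hfun_diff hX weighted_composition_def right_diff_distrib)
    show ?thesis unfolding norm_hardy_def[of "X N - X M"] X unfolding P_def hpoly_diff by (rule poly(2))
  qed
  have "Cauchy X"
  proof (rule CauchyI)
    fix e :: real assume e: "0 < e"
    have "Cauchy P" using P by (rule LIMSEQ_imp_Cauchy)
    then obtain M where M: "\<forall>m\<ge>M. \<forall>n\<ge>M. norm (P m - P n) < e / (B + 1)"
      using CauchyD[of P "e / (B + 1)"] e B by (auto simp: divide_pos_pos)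
    have "norm (X m - X n) < e" if "m \<ge> M" "n \<ge> M" for m n
    proof -
      have "norm (X m - X n) \<le> (B + 1) * norm (P m - P n)"
        by (rule order.trans[OF diff mult_right_mono]) auto
      also have "\<dots> < (B + 1) * (e / (B + 1))" using M that B by (intro mult_strict_left_mono) auto
      finally show ?thesis using B by simp
    qed
    thus "\<exists>M. \<forall>m\<ge>M. \<forall>n\<ge>M. norm (X m - X n) < e" by blast
  qed
  then obtain L where L: "X \<longlonglongrightarrow> L" by (auto dest: Cauchy_convergent convergentD)
  have hL: "hfun L = weighted_composition g \<phi> (hfun f)"
  proof
    fix z
    show "hfun L z = weighted_composition g \<phi> (hfun f) z"
    proof (cases "z \<in> \<D>")
      case True
      have "(\<lambda>N. g z * hfun (P N) (\<phi> z)) \<longlonglongrightarrow> g z * hfun f (\<phi> z)"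
        by (intro tendsto_intros tendsto_hfun P disc_bijection_in_disc[OF \<phi> True])
      moreover have "hfun (X N) z = g z * hfun (P N) (\<phi> z)" for N
        using True by (simp add: hX weighted_composition_def)
      ultimately have "hfun L z = g z * hfun f (\<phi> z)"
        using LIMSEQ_unique[OF tendsto_hfun[OF L True]] by simp
      thus ?thesis using True by (simp add: weighted_composition_def)
    qed (simp add: hfun_outside weighted_composition_def)
  qed
  thus "weighted_composition g \<phi> (hfun f) \<in> H\<^sup>2" by (metis hfun)
  have "norm (X N) \<le> B * norm (P N)" for N
    unfolding norm_hardy_def[of "X N"] hX unfolding P_def by (rule poly(2))
  hence "norm L \<le> B * norm f"
    by (intro LIMSEQ_le[OF tendsto_norm[OF L] tendsto_mult[OF tendsto_const tendsto_norm[OF P]]]) auto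
  thus "hardy_norm (weighted_composition g \<phi> (hfun f)) \<le> B * norm f"
    by (simp add: norm_hardy_def hL)
qed

lemma disc_bijection_distortion:
  assumes \<phi>: "disc_bijection \<phi>"
  obtains \<delta> where "0 < \<delta>" "\<And>z. z \<in> \<D> \<Longrightarrow> \<delta> * (1 - (cmod z)\<^sup>2) \<le> 1 - (cmod (\<phi> z))\<^sup>2"
proof -
  obtain \<alpha> c where \<alpha>: "cmod \<alpha> < 1" and c: "cmod c = 1"
    and \<phi>eq: "\<And>z. z \<in> \<D> \<Longrightarrow> \<phi> z = c * (z - \<alpha>) / (1 - cnj \<alpha> * z)"
    using disc_bijection_moebius[OF \<phi>] by blast
  have \<alpha>2: "(cmod \<alpha>)\<^sup>2 < 1" using \<alpha> by (simp add: power_less_one_iff abs_square_less_1)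
  show ?thesis
  proof (rule that[of "(1 - (cmod \<alpha>)\<^sup>2) / 2\<^sup>2"])
    fix z :: complex assume z: "z \<in> \<D>"
    have d: "cmod (1 - cnj \<alpha> * z) > 0" using moebius_denominator_nonzero[OF \<alpha>, of z] z by simp
    have "cmod (1 - cnj \<alpha> * z) \<le> 1 + cmod \<alpha> * cmod z"
      using norm_triangle_ineq4[of 1 "cnj \<alpha> * z"] by (simp add: norm_mult)
    also have "cmod \<alpha> * cmod z \<le> 1 * 1" using \<alpha> z by (intro mult_mono) auto
    finally have "(cmod (1 - cnj \<alpha> * z))\<^sup>2 \<le> 2\<^sup>2" by (intro power_mono) auto
    moreover have "0 < 1 - (cmod z)\<^sup>2" using z by (simp add: power_less_one_iff abs_square_less_1)
    ultimately have "(1 - (cmod \<alpha>)\<^sup>2) / 2\<^sup>2 * (1 - (cmod z)\<^sup>2) \<le> (1 - (cmod \<alpha>)\<^sup>2) / (cmod (1 - cnj \<alpha> * z))\<^sup>2 * (1 - (cmod z)\<^sup>2)"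
      using \<alpha>2 d by (intro mult_right_mono divide_left_mono mult_pos_pos zero_less_power) auto
    also have "\<dots> = 1 - (cmod (\<phi> z))\<^sup>2"
      unfolding \<phi>eq[OF z] using z by (intro moebius_norm_identity[OF \<alpha> c, symmetric]) simp
    finally show "(1 - (cmod \<alpha>)\<^sup>2) / 2\<^sup>2 * (1 - (cmod z)\<^sup>2) \<le> 1 - (cmod (\<phi> z))\<^sup>2" .
  qed (use \<alpha>2 in auto)
qed

lemma bounded_holomorphic_bound: "g \<in> H\<^sup>\<infinity> \<Longrightarrow> \<exists>C. \<forall>z\<in>\<D>. cmod (g z) \<le> C"
  unfolding bounded_holomorphic_def bounded_iff by blast

lemma bounded_holomorphicI: "g holomorphic_on \<D> \<Longrightarrow> (\<And>z. z \<in> \<D> \<Longrightarrow> cmod (g z) \<le> C) \<Longrightarrow> g \<in> H\<^sup>\<infinity>"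
  unfolding bounded_holomorphic_def bounded_iff by blast

text \<open>
  The definition is meaningful only for bounded holomorphic \<open>g\<close> and a holomorphic bijection \<open>\<phi>\<close>
  of the disc.
\<close>

definition wcop :: "(complex \<Rightarrow> complex) \<Rightarrow> (complex \<Rightarrow> complex) \<Rightarrow> hardy \<Rightarrow>\<^sub>L hardy" where
  "wcop g \<phi> = Blinfun (\<lambda>f. Hardy (weighted_composition g \<phi> (hfun f)))"

lemma
  assumes g: "g \<in> H\<^sup>\<infinity>" and \<phi>: "disc_bijection \<phi>"
  shows hfun_wcop_eq: "hfun (wcop g \<phi> f) = weighted_composition g \<phi> (hfun f)"
    and norm_wcop_le: "\<lbrakk>0 \<le> B; \<And>z. z \<in> \<D> \<Longrightarrow> (cmod (g z))\<^sup>2 * (1 - (cmod z)\<^sup>2) \<le> B\<^sup>2 * (1 - (cmod (\<phi> z))\<^sup>2)\<rbrakk> \<Longrightarrow> norm (wcop g \<phi>) \<le> B"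
proof -
  have gh: "g holomorphic_on \<D>" using g by (auto simp: bounded_holomorphic_def)
  obtain C where C: "\<And>z. z \<in> \<D> \<Longrightarrow> cmod (g z) \<le> C"
    using bounded_holomorphic_bound[OF g] by blast
  obtain \<delta> where \<delta>: "0 < \<delta>" "\<And>z. z \<in> \<D> \<Longrightarrow> \<delta> * (1 - (cmod z)\<^sup>2) \<le> 1 - (cmod (\<phi> z))\<^sup>2"
    using disc_bijection_distortion[OF \<phi>] by blast
  define K where "K = C / sqrt \<delta>"
  have C0: "0 \<le> C" using order.trans[OF norm_ge_zero C[of 0]] by simp
  have K: "0 \<le> K" using C0 \<delta> by (simp add: K_def)
  have Kb: "(cmod (g z))\<^sup>2 * (1 - (cmod z)\<^sup>2) \<le> K\<^sup>2 * (1 - (cmod (\<phi> z))\<^sup>2)" if z: "z \<in> \<D>" for z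
  proof -
    have z1: "0 \<le> 1 - (cmod z)\<^sup>2" using z by (simp add: power_le_one_iff abs_square_le_1)
    have "(cmod (g z))\<^sup>2 * (1 - (cmod z)\<^sup>2) \<le> C\<^sup>2 * (1 - (cmod z)\<^sup>2)"
      using C[OF z] z1 by (intro mult_right_mono power_mono) auto
    also have "\<dots> = K\<^sup>2 * (\<delta> * (1 - (cmod z)\<^sup>2))" using \<delta>(1) by (simp add: K_def power_divide)
    also have "\<dots> \<le> K\<^sup>2 * (1 - (cmod (\<phi> z))\<^sup>2)" using \<delta>(2)[OF z] by (intro mult_left_mono) auto
    finally show ?thesis .
  qed
  note mem = weighted_composition_bound(1)[OF \<phi> gh K Kb]
  let ?T = "\<lambda>f. Hardy (weighted_composition g \<phi> (hfun f))"
  have h: "hfun (?T f) = weighted_composition g \<phi> (hfun f)" for f by (rule Hardy_inverse[OF mem])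
  have "bounded_linear ?T"
  proof (rule bounded_linear_intro[where K = K])
    show "norm (?T f) \<le> norm f * K" for f
      using weighted_composition_bound(2)[OF \<phi> gh K Kb, of f]
      unfolding norm_hardy_def h by (simp add: norm_hardy_def mult.commute)
    show "?T (x + y) = ?T x + ?T y" for x y
      by (rule hardy_eqI) (simp only: h hfun_add, simp add: weighted_composition_def hfun_add ring_distribs)
    show "?T (r *\<^sub>R x) = r *\<^sub>R ?T x" for r x
      by (rule hardy_eqI) (simp only: h hfun_scaleR, simp add: weighted_composition_def hfun_scaleR)
  qed
  hence ap: "blinfun_apply (wcop g \<phi>) = ?T" unfolding wcop_def by (rule bounded_linear_Blinfun_apply)
  show eq: "hfun (wcop g \<phi> f) = weighted_composition g \<phi> (hfun f)" for f unfolding ap h ..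
  assume B: "0 \<le> B" "\<And>z. z \<in> \<D> \<Longrightarrow> (cmod (g z))\<^sup>2 * (1 - (cmod z)\<^sup>2) \<le> B\<^sup>2 * (1 - (cmod (\<phi> z))\<^sup>2)"
  show "norm (wcop g \<phi>) \<le> B"
  proof (rule norm_blinfun_bound)
    show "norm (wcop g \<phi> f) \<le> B * norm f" for f
      using weighted_composition_bound(2)[OF \<phi> gh B, of f] by (simp add: norm_hardy_def eq)
  qed fact
qed

lemma hfun_wcop:
  assumes "g \<in> H\<^sup>\<infinity>" "disc_bijection \<phi>" "z \<in> \<D>"
  shows "hfun (wcop g \<phi> f) z = g z * hfun f (\<phi> z)"
  using assms by (simp add: hfun_wcop_eq weighted_composition_def)

abbreviation hmult :: "(complex \<Rightarrow> complex) \<Rightarrow> hardy \<Rightarrow>\<^sub>L hardy" where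
  "hmult g \<equiv> wcop g (\<lambda>z. z)"

lemma hfun_hmult: "g \<in> H\<^sup>\<infinity> \<Longrightarrow> z \<in> \<D> \<Longrightarrow> hfun (hmult g f) z = g z * hfun f z"
  by (simp add: hfun_wcop disc_bijection_id)

lemma norm_hmult_le:
  assumes "g \<in> H\<^sup>\<infinity>" "\<And>z. z \<in> \<D> \<Longrightarrow> cmod (g z) \<le> B"
  shows "norm (hmult g) \<le> B"
proof (rule norm_wcop_le[OF assms(1) disc_bijection_id])
  show "0 \<le> B" using order.trans[OF norm_ge_zero assms(2)[of 0]] by simp
  show "(cmod (g z))\<^sup>2 * (1 - (cmod z)\<^sup>2) \<le> B\<^sup>2 * (1 - (cmod z)\<^sup>2)" if "z \<in> \<D>" for z
    using that assms(2)[OF that] by (intro mult_right_mono power_mono) (auto simp: power_le_one_iff abs_square_le_1)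
qed

text \<open>
  The type carries real scalars only; complex scalars act as multiplications by constants.
\<close>

definition hscale :: "complex \<Rightarrow> hardy \<Rightarrow>\<^sub>L hardy" where
  "hscale c = hmult (\<lambda>_. c)"

lemma bounded_holomorphic_const: "(\<lambda>_. c) \<in> H\<^sup>\<infinity>"
  by (auto simp: bounded_holomorphic_def image_constant_conv)

lemma hfun_hscale: "hfun (hscale c f) z = c * hfun f z"
  by (cases "z \<in> \<D>") (simp_all add: hscale_def hfun_hmult bounded_holomorphic_const hfun_outside del: mem_ball_0)

lemma norm_hscale: "norm (hscale c f) = cmod c * norm f"
proof -
  have "hfun (hscale c f) = (\<lambda>z. c * hfun f z)" by (simp add: hfun_hscale fun_eq_iff)
  thus ?thesis unfolding norm_hardy_def using hardy_cmult(2)[OF hfun, of c f] by simp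
qed

lemma hscale_mult: "hscale (x * y) f = hscale x (hscale y f)"
  by (rule hardy_eqI) (simp only: hfun_hscale mult.assoc)

lemma hscale_commute: "hscale x (hscale y f) = hscale y (hscale x f)"
  by (metis hscale_mult mult.commute)

lemma hscale_one: "hscale 1 f = f"
  by (rule hardy_eqI) (simp only: hfun_hscale mult_1)

lemma bounded_linear_hscale: "bounded_linear hscale"
proof (rule bounded_linear_intro[where K = 1])
  show "norm (hscale c) \<le> norm c * 1" for c
    unfolding hscale_def by (intro norm_hmult_le bounded_holomorphic_const) auto
qed (rule blinfun_eqI; rule hardy_eqI; simp add: blinfun.bilinear_simps hfun_simps hfun_hscale ring_distribs scaleR_conv_of_real)+

lemma bounded_holomorphic_mult: "f \<in> H\<^sup>\<infinity> \<Longrightarrow> g \<in> H\<^sup>\<infinity> \<Longrightarrow> (\<lambda>z. f z * g z) \<in> H\<^sup>\<infinity>"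
proof -
  assume fg: "f \<in> H\<^sup>\<infinity>" "g \<in> H\<^sup>\<infinity>"
  obtain B C where "\<And>z. z \<in> \<D> \<Longrightarrow> cmod (f z) \<le> B" "\<And>z. z \<in> \<D> \<Longrightarrow> cmod (g z) \<le> C"
    using fg[THEN bounded_holomorphic_bound] by blast
  hence "cmod (f z * g z) \<le> B * C" if "z \<in> \<D>" for z
    unfolding norm_mult using that by (intro mult_mono) (auto intro: order.trans[OF norm_ge_zero])
  thus ?thesis using fg by (intro bounded_holomorphicI holomorphic_intros) (auto simp: bounded_holomorphic_def)
qed

lemma hpoly_Suc: "hpoly a (Suc N) = hpoly a N + hscale (a N) (hmono N)"
  by (rule hardy_eqI) (simp add: hfun_hpoly hfun_hmono hfun_add hfun_hscale)

text \<open>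
  Through this expansion two bounded operators that commute with complex scalars are
  compared on monomials only.
\<close>

lemma hardy_expansion: "(\<lambda>k. hscale (hcoeff f k) (hmono k)) sums f"
proof -
  have "(\<Sum>k<N. hscale (hcoeff f k) (hmono k)) = hpoly (hcoeff f) N" for N
  proof (induction N)
    case 0 show ?case by (rule hardy_eqI) (simp add: hfun_0 hfun_hpoly)
  qed (simp only: hpoly_Suc[of "hcoeff f"] sum.lessThan_Suc)
  thus ?thesis using hpoly_tendsto[of f] by (simp only: sums_def)
qed

section \<open>The spectral projection of a circle\<close>

lemma inverse_commute:
  assumes "\<And>f. G (D f) = f" "\<And>f. D (G f) = f" "\<And>f. B (D f) = D (B f)"
  shows "B (G f) = G (B f)"
  by (metis assms)

lemma has_integral_cis_int:
  "((\<lambda>x. cis (- (real_of_int n * x))) has_integral (if n = 0 then of_real (2 * pi) else 0)) {0..2 * pi}"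
proof (cases "n = 0")
  case True
  thus ?thesis using has_integral_const_real[of "1 :: complex" 0 "2 * pi"] by (simp add: scaleR_conv_of_real)
next
  case False
  have "((\<lambda>x. exp (- (\<i> * of_int n * of_real x)) / (- \<i> * of_int n)) has_vector_derivative exp (- (\<i> * of_int n * of_real x)))
      (at x within {0..2*pi})" for x
    using False
    by (intro has_vector_derivative_real_field[of "\<lambda>z. exp (- (\<i> * of_int n * z)) / (- \<i> * of_int n)"])
       (auto intro!: derivative_eq_intros)
  hence "((\<lambda>x. cis (- (real_of_int n * x)) / (- \<i> * of_int n)) has_vector_derivative cis (- (real_of_int n * x)))
      (at x within {0..2*pi})" for x
    by (simp add: cis_conv_exp mult_ac)
  hence "((\<lambda>x. cis (- (real_of_int n * x))) has_integral
      (cis (- (real_of_int n * (2 * pi))) / (- \<i> * of_int n) - cis (- (real_of_int n * 0)) / (- \<i> * of_int n))) {0..2 * pi}"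
    by (intro fundamental_theorem_of_calculus) auto
  moreover have "cis (- (real_of_int n * (2 * pi))) = 1"
    using cis_multiple_2pi[of "- of_int n"] by (simp add: mult_ac)
  ultimately show ?thesis using False by simp
qed

lemma blinfun_compose_assoc: "(R o\<^sub>L S) o\<^sub>L T = R o\<^sub>L (S o\<^sub>L T)"
  by (rule blinfun_eqI) simp

text \<open>
  \<open>G x\<close> is the inverse of \<open>I - cis x A\<close>. The map \<open>c\<close> supplies the complex scalars of a space that
  is formally a real Banach space.
\<close>

locale circle_resolvent =
  fixes c :: "complex \<Rightarrow> 'a::banach \<Rightarrow>\<^sub>L 'a" and A :: "'a \<Rightarrow>\<^sub>L 'a" and G :: "real \<Rightarrow> 'a \<Rightarrow>\<^sub>L 'a"
  assumes bounded_linear_c: "bounded_linear c"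
    and c_one: "c 1 f = f"
    and c_mult: "c (z * w) f = c z (c w f)"
    and A_c: "A (c z f) = c z (A f)"
    and G_left: "G x (f - c (cis x) (A f)) = f"
    and G_right: "G x f - c (cis x) (A (G x f)) = f"
begin

lemmas c_linear = linear_simps[OF bounded_linear_c] linear_simps[OF blinfun.bounded_linear_right]

lemma c_commute: "c z (c w f) = c w (c z f)"
  by (metis c_mult mult.commute)

lemma c_of_real: "c (of_real r) f = r *\<^sub>R f"
  using linear_simps(5)[OF bounded_linear_c, of r 1] by (simp add: of_real_def blinfun.scaleR_left c_one)

lemma G_c: "G x (c z f) = c z (G x f)"
  by (rule inverse_commute[where D = "\<lambda>f. f - c (cis x) (A f)", symmetric])
     (rule G_left, rule G_right, simp add: blinfun.diff_right A_c c_commute)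

lemma G_A: "G x (A f) = A (G x f)"
  by (rule inverse_commute[where D = "\<lambda>f. f - c (cis x) (A f)", symmetric])
     (rule G_left, rule G_right, simp add: blinfun.diff_right A_c)

lemma c_cis_A_G: "c (cis x) (A (G x f)) = G x f - f"
  using G_right[of x f] by (simp add: algebra_simps)

lemma resolvent_identity: "G y f - G x f = G y (c (cis y - cis x) (A (G x f)))"
proof -
  have "G y f = G y (G x f - c (cis x) (A (G x f)))" by (simp add: G_right)
  moreover have "G x f = G y (G x f - c (cis y) (A (G x f)))" by (simp add: G_left)
  ultimately have "G y f - G x f = G y (c (cis y) (A (G x f)) - c (cis x) (A (G x f)))"
    by (metis (no_types, lifting) blinfun.diff_right diff_diff_eq2 diff_add_cancel add_diff_cancel_left' add.commute)
  also have "c (cis y) (A (G x f)) - c (cis x) (A (G x f)) = c (cis y - cis x) (A (G x f))"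
    by (simp add: linear_simps(2)[OF bounded_linear_c] blinfun.diff_left)
  finally show ?thesis .
qed

lemma resolvent_identity_compose: "G y - G x = G y o\<^sub>L c (cis y - cis x) o\<^sub>L A o\<^sub>L G x"
  by (rule blinfun_eqI) (simp add: blinfun.diff_left resolvent_identity)

lemma G_periodic: "G (x + 2 * pi) = G x"
  using resolvent_identity_compose[of "x + 2 * pi" x] by (simp add: linear_simps(3)[OF bounded_linear_c] flip: cis_mult)

text \<open>
  The resolvent identity bounds \<open>G y - G x\<close> by a small multiple of \<open>norm (G y)\<close>, which first
  bounds \<open>norm (G y)\<close> by \<open>2 * norm (G x)\<close> near \<open>x\<close>.
\<close>

lemma isCont_G: "isCont G x"
proof -
  have "isCont cis x" unfolding cis_conv_exp[abs_def] by (intro continuous_intros)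
  hence "((\<lambda>y. cis y - cis x) \<longlongrightarrow> cis x - cis x) (at x)"
    unfolding isCont_def by (intro tendsto_intros)
  hence "((\<lambda>y. c (cis y - cis x)) \<longlongrightarrow> c (cis x - cis x)) (at x)"
    by (rule bounded_linear.tendsto[OF bounded_linear_c])
  hence cc: "((\<lambda>y. c (cis y - cis x) o\<^sub>L A o\<^sub>L G x) \<longlongrightarrow> c (cis x - cis x) o\<^sub>L A o\<^sub>L G x) (at x)"
    by (intro bounded_bilinear.tendsto[OF bounded_bilinear_blinfun_compose] tendsto_const)
  define h where "h y = norm (c (cis y - cis x) o\<^sub>L A o\<^sub>L G x)" for y
  have h: "(h \<longlongrightarrow> 0) (at x)"
    using tendsto_norm[OF cc] by (simp add: h_def[abs_def] linear_simps(3)[OF bounded_linear_c])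
  have le: "norm (G y - G x) \<le> norm (G y) * h y" for y
    using norm_blinfun_compose[of "G y" "c (cis y - cis x) o\<^sub>L A o\<^sub>L G x"]
    by (simp add: resolvent_identity_compose h_def blinfun_compose_assoc)
  have "eventually (\<lambda>y. h y < 1/2) (at x)" using order_tendstoD(2)[OF h, of "1/2"] by simp
  hence "eventually (\<lambda>y. norm (G y - G x) \<le> 2 * norm (G x) * h y) (at x)"
  proof eventually_elim
    case (elim y)
    have "h y \<ge> 0" by (simp add: h_def)
    have "norm (G y) \<le> norm (G x) + norm (G y - G x)" by (rule norm_triangle_sub)
    also have "\<dots> \<le> norm (G x) + norm (G y) * (1/2)"
      using le[of y] elim by (smt (verit) mult_left_mono norm_ge_zero)
    finally have "norm (G y) \<le> 2 * norm (G x)" by simp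
    with le[of y] \<open>h y \<ge> 0\<close> show ?case by (meson mult_right_mono order_trans)
  qed
  moreover have "((\<lambda>y. 2 * norm (G x) * h y) \<longlongrightarrow> 0) (at x)" using tendsto_mult_right_zero[OF h] .
  ultimately have "((\<lambda>y. G y - G x) \<longlongrightarrow> 0) (at x)" by (rule Lim_null_comparison)
  thus ?thesis unfolding isCont_def by (rule LIM_zero_cancel)
qed

lemma continuous_on_G: "continuous_on S G"
  by (simp add: continuous_at_imp_continuous_on isCont_G)

abbreviation mode :: "int \<Rightarrow> real \<Rightarrow> 'a \<Rightarrow>\<^sub>L 'a" where
  "mode n x \<equiv> c (cis (- (real_of_int n * x)))"

text \<open>
  Up to the factor \<open>2 * pi\<close>, these are the Laurent coefficients of the resolvent on the circle.
\<close>

definition fourier :: "int \<Rightarrow> 'a \<Rightarrow>\<^sub>L 'a" where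
  "fourier n = integral {0..2 * pi} (\<lambda>x. mode n x o\<^sub>L G x)"

lemma continuous_on_integrand: "continuous_on S (\<lambda>x. mode n x o\<^sub>L G x)"
  by (intro bounded_bilinear.continuous_on[OF bounded_bilinear_blinfun_compose] continuous_on_G
      bounded_linear.continuous_on[OF bounded_linear_c] continuous_intros)

lemma has_integral_fourier:
  "((\<lambda>x. mode n x o\<^sub>L G x) has_integral fourier n) {0..2 * pi}"
  unfolding fourier_def
  by (intro integrable_integral integrable_continuous_interval continuous_on_integrand)

lemma has_integral_fourier_apply:
  "((\<lambda>x. mode n x (G x f)) has_integral fourier n f) {0..2 * pi}"
  using has_integral_linear[OF has_integral_fourier[of n] blinfun.bounded_linear_left[of f]] by (simp add: o_def)

lemma fourier_A: "fourier n (A f) = A (fourier n f)"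
proof -
  have "((\<lambda>x. A (mode n x (G x f))) has_integral A (fourier n f)) {0..2 * pi}"
    using has_integral_linear[OF has_integral_fourier_apply blinfun.bounded_linear_right[of A], of n f] by (simp add: o_def)
  thus ?thesis using has_integral_fourier_apply[of n "A f"]
    by (simp add: G_A A_c has_integral_unique)
qed

lemma fourier_c: "fourier n (c z f) = c z (fourier n f)"
proof -
  have "((\<lambda>x. c z (mode n x (G x f))) has_integral c z (fourier n f)) {0..2 * pi}"
    using has_integral_linear[OF has_integral_fourier_apply blinfun.bounded_linear_right[of "c z"], of n f] by (simp add: o_def)
  thus ?thesis using has_integral_fourier_apply[of n "c z f"]
    by (simp add: G_c c_commute[of z] has_integral_unique)
qed

text \<open>
  Integrate \<open>G x f = f + cis x A (G x f)\<close> against the \<open>n\<close>-th mode.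
\<close>

lemma fourier_rec: "fourier n f = (if n = 0 then (2 * pi) *\<^sub>R f else 0) + A (fourier (n - 1) f)"
proof -
  have i1: "((\<lambda>x. A (mode (n - 1) x (G x f))) has_integral A (fourier (n - 1) f)) {0..2 * pi}"
    using has_integral_linear[OF has_integral_fourier_apply blinfun.bounded_linear_right[of A], of "n - 1" f] by (simp add: o_def)
  have "bounded_linear (\<lambda>z. c z f)"
    using bounded_linear_compose[OF blinfun.bounded_linear_left bounded_linear_c, of f] by simp
  from has_integral_linear[OF has_integral_cis_int this, of n]
  have i2: "((\<lambda>x. mode n x f) has_integral (if n = 0 then (2 * pi) *\<^sub>R f else 0)) {0..2 * pi}"
    using c_of_real[of "2 * pi" f] by (cases "n = 0") (simp_all add: o_def c_linear blinfun.zero_left)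
  have eq: "mode n x (G x f) =
      mode n x f + A (mode (n - 1) x (G x f))" for x
  proof -
    have "cis (- (real_of_int (n - 1) * x)) = cis (- (real_of_int n * x)) * cis x"
      by (simp add: cis_mult algebra_simps)
    hence "A (mode (n - 1) x (G x f)) = mode n x (c (cis x) (A (G x f)))"
      by (simp add: A_c c_mult)
    thus ?thesis by (simp add: c_cis_A_G blinfun.diff_right)
  qed
  from has_integral_add[OF i2 i1] show ?thesis
    using has_integral_fourier_apply[of n f] unfolding eq by (rule has_integral_unique[rotated])
qed

lemma fourier_nonneg: "fourier (int n) f = (blinfun_apply A ^^ n) (fourier 0 f)"
proof (induction n)
  case (Suc n)
  show ?case using fourier_rec[of "int (Suc n)" f] Suc by simp
qed simp

lemma integral_periodic_shift:
  fixes H :: "real \<Rightarrow> 'b::banach"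
  assumes H: "continuous_on UNIV H" "\<And>x. H (x + 2 * pi) = H x" and t: "0 \<le> t" "t \<le> 2 * pi"
  shows "((\<lambda>x. H (x + t)) has_integral integral {0..2 * pi} H) {0..2 * pi}"
proof -
  have int: "H integrable_on {u..v}" for u v
    by (intro integrable_continuous_interval continuous_on_subset[OF H(1)]) auto
  have "integral {2 * pi..t + 2 * pi} H = integral {0..t} (\<lambda>x. H (x + 2 * pi))"
    using integral_shift_Icc_real[of 0 t H "2 * pi"] by (simp add: o_def add.commute[of _ "2 * pi"])
  also have "\<dots> = integral {0..t} H" by (simp add: H(2))
  finally have "integral {t..t + 2 * pi} H = integral {0..2 * pi} H"
    using Henstock_Kurzweil_Integration.integral_combine[of t "2 * pi" "t + 2 * pi" H] Henstock_Kurzweil_Integration.integral_combine[of 0 t "2 * pi" H] int t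
    by (simp add: add.commute)
  hence "(H has_integral integral {0..2 * pi} H) {0 + t..2 * pi + t}"
    using integrable_integral[OF int[of t "t + 2 * pi"]] by (simp add: add.commute)
  thus ?thesis using has_integral_shift_Icc_real[of H t _ 0 "2 * pi"] by (simp add: o_def add.commute)
qed

lemma norm_fourier_le: obtains C where "\<And>n. norm (fourier n) \<le> C"
proof -
  have "bounded (G ` {0..2 * pi})"
    by (intro compact_imp_bounded compact_continuous_image continuous_on_G) auto
  then obtain K where K: "\<And>x. x \<in> {0..2 * pi} \<Longrightarrow> norm (G x) \<le> K" unfolding bounded_iff by blast
  obtain k where k: "\<And>z. norm (c z) \<le> norm z * k" using bounded_linear.bounded[OF bounded_linear_c] by blast
  have k0: "0 \<le> k" using order.trans[OF norm_ge_zero k[of 1]] by simp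
  have "norm (fourier n) \<le> k * K * (2 * pi - 0)" for n
    unfolding fourier_def
  proof (rule integral_bound)
    fix x assume x: "x \<in> {0..2 * pi}"
    have "norm (mode n x o\<^sub>L G x) \<le> norm (mode n x) * norm (G x)"
      by (rule norm_blinfun_compose)
    also have "\<dots> \<le> k * K" using k[of "cis _"] K[OF x] k0 by (intro mult_mono) auto
    finally show "norm (mode n x o\<^sub>L G x) \<le> k * K" .
  qed (auto intro: continuous_on_integrand)
  thus ?thesis using that by blast
qed

text \<open>
  The Riesz projection onto the part of the space on which \<open>A\<close> has its spectrum inside the
  unit circle.
\<close>

definition proj :: "'a \<Rightarrow>\<^sub>L 'a" where "proj = (1 / (2 * pi)) *\<^sub>R fourier 0"

lemma fourier_0_eq: "fourier 0 f = (2 * pi) *\<^sub>R proj f"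
  by (simp add: proj_def blinfun.scaleR_left)

lemma proj_c: "proj (c z f) = c z (proj f)"
  by (simp add: proj_def blinfun.scaleR_left blinfun.scaleR_right fourier_c)

lemma fourier_0: "fourier 0 = integral {0..2 * pi} G"
  unfolding fourier_def by (intro arg_cong[of _ _ "integral _"] ext blinfun_eqI) (simp add: c_one)

lemma has_integral_G_shift:
  fixes B :: "'a \<Rightarrow>\<^sub>L 'a"
  assumes "0 \<le> t" "t \<le> 2 * pi"
  shows "((\<lambda>y. B (G (y + t) f)) has_integral B (fourier 0 f)) {0..2 * pi}"
proof -
  have "((\<lambda>y. G (y + t)) has_integral fourier 0) {0..2 * pi}"
    unfolding fourier_0 by (intro integral_periodic_shift continuous_on_G G_periodic assms)
  from has_integral_linear[OF has_integral_linear[OF this blinfun.bounded_linear_left[of f]] blinfun.bounded_linear_right[of B]]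
  show ?thesis by (simp add: o_def)
qed

lemma has_integral_G: "((\<lambda>x. G x f) has_integral fourier 0 f) {0..2 * pi}"
  using has_integral_fourier_apply[where n = 0 and f = f] by (simp add: c_one)

lemma resolvent_product: "c (cis t - 1) (G (y + t) (G y f)) = c (cis t) (G (y + t) f) - G y f"
proof -
  have "cis (y + t) - cis y = (cis t - 1) * cis y" by (simp add: cis_mult left_diff_distrib add.commute)
  hence "G (y + t) f - G y f = c (cis t - 1) (G (y + t) (G y f - f))"
    using resolvent_identity[of "y + t" f y] by (simp only: c_mult c_cis_A_G G_c)
  thus ?thesis
    by (simp add: blinfun.diff_right linear_simps(2)[OF bounded_linear_c] blinfun.diff_left c_one algebra_simps)
qed

text \<open>
  By the resolvent identity the mean of \<open>G (y + t) (G y f)\<close> over \<open>y\<close> is \<open>proj f\<close> for every \<open>t\<close>.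
  Taking the mean over \<open>t\<close> first gives \<open>proj (proj f)\<close>.
\<close>

lemma proj_idem: "proj (proj f) = proj f"
proof -
  (* Averaging the resolvent product over y divides out cis t - 1, whence the exclusion of the end points. *)
  have mean: "((\<lambda>y. G (y + t) (G y f)) has_integral fourier 0 f) {0..2 * pi}" if t: "0 < t" "t < 2 * pi" for t
  proof -
    have "cis t \<noteq> 1"
    proof
      assume "cis t = 1"
      hence "cos t = 1" by (simp add: complex_eq_iff)
      hence "sin (t / 2) = 0" using cos_double_sin[of "t / 2"] by simp
      thus False using t sin_gt_zero[of "t / 2"] by simp
    qed
    hence inv: "c (1 / (cis t - 1)) (c (cis t - 1) g) = g" for g by (simp add: c_one flip: c_mult)
    have "((\<lambda>y. c (cis t) (G (y + t) f)) has_integral c (cis t) (fourier 0 f)) {0..2 * pi}"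
      using t by (intro has_integral_G_shift) auto
    from has_integral_diff[OF this has_integral_G[of f]]
    have "((\<lambda>y. c (cis t - 1) (G (y + t) (G y f))) has_integral c (cis t - 1) (fourier 0 f)) {0..2 * pi}"
      unfolding resolvent_product by (simp add: linear_simps(2)[OF bounded_linear_c] blinfun.diff_left c_one)
    from has_integral_linear[OF this blinfun.bounded_linear_right[of "c (1 / (cis t - 1))"]]
    show ?thesis by (simp add: o_def inv)
  qed
  have swap: "integral {0..2 * pi} (\<lambda>y. integral {0..2 * pi} (\<lambda>t. G (y + t) (G y f))) =
      integral {0..2 * pi} (\<lambda>t. integral {0..2 * pi} (\<lambda>y. G (y + t) (G y f)))"
    unfolding interval_cbox
  proof (rule integral_swap_continuous)
    have cG: "continuous_on S (\<lambda>p. G (h p))" if "continuous_on S h" for S :: "(real \<times> real) set" and h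
      by (rule continuous_on_compose2[OF continuous_on_G[of UNIV] that]) auto
    show "continuous_on (cbox (0, 0) (2 * pi, 2 * pi)) (\<lambda>(y, t). G (y + t) (G y f))"
      unfolding split_def
      by (intro bounded_bilinear.continuous_on[OF bounded_bilinear_blinfun_apply] cG continuous_intros)
  qed
  have outer_t: "integral {0..2 * pi} (\<lambda>t. integral {0..2 * pi} (\<lambda>y. G (y + t) (G y f))) = (2 * pi) *\<^sub>R fourier 0 f"
  proof (rule integral_unique, rule has_integral_spike_finite[where S = "{0, 2 * pi}"])
    show "((\<lambda>t. fourier 0 f) has_integral (2 * pi) *\<^sub>R fourier 0 f) {0..2 * pi}"
      using has_integral_const_real[of "fourier 0 f" 0 "2 * pi"] by simp
    show "integral {0..2 * pi} (\<lambda>y. G (y + t) (G y f)) = fourier 0 f" if "t \<in> {0..2 * pi} - {0, 2 * pi}" for t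
      using that by (intro integral_unique mean) auto
  qed simp
  have outer_y: "integral {0..2 * pi} (\<lambda>y. integral {0..2 * pi} (\<lambda>t. G (y + t) (G y f))) = fourier 0 (fourier 0 f)"
  proof (rule integral_unique)
    have inner: "integral {0..2 * pi} (\<lambda>t. G (y + t) (G y f)) = fourier 0 (G y f)" if y: "y \<in> {0..2 * pi}" for y
    proof -
      have "((\<lambda>t. G (t + y) (G y f)) has_integral integral {0..2 * pi} (\<lambda>t. G t (G y f))) {0..2 * pi}"
        by (rule integral_periodic_shift[of "\<lambda>t. G t (G y f)"])
           (use y in \<open>auto intro!: bounded_linear.continuous_on[OF blinfun.bounded_linear_left] continuous_on_G simp: G_periodic\<close>)
      thus ?thesis using has_integral_G[of "G y f"] by (simp add: add.commute integral_unique)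
    qed
    have "((\<lambda>y. fourier 0 (G y f)) has_integral fourier 0 (fourier 0 f)) {0..2 * pi}"
      using has_integral_linear[OF has_integral_G[of f] blinfun.bounded_linear_right[of "fourier 0"]] by (simp add: o_def)
    thus "((\<lambda>y. integral {0..2 * pi} (\<lambda>t. G (y + t) (G y f))) has_integral fourier 0 (fourier 0 f)) {0..2 * pi}"
      by (rule has_integral_eq[rotated]) (simp add: inner)
  qed
  have "fourier 0 (fourier 0 f) = (2 * pi) *\<^sub>R fourier 0 f"
    using swap unfolding outer_t outer_y .
  thus ?thesis by (simp add: proj_def blinfun.scaleR_left blinfun.scaleR_right)
qed

text \<open>
  The coefficients of nonnegative index are \<open>(A ^^ n) (fourier 0 f)\<close> by the recursion, and all
  of them are bounded by the maximum of the resolvent.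
\<close>

lemma proj_id_imp_power_bounded:
  assumes "\<And>f. proj f = f"
  obtains C where "\<And>n f. norm ((blinfun_apply A ^^ n) f) \<le> C * norm f"
proof -
  obtain C where C: "\<And>n. norm (fourier n) \<le> C" using norm_fourier_le by blast
  show ?thesis
  proof (rule that)
    fix n f
    have "(blinfun_apply A ^^ n) f = fourier (int n) ((1 / (2 * pi)) *\<^sub>R f)"
      unfolding fourier_nonneg fourier_0_eq assms by simp
    also have "norm \<dots> \<le> C * norm ((1 / (2 * pi)) *\<^sub>R f)"
      by (intro order.trans[OF norm_blinfun] mult_right_mono C) auto
    finally show "norm ((blinfun_apply A ^^ n) f) \<le> C * (1 / (2 * pi)) * norm f" by simp
  qed
qed

text \<open>
  If \<open>fourier 0\<close> vanishes, the recursion at index 0 reads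
  \<open>A (fourier (- 1) f) = - (2 * pi) *\<^sub>R f\<close>.
\<close>

lemma proj_zero_imp_invertible:
  assumes "\<And>f. proj f = 0"
  obtains B :: "'a \<Rightarrow>\<^sub>L 'a" where "\<And>f. A (B f) = f" "\<And>f. B (A f) = f" "\<And>z f. B (c z f) = c z (B f)"
proof (rule that)
  let ?B = "(- 1 / (2 * pi)) *\<^sub>R fourier (- 1)"
  have "fourier 0 f = 0" for f by (simp add: fourier_0_eq assms)
  hence *: "A (fourier (- 1) f) = - (2 * pi) *\<^sub>R f" for f
    using fourier_rec[of 0 f] by (simp add: eq_neg_iff_add_eq_0 add.commute)
  show "A (?B f) = f" for f using * by (simp add: blinfun.scaleR_left blinfun.scaleR_right blinfun.minus_left blinfun.minus_right)
  thus "?B (A f) = f" for f by (simp add: blinfun.scaleR_left blinfun.scaleR_right blinfun.minus_left blinfun.minus_right fourier_A)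
  show "?B (c z f) = c z (?B f)" for z f by (simp add: blinfun.scaleR_left blinfun.scaleR_right blinfun.minus_left blinfun.minus_right fourier_c)
qed

text \<open>
  A symmetry that rotates the resolvent family does not change its mean.
\<close>

lemma proj_commute_shift:
  fixes M :: "'a \<Rightarrow>\<^sub>L 'a"
  assumes t: "0 \<le> t" "t \<le> 2 * pi" and G: "\<And>x f. G x (M f) = M (G (x + t) f)"
  shows "proj (M f) = M (proj f)"
proof -
  have "((\<lambda>x. M (G (x + t) f)) has_integral M (fourier 0 f)) {0..2 * pi}"
    by (rule has_integral_G_shift[OF t])
  moreover have "((\<lambda>x. G x (M f)) has_integral fourier 0 (M f)) {0..2 * pi}"
    by (rule has_integral_G)
  ultimately have "fourier 0 (M f) = M (fourier 0 f)" unfolding G by (rule has_integral_unique[rotated])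
  thus ?thesis by (simp add: proj_def blinfun.scaleR_left blinfun.scaleR_right)
qed

end

section \<open>Multipliers attached to two boundary points\<close>

text \<open>
  The factor \<open>t ^ N\<close> comes from comparing the tail of \<open>exp (t * y)\<close> term by term with \<open>exp y\<close>.
\<close>

lemma exp_tail_le:
  fixes x :: complex
  assumes "cmod x \<le> t * y" "0 \<le> t" "t \<le> 1" "0 \<le> y"
  shows "cmod (exp x - (\<Sum>n<N. x ^ n / fact n)) \<le> t ^ N * exp y"
proof -
  have ex: "(\<lambda>n. x ^ n / fact n) sums exp x" using exp_converges[of x] by (simp add: scaleR_conv_of_real divide_inverse mult.commute)
  have ey: "(\<lambda>n. y ^ n / fact n) sums exp y" using exp_converges[of y] by (simp add: divide_inverse mult.commute)
  have tail: "(\<lambda>n. x ^ (n + N) / fact (n + N)) sums (exp x - (\<Sum>n<N. x ^ n / fact n))"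
    by (rule sums_split_initial_segment[OF ex])
  have ytail: "(\<lambda>n. t ^ N * (y ^ (n + N) / fact (n + N))) sums (t ^ N * (exp y - (\<Sum>n<N. y ^ n / fact n)))"
    by (intro sums_mult sums_split_initial_segment[OF ey])
  have le: "cmod (x ^ (n + N) / fact (n + N)) \<le> t ^ N * (y ^ (n + N) / fact (n + N))" for n
  proof -
    have "cmod x ^ (n + N) \<le> (t * y) ^ (n + N)" using assms by (intro power_mono) auto
    also have "\<dots> = t ^ N * (t ^ n * y ^ (n + N))" by (simp add: power_mult_distrib power_add)
    also have "\<dots> \<le> t ^ N * (1 * y ^ (n + N))" using assms by (intro mult_left_mono mult_right_mono power_le_one) auto
    finally show ?thesis by (simp add: norm_divide norm_power divide_right_mono)
  qed
  have "cmod (exp x - (\<Sum>n<N. x ^ n / fact n)) \<le> t ^ N * (exp y - (\<Sum>n<N. y ^ n / fact n))"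
    using norm_sums_le[OF tail ytail le] .
  also have "\<dots> \<le> t ^ N * exp y"
    using assms by (intro mult_left_mono) (auto intro!: sum_nonneg)
  finally show ?thesis .
qed

lemma bounded_holomorphic_cong:
  assumes f: "f \<in> H\<^sup>\<infinity>" and eq: "\<And>z. z \<in> \<D> \<Longrightarrow> f z = g z"
  shows "g \<in> H\<^sup>\<infinity>"
proof -
  have "f ` \<D> = g ` \<D>" by (rule image_cong[OF refl eq])
  moreover have "g holomorphic_on \<D>"
    by (rule holomorphic_transform[of f]) (use f eq in \<open>simp_all add: bounded_holomorphic_def\<close>)
  ultimately show ?thesis using f by (simp add: bounded_holomorphic_def)
qed

locale boundary_pair =
  fixes a b :: complex
  assumes a: "cmod a = 1" and b: "cmod b = 1" and ab: "a \<noteq> b"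
begin

text \<open>
  The Moebius map \<open>u\<close> takes the disc to a half plane that contains 1, with \<open>a\<close> at 0 and \<open>b\<close> at infinity.
  A hyperbolic automorphism with these fixed points is a dilation in the coordinate \<open>u\<close> and a
  translation in the coordinate \<open>\<zeta>\<close>. The weight \<open>q\<close> vanishes at \<open>a\<close> and \<open>b\<close> fast enough to make \<open>u * q\<close>
  and the whole exponential series of \<open>\<zeta>\<close> bounded.
\<close>

definition u :: "complex \<Rightarrow> complex" where "u z = (1 - cnj a * z) / (1 - cnj b * z)"
definition \<zeta> :: "complex \<Rightarrow> complex" where "\<zeta> z = Ln (u z)"
definition q :: "complex \<Rightarrow> complex" where "q z = (1 - cnj a * z)\<^sup>2 * (1 - cnj b * z)\<^sup>2"

lemma factor_nonzero: "cmod w = 1 \<Longrightarrow> z \<in> \<D> \<Longrightarrow> 1 - cnj w * z \<noteq> 0"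
  by (metis complex_mod_cnj eq_iff_diff_eq_0 less_irrefl mem_ball_0 mult_1 norm_mult norm_one)

lemma factor_le: "cmod w = 1 \<Longrightarrow> z \<in> \<D> \<Longrightarrow> cmod (1 - cnj w * z) \<le> 2"
  using norm_triangle_ineq4[of 1 "cnj w * z"] by (simp add: norm_mult)

lemma u_nonzero: "z \<in> \<D> \<Longrightarrow> u z \<noteq> 0"
  using factor_nonzero a b by (simp add: u_def)

text \<open>
  A value \<open>- r\<close> with \<open>r \<ge> 0\<close> would give \<open>1 + r = (cnj a + r * cnj b) * z\<close>, so \<open>z\<close> could not lie in
  the open disc. Hence the principal logarithm of \<open>u\<close> is holomorphic.
\<close>

lemma u_notin_nonpos: assumes z: "z \<in> \<D>" shows "u z \<notin> \<real>\<^sub>\<le>\<^sub>0"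
proof
  assume "u z \<in> \<real>\<^sub>\<le>\<^sub>0"
  then obtain r' where "r' \<le> 0" "u z = of_real r'" by (elim nonpos_Reals_cases)
  define r where "r = - r'"
  have r: "0 \<le> r" "u z = - of_real r" using \<open>r' \<le> 0\<close> \<open>u z = of_real r'\<close> by (simp_all add: r_def)
  have "1 - cnj a * z = - of_real r * (1 - cnj b * z)"
    using r(2) factor_nonzero[OF b z] by (simp add: u_def divide_eq_eq)
  hence "1 + of_real r = (cnj a + of_real r * cnj b) * z" by (simp add: algebra_simps)
  hence "cmod (1 + of_real r) = cmod (cnj a + of_real r * cnj b) * cmod z" by (metis norm_mult)
  moreover have "cmod (1 + of_real r) = 1 + r"
    using r(1) norm_of_real[of "1 + r", where 'a = complex] by simp
  moreover have "cmod (cnj a + of_real r * cnj b) \<le> 1 + r"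
    using norm_triangle_ineq[of "cnj a" "of_real r * cnj b"] a b r(1) by (simp add: norm_mult)
  ultimately have "1 + r \<le> (1 + r) * cmod z" by (simp add: mult_right_mono)
  also have "\<dots> < (1 + r) * 1" using z r(1) by (intro mult_strict_left_mono) auto
  finally show False by simp
qed

lemma \<zeta>_holomorphic: "\<zeta> holomorphic_on \<D>"
  unfolding \<zeta>_def using u_notin_nonpos factor_nonzero[OF b]
  by (intro holomorphic_intros) (auto simp: u_def[abs_def] intro!: holomorphic_intros)

lemma exp_\<zeta>: "z \<in> \<D> \<Longrightarrow> exp (\<zeta> z) = u z"
  unfolding \<zeta>_def by (intro exp_Ln u_nonzero)

lemma Im_\<zeta>: "z \<in> \<D> \<Longrightarrow> \<bar>Im (\<zeta> z)\<bar> \<le> pi"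
  unfolding \<zeta>_def using Im_Ln_le_pi mpi_less_Im_Ln u_nonzero by (metis abs_leI less_imp_le minus_le_iff)

lemma q_holomorphic: "q holomorphic_on \<D>"
  unfolding q_def[abs_def] by (intro holomorphic_intros)

text \<open>
  Up to a constant \<open>exp (2 * cmod (\<zeta> z))\<close> is the larger of \<open>\<bar>u z\<bar>\<^sup>2\<close> and \<open>1 / \<bar>u z\<bar>\<^sup>2\<close>.
\<close>

lemma q_exp_\<zeta>_le:
  assumes z: "z \<in> \<D>"
  shows "cmod (q z) * exp (2 * cmod (\<zeta> z)) \<le> 16 * exp (2 * pi)"
proof -
  let ?A = "cmod (1 - cnj a * z)" and ?B = "cmod (1 - cnj b * z)" and ?x = "Re (\<zeta> z)"
  have AB: "0 < ?A" "0 < ?B" using factor_nonzero a b z by simp_all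
  have A4: "?A ^ 4 \<le> 2 ^ 4" and B4: "?B ^ 4 \<le> 2 ^ 4" using factor_le a b z by (intro power_mono; simp)+
  have ex: "exp ?x = ?A / ?B"
    using exp_\<zeta>[OF z] by (metis norm_divide norm_exp_eq_Re u_def)
  have q: "cmod (q z) = ?A\<^sup>2 * ?B\<^sup>2" by (simp add: q_def norm_mult norm_power)
  have sq: "x\<^sup>2 * y\<^sup>2 * (x / y)\<^sup>2 = x ^ 4" if "y \<noteq> 0" for x y :: real
  proof -
    have "x\<^sup>2 * y\<^sup>2 * (x / y)\<^sup>2 = (x * y * (x / y))\<^sup>2" by (simp only: power_mult_distrib)
    also have "x * y * (x / y) = x\<^sup>2" using that by (simp add: power2_eq_square)
    finally show ?thesis by simp
  qed
  have le16: "cmod (q z) * exp (2 * \<bar>?x\<bar>) \<le> 16"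
  proof (cases "?x \<ge> 0")
    case True
    hence "exp (2 * \<bar>?x\<bar>) = (?A / ?B)\<^sup>2" by (simp add: ex[symmetric] exp_double)
    thus ?thesis unfolding q using sq[of ?B ?A] AB A4 by simp
  next
    case False
    hence "exp (2 * \<bar>?x\<bar>) = (exp (- ?x))\<^sup>2" by (simp flip: exp_double)
    also have "exp (- ?x) = ?B / ?A" by (simp add: exp_minus ex)
    finally show ?thesis unfolding q using sq[of ?A ?B] AB B4 by (simp add: mult.commute)
  qed
  have "exp (2 * cmod (\<zeta> z)) \<le> exp (2 * \<bar>?x\<bar>) * exp (2 * pi)"
    using cmod_le[of "\<zeta> z"] Im_\<zeta>[OF z] by (simp flip: exp_add)
  hence "cmod (q z) * exp (2 * cmod (\<zeta> z)) \<le> cmod (q z) * exp (2 * \<bar>?x\<bar>) * exp (2 * pi)"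
    by (simp add: mult_left_mono mult.assoc)
  also have "\<dots> \<le> 16 * exp (2 * pi)" by (rule mult_right_mono[OF le16]) simp
  finally show ?thesis .
qed

text \<open>
  The powers \<open>u powr (\<i> * \<theta>)\<close>; they are bounded because the imaginary part of \<open>\<zeta>\<close> is.
\<close>

definition e :: "real \<Rightarrow> complex \<Rightarrow> complex" where
  "e \<theta> z = exp (\<i> * of_real \<theta> * \<zeta> z)"

lemma norm_e_le: "z \<in> \<D> \<Longrightarrow> cmod (e \<theta> z) \<le> exp (\<bar>\<theta>\<bar> * pi)"
proof -
  assume z: "z \<in> \<D>"
  have "- (\<theta> * Im (\<zeta> z)) \<le> \<bar>\<theta>\<bar> * \<bar>Im (\<zeta> z)\<bar>" by (metis abs_ge_minus_self abs_mult)
  also have "\<dots> \<le> \<bar>\<theta>\<bar> * pi" using Im_\<zeta>[OF z] by (intro mult_left_mono) auto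
  finally show ?thesis by (simp add: e_def norm_exp_eq_Re)
qed

lemma e_bounded_holomorphic: "e \<theta> \<in> H\<^sup>\<infinity>"
  by (rule bounded_holomorphicI[OF _ norm_e_le])
     (auto simp: e_def[abs_def] intro!: holomorphic_intros \<zeta>_holomorphic)

lemma weight_bounded:
  assumes "F holomorphic_on \<D>" "\<And>z. z \<in> \<D> \<Longrightarrow> cmod (F z) \<le> C * exp (2 * cmod (\<zeta> z))" "0 \<le> C"
  shows "(\<lambda>z. F z * q z) \<in> H\<^sup>\<infinity>" "norm (hmult (\<lambda>z. F z * q z)) \<le> C * (16 * exp (2 * pi))"
proof -
  have le: "cmod (F z * q z) \<le> C * (16 * exp (2 * pi))" if z: "z \<in> \<D>" for z
  proof -
    have "cmod (F z * q z) \<le> C * exp (2 * cmod (\<zeta> z)) * cmod (q z)"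
      unfolding norm_mult by (intro mult_right_mono assms z) auto
    also have "\<dots> = C * (cmod (q z) * exp (2 * cmod (\<zeta> z)))" by simp
    also have "\<dots> \<le> C * (16 * exp (2 * pi))" by (intro mult_left_mono q_exp_\<zeta>_le z assms)
    finally show ?thesis .
  qed
  show 1: "(\<lambda>z. F z * q z) \<in> H\<^sup>\<infinity>"
    by (rule bounded_holomorphicI[OF _ le]) (intro holomorphic_intros assms q_holomorphic)
  show "norm (hmult (\<lambda>z. F z * q z)) \<le> C * (16 * exp (2 * pi))" by (rule norm_hmult_le[OF 1 le])
qed

lemma q_bounded: "q \<in> H\<^sup>\<infinity>"
  using weight_bounded(1)[of "\<lambda>_. 1" 1] by simp

abbreviation exp_term :: "complex \<Rightarrow> nat \<Rightarrow> complex \<Rightarrow> complex" where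
  "exp_term s n \<equiv> \<lambda>z. (s * \<zeta> z) ^ n / fact n * q z"

abbreviation exp_mult :: "complex \<Rightarrow> complex \<Rightarrow> complex" where
  "exp_mult s \<equiv> \<lambda>z. exp (s * \<zeta> z) * q z"

lemma exponential_term_bounded:
  assumes "cmod s \<le> 2"
  shows "exp_term s n \<in> H\<^sup>\<infinity>"
    and "norm (hmult (exp_term s n)) \<le> (cmod s / 2) ^ n * (16 * exp (2 * pi))"
proof -
  have "cmod ((s * \<zeta> z) ^ n / fact n) \<le> (cmod s / 2) ^ n * exp (2 * cmod (\<zeta> z))" for z
  proof -
    have ex: "(\<lambda>n. (2 * cmod (\<zeta> z)) ^ n / fact n) sums exp (2 * cmod (\<zeta> z))"
      using exp_converges[of "2 * cmod (\<zeta> z)"] by (simp add: divide_inverse mult.commute)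
    have "(2 * cmod (\<zeta> z)) ^ n / fact n \<le> exp (2 * cmod (\<zeta> z))"
      using sum_le_suminf[OF sums_summable[OF ex], of "{n}"] unfolding sums_unique[OF ex, symmetric] by simp
    hence "(cmod s / 2) ^ n * ((2 * cmod (\<zeta> z)) ^ n / fact n) \<le> (cmod s / 2) ^ n * exp (2 * cmod (\<zeta> z))"
      by (intro mult_left_mono) auto
    thus ?thesis by (simp add: norm_divide norm_power norm_mult power_mult_distrib power_divide)
  qed
  note le = this
  have hol: "(\<lambda>z. (s * \<zeta> z) ^ n / fact n) holomorphic_on \<D>"
    by (intro holomorphic_intros \<zeta>_holomorphic) auto
  show "exp_term s n \<in> H\<^sup>\<infinity>"
    by (rule weight_bounded(1)[OF hol le]) auto
  show "norm (hmult (exp_term s n)) \<le> (cmod s / 2) ^ n * (16 * exp (2 * pi))"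
    by (rule weight_bounded(2)[OF hol le]) auto
qed

lemma exponential_bounded:
  assumes "cmod s \<le> 1"
  shows "exp_mult s \<in> H\<^sup>\<infinity>"
proof (rule weight_bounded(1)[of _ 1])
  fix z
  have "cmod (exp (s * \<zeta> z)) \<le> exp (cmod (s * \<zeta> z))" by (rule norm_exp)
  also have "cmod (s * \<zeta> z) \<le> 2 * cmod (\<zeta> z)" unfolding norm_mult using assms by (intro mult_right_mono) auto
  finally show "cmod (exp (s * \<zeta> z)) \<le> 1 * exp (2 * cmod (\<zeta> z))" by simp
qed (auto intro!: holomorphic_intros \<zeta>_holomorphic)

lemma exponential_series:
  assumes s: "cmod s \<le> 1"
  shows "(\<lambda>n. hmult (exp_term s n) g) sums hmult (exp_mult s) g"
proof -
  have s2: "cmod s \<le> 2" using s by simp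
  (* For a modulus of s up to 1 the N-th remainder is at most 2 ^ -N * exp (2 * cmod (\<zeta> z)); the factor q absorbs the exponential. *)
  define D where "D N z = (exp (s * \<zeta> z) - (\<Sum>n<N. (s * \<zeta> z) ^ n / fact n))" for N z
  have "D N holomorphic_on \<D>" for N
    unfolding D_def[abs_def] by (intro holomorphic_intros \<zeta>_holomorphic) auto
  moreover have "cmod (D N z) \<le> (1/2) ^ N * exp (2 * cmod (\<zeta> z))" for N z
    unfolding D_def by (rule exp_tail_le) (use s in \<open>auto simp: norm_mult mult_left_le_one_le\<close>)
  ultimately have D: "(\<lambda>z. D N z * q z) \<in> H\<^sup>\<infinity>" "norm (hmult (\<lambda>z. D N z * q z)) \<le> (1/2) ^ N * (16 * exp (2 * pi))" for N
    using weight_bounded[of "D N" "(1/2)^N"] by auto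
  define T where "T n z = (s * \<zeta> z) ^ n / fact n * q z" for n z
  define L where "L z = exp (s * \<zeta> z) * q z" for z
  have T: "T n \<in> H\<^sup>\<infinity>" for n unfolding T_def[abs_def] by (rule exponential_term_bounded(1)[OF s2])
  have L: "L \<in> H\<^sup>\<infinity>" unfolding L_def[abs_def] by (rule exponential_bounded[OF s])
  have eq: "hmult L g - (\<Sum>n<N. hmult (T n) g) = hmult (\<lambda>z. D N z * q z) g" for N
  proof (rule hardy_eqI)
    fix z assume z: "z \<in> \<D>"
    have "hfun (\<Sum>n<N. hmult (T n) g) z = (\<Sum>n<N. T n z) * hfun g z"
      by (induction N) (simp_all add: hfun_0 hfun_add hfun_hmult[OF T z] ring_distribs)
    moreover have "(\<Sum>n<N. T n z) = (\<Sum>n<N. (s * \<zeta> z) ^ n / fact n) * q z"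
      by (simp add: T_def sum_distrib_right)
    ultimately show "hfun (hmult L g - (\<Sum>n<N. hmult (T n) g)) z = hfun (hmult (\<lambda>z. D N z * q z) g) z"
      unfolding hfun_diff hfun_hmult[OF L z] hfun_hmult[OF D(1) z] by (simp add: L_def D_def left_diff_distrib)
  qed
  have "(\<lambda>N. (\<Sum>n<N. hmult (T n) g) - hmult L g) \<longlonglongrightarrow> 0"
  proof (rule Lim_null_comparison[OF always_eventually[OF allI]])
    fix N
    have "norm ((\<Sum>n<N. hmult (T n) g) - hmult L g) = norm (hmult (\<lambda>z. D N z * q z) g)"
      by (simp only: norm_minus_commute[of "sum _ _"] eq)
    also have "\<dots> \<le> norm (hmult (\<lambda>z. D N z * q z)) * norm g" by (rule norm_blinfun)
    also have "\<dots> \<le> (1/2) ^ N * (16 * exp (2 * pi)) * norm g" by (rule mult_right_mono[OF D(2)]) simp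
    finally show "norm ((\<Sum>n<N. hmult (T n) g) - hmult L g) \<le> (1/2) ^ N * (16 * exp (2 * pi) * norm g)"
      by (simp only: mult.assoc)
    show "(\<lambda>N. (1/2) ^ N * (16 * exp (2 * pi) * norm g)) \<longlonglongrightarrow> 0"
      by (intro tendsto_mult_left_zero LIMSEQ_power_zero) auto
  qed
  hence "(\<lambda>n. hmult (T n) g) sums hmult L g" unfolding sums_def by (rule LIM_zero_cancel)
  thus ?thesis unfolding T_def[abs_def] L_def[abs_def] .
qed

text \<open>
  Both sides of \<open>L (u powr s * q * g) = u z0 powr s * L (q * g)\<close> are holomorphic in \<open>s\<close> near the
  closed unit disc, the left one as the power series with coefficients \<open>\<kappa> n\<close>. They agree on a
  segment of the imaginary axis, hence at \<open>s = 1\<close>. In the applications \<open>L\<close> is \<open>f \<mapsto> hfun (P f) z0\<close>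
  for an operator \<open>P\<close> that commutes with the multiplications by \<open>e \<theta>\<close>.
\<close>

lemma intertwining_extends_to_u:
  fixes L :: "hardy \<Rightarrow> complex"
  assumes L: "bounded_linear L" and Lc: "\<And>c f. L (hscale c f) = c * L f"
    and z0: "z0 \<in> \<D>" and \<tau>: "\<tau> \<noteq> 0"
    and Le: "\<And>t f. 0 \<le> t \<Longrightarrow> t \<le> 2 * pi \<Longrightarrow> L (hmult (e (t / \<tau>)) f) = e (t / \<tau>) z0 * L f"
  shows "L (hmult (\<lambda>z. u z * q z) g) = u z0 * L (hmult q g)"
proof -
  obtain B where B: "\<And>f. norm (L f) \<le> norm f * B" using bounded_linear.bounded[OF L] by blast
  have B0: "0 \<le> B" if "g \<noteq> 0" using order.trans[OF norm_ge_zero B[of g]] that by (simp add: zero_le_mult_iff)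
  define \<kappa> where "\<kappa> n = L (hmult (exp_term 1 n) g)" for n
  define C where "C = 16 * exp (2 * pi) * norm g * \<bar>B\<bar>"
  have \<kappa>: "cmod (\<kappa> n) \<le> (1/2) ^ n * C" for n
  proof -
    have "cmod (\<kappa> n) \<le> norm (hmult (exp_term 1 n) g) * \<bar>B\<bar>"
      unfolding \<kappa>_def by (rule order.trans[OF B]) (intro mult_left_mono, auto)
    also have "\<dots> \<le> (norm (hmult (exp_term 1 n)) * norm g) * \<bar>B\<bar>"
      by (intro mult_right_mono norm_blinfun) auto
    also have "\<dots> \<le> (((cmod 1 / 2) ^ n * (16 * exp (2 * pi))) * norm g) * \<bar>B\<bar>"
      by (intro mult_right_mono exponential_term_bounded(2)) auto
    finally show ?thesis by (simp add: C_def mult_ac)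
  qed
  define F where "F s = (\<Sum>n. \<kappa> n * s ^ n)" for s
  have F: "(\<lambda>n. \<kappa> n * s ^ n) sums F s" if s: "cmod s < 2" for s
  proof -
    have "summable (\<lambda>n. \<kappa> n * s ^ n)"
    proof (rule summable_comparison_test')
      show "summable (\<lambda>n. C * (cmod s / 2) ^ n)" using s by (intro summable_mult summable_geometric) auto
      show "norm (\<kappa> n * s ^ n) \<le> C * (cmod s / 2) ^ n" for n
        using mult_right_mono[OF \<kappa>[of n], of "cmod s ^ n"] by (simp add: norm_mult norm_power power_divide mult_ac)
    qed
    thus ?thesis unfolding F_def by (rule summable_sums)
  qed
  have Fval: "F s = L (hmult (exp_mult s) g)" if s: "cmod s \<le> 1" for s
  proof -
    have "(\<lambda>n. L (hmult (exp_term s n) g)) sums L (hmult (exp_mult s) g)"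
      by (rule bounded_linear.sums[OF L exponential_series[OF s]])
    moreover have "L (hmult (exp_term s n) g) = \<kappa> n * s ^ n" for n
    proof -
      have "hmult (exp_term s n) g = hscale (s ^ n) (hmult (exp_term 1 n) g)"
      proof (rule hardy_eqI)
        fix z assume z: "z \<in> \<D>"
        have "cmod s \<le> 2" "cmod 1 \<le> 2" using s by auto
        note E = exponential_term_bounded(1)[OF this(1), of n] exponential_term_bounded(1)[OF this(2), of n]
        show "hfun (hmult (exp_term s n) g) z = hfun (hscale (s ^ n) (hmult (exp_term 1 n) g)) z"
          unfolding hfun_hscale hfun_hmult[OF E(1) z] hfun_hmult[OF E(2) z] by (simp add: power_mult_distrib)
      qed
      thus ?thesis by (simp only: Lc \<kappa>_def mult.commute)
    qed
    ultimately show ?thesis using F[of s] s by (simp add: sums_iff)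
  qed
  define H where "H s = F s - exp (s * \<zeta> z0) * L (hmult q g)" for s
  have Hhol: "H holomorphic_on ball 0 2"
  proof -
    have "F holomorphic_on ball 0 2"
      using power_series_holomorphic[of 0 2 \<kappa> F] F by simp
    thus ?thesis unfolding H_def[abs_def] by (intro holomorphic_intros)
  qed
  (* The hypothesis is only about t in [0, 2 * pi], and the series only reaches the closed unit disc. *)
  define \<rho> where "\<rho> = min (2 * pi) \<bar>\<tau>\<bar>"
  have \<rho>: "0 < \<rho>" using \<tau> by (simp add: \<rho>_def)
  define U where "U = (\<lambda>t. \<i> * of_real (t / \<tau>)) ` {0..\<rho>}"
  have HU: "H s = 0" "cmod s \<le> 1" if "s \<in> U" for s
  proof -
    have "s \<in> U" by fact
    then obtain t where t: "0 \<le> t" "t \<le> \<rho>" "s = \<i> * of_real (t / \<tau>)" by (auto simp: U_def simp del: of_real_divide)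
    show s1: "cmod s \<le> 1" using t \<tau> by (simp add: norm_mult norm_divide \<rho>_def)
    have es: "(\<lambda>z. exp (s * \<zeta> z)) = e (t / \<tau>)" unfolding t(3) e_def[abs_def] ..
    have "hmult (exp_mult s) g = hmult (e (t / \<tau>)) (hmult q g)"
    proof (rule hardy_eqI)
      fix z assume z: "z \<in> \<D>"
      show "hfun (hmult (exp_mult s) g) z = hfun (hmult (e (t / \<tau>)) (hmult q g)) z"
        unfolding hfun_hmult[OF exponential_bounded[OF s1] z] hfun_hmult[OF e_bounded_holomorphic z] hfun_hmult[OF q_bounded z]
        by (simp add: fun_cong[OF es])
    qed
    hence "F s = e (t / \<tau>) z0 * L (hmult q g)"
      using Fval[OF s1] Le t by (simp add: \<rho>_def)
    thus "H s = 0" using fun_cong[OF es, of z0] by (simp add: H_def)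
  qed
  have "0 islimpt U"
  proof (rule connected_imp_perfect)
    show "connected U" unfolding U_def by (intro connected_continuous_image continuous_intros) (use \<tau> in auto)
    show "0 \<in> U" unfolding U_def using \<rho> by (auto intro!: image_eqI[of _ _ 0])
    have "\<i> * of_real (\<rho> / \<tau>) \<in> U" unfolding U_def using \<rho> by (intro imageI) auto
    moreover have "\<i> * of_real (\<rho> / \<tau>) \<noteq> 0" using \<rho> \<tau> by simp
    ultimately show "U \<noteq> {x}" for x using \<open>0 \<in> U\<close> by auto
  qed
  moreover have "U \<subseteq> ball 0 2" using HU(2) by force
  ultimately have "H 1 = 0"
    by (intro analytic_continuation[OF Hhol open_ball connected_ball, of U 0 1]) (use HU(1) in auto)
  hence "L (hmult (exp_mult 1) g) = u z0 * L (hmult q g)"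
    using Fval[of 1] exp_\<zeta>[OF z0] by (simp add: H_def)
  moreover have "hmult (exp_mult 1) g = hmult (\<lambda>z. u z * q z) g"
  proof -
    have "weighted_composition (exp_mult 1) (\<lambda>z. z) = weighted_composition (\<lambda>z. u z * q z) (\<lambda>z. z)"
      by (auto simp: weighted_composition_def fun_eq_iff exp_\<zeta>)
    thus ?thesis by (simp add: wcop_def)
  qed
  ultimately show ?thesis by simp
qed

definition factor :: "complex \<Rightarrow> complex \<Rightarrow> complex" where "factor w z = 1 - cnj w * z"

lemma factor_bounded: "factor w \<in> H\<^sup>\<infinity>"
proof (rule bounded_holomorphicI)
  show "factor w holomorphic_on \<D>" unfolding factor_def[abs_def] by (intro holomorphic_intros)
  show "cmod (factor w z) \<le> 1 + cmod w" if "z \<in> \<D>" for z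
    using norm_triangle_ineq4[of 1 "cnj w * z"] mult_left_mono[of "cmod z" 1 "cmod w"] that by (simp add: factor_def norm_mult)
qed

lemma id_bounded: "(\<lambda>z. z) \<in> H\<^sup>\<infinity>"
  by (rule bounded_holomorphicI[of _ 1]) (auto intro!: holomorphic_intros)

text \<open>
  Since \<open>u\<close> is a fractional linear function of \<open>z\<close>, the relation for \<open>u\<close> is a relation for \<open>z\<close> after
  clearing the denominator: \<open>L (z * q * h) = z0 * L (q * h)\<close>. Now expand \<open>f\<close> in monomials.
\<close>

lemma evaluation_on_q_multiples:
  fixes L :: "hardy \<Rightarrow> complex"
  assumes L: "bounded_linear L" and Lc: "\<And>c f. L (hscale c f) = c * L f"
    and z0: "z0 \<in> \<D>" and \<tau>: "\<tau> \<noteq> 0"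
    and Le: "\<And>t f. 0 \<le> t \<Longrightarrow> t \<le> 2 * pi \<Longrightarrow> L (hmult (e (t / \<tau>)) f) = e (t / \<tau>) z0 * L f"
  shows "L (hmult q f) = hfun f z0 * L (hmult q (hmono 0))"
proof -
  note inter = intertwining_extends_to_u[OF L Lc z0 \<tau> Le]
  have uq: "(\<lambda>z. u z * q z) \<in> H\<^sup>\<infinity>"
  proof -
    have "exp_mult 1 \<in> H\<^sup>\<infinity>" by (rule exponential_bounded) simp
    thus ?thesis by (rule bounded_holomorphic_cong) (simp add: exp_\<zeta>)
  qed
  have shift: "L (hmult q (hmult (\<lambda>z. z) h)) = z0 * L (hmult q h)" for h
  proof -
    let ?X = "L (hmult q h)" and ?Y = "L (hmult q (hmult (\<lambda>z. z) h))"
    have lin: "L (hmult q (hmult (factor w) h)) = ?X - cnj w * ?Y" for w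
    proof -
      have "hmult q (hmult (factor w) h) = hmult q h - hscale (cnj w) (hmult q (hmult (\<lambda>z. z) h))"
        by (rule hardy_eqI) (simp only: hfun_diff hfun_hscale hfun_hmult[OF q_bounded] hfun_hmult[OF factor_bounded] hfun_hmult[OF id_bounded],
            simp add: factor_def algebra_simps)
      thus ?thesis by (simp add: linear_simps(2)[OF L] Lc)
    qed
    have cancel: "hmult (\<lambda>z. u z * q z) (hmult (factor b) h) = hmult q (hmult (factor a) h)"
    proof (rule hardy_eqI)
      fix z assume z: "z \<in> \<D>"
      have "u z * factor b z = factor a z" using factor_nonzero[OF b z] by (simp add: u_def factor_def)
      hence "u z * q z * (factor b z * hfun h z) = q z * (factor a z * hfun h z)" by (metis mult.assoc mult.commute)
      thus "hfun (hmult (\<lambda>z. u z * q z) (hmult (factor b) h)) z = hfun (hmult q (hmult (factor a) h)) z"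
        by (simp only: hfun_hmult[OF uq z] hfun_hmult[OF factor_bounded z] hfun_hmult[OF q_bounded z])
    qed
    have rel: "?X - cnj a * ?Y = u z0 * (?X - cnj b * ?Y)"
      using inter[of "hmult (factor b) h"] unfolding cancel lin .
    have solve: "y = z0 * x" if eq: "x - cnj a * y = u z0 * (x - cnj b * y)" for x y
    proof -
      have "(1 - cnj b * z0) * (x - cnj a * y) = (1 - cnj a * z0) * (x - cnj b * y)"
        unfolding eq u_def using factor_nonzero[OF b z0] by simp
      moreover have "(cnj a - cnj b) * (y - z0 * x) =
          (1 - cnj a * z0) * (x - cnj b * y) - (1 - cnj b * z0) * (x - cnj a * y)"
        by (simp add: algebra_simps)
      ultimately have "(cnj a - cnj b) * (y - z0 * x) = 0" by simp
      thus ?thesis using ab by simp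
    qed
    show ?thesis by (rule solve[OF rel])
  qed
  have mono: "L (hmult q (hmono k)) = z0 ^ k * L (hmult q (hmono 0))" for k
  proof (induction k)
    case (Suc k)
    have "hmono (Suc k) = hmult (\<lambda>z. z) (hmono k)"
      by (rule hardy_eqI) (simp only: hfun_hmono hfun_hmult[OF id_bounded] power_Suc)
    thus ?case using Suc shift[of "hmono k"] by simp
  qed simp
  have bl: "bounded_linear (\<lambda>f. L (hmult q f))"
    by (rule bounded_linear_compose[OF L blinfun.bounded_linear_right])
  have each: "L (hmult q (hscale (hcoeff f k) (hmono k))) = hcoeff f k * z0 ^ k * L (hmult q (hmono 0))" for k
  proof -
    have "hmult q (hscale (hcoeff f k) (hmono k)) = hscale (hcoeff f k) (hmult q (hmono k))"
      by (rule hardy_eqI) (simp only: hfun_hscale hfun_hmult[OF q_bounded], rule mult.left_commute)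
    thus ?thesis by (simp only: Lc mono[of k] mult.assoc)
  qed
  have "(\<lambda>k. L (hmult q (hscale (hcoeff f k) (hmono k)))) sums L (hmult q f)"
    by (rule bounded_linear.sums[OF bl hardy_expansion])
  hence "(\<lambda>k. hcoeff f k * z0 ^ k * L (hmult q (hmono 0))) sums L (hmult q f)"
    by (simp only: each)
  moreover have "(\<lambda>k. hcoeff f k * z0 ^ k * L (hmult q (hmono 0))) sums (hfun f z0 * L (hmult q (hmono 0)))"
    by (rule sums_mult2[OF hcoeff_sums[OF z0]])
  ultimately show ?thesis by (rule sums_unique2)
qed

text \<open>
  This says that the multiples of \<open>1 - cnj w * z\<close> are dense, in the form in which it is used.
  An operator that kills them satisfies \<open>B (z ^ k) = cnj w * B (z ^ (k + 1))\<close>.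
\<close>

lemma dense_factor_multiples:
  fixes B :: "hardy \<Rightarrow>\<^sub>L hardy"
  assumes w: "cmod w = 1" and Bc: "\<And>c f. B (hscale c f) = hscale c (B f)"
    and B: "\<And>f. B (hmult (factor w) f) = 0"
  shows "B f = 0"
proof -
  have lin0: "hscale c 0 = 0" for c by (simp add: blinfun.zero_right)
  have step: "B (hmono k) = hscale (cnj w) (B (hmono (Suc k)))" for k
  proof -
    have "hmult (factor w) (hmono k) = hmono k - hscale (cnj w) (hmono (Suc k))"
      by (rule hardy_eqI) (simp only: hfun_diff hfun_hscale hfun_hmult[OF factor_bounded] hfun_hmono, simp add: factor_def algebra_simps)
    with B[of "hmono k"] show ?thesis by (simp add: blinfun.diff_right Bc)
  qed
  have hs: "hscale x (hscale y g) = hscale (x * y) g" for x y g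
    by (rule hardy_eqI) (simp add: hfun_hscale)
  have hs1: "hscale 1 g = g" for g by (rule hardy_eqI) (simp add: hfun_hscale)
  have pow: "B (hmono 0) = hscale (cnj w ^ k) (B (hmono k))" for k
  proof (induction k)
    case (Suc k) thus ?case by (subst (asm) step) (simp add: hs mult.commute)
  qed (simp add: hs1)
  (* B takes the same value on each of the n unit vectors cnj w ^ k * z ^ k, k < n, whose sum only has norm sqrt n. *)
  have bound: "real n * norm (B (hmono 0)) \<le> norm B * sqrt (real n)" for n
  proof -
    have "B (hpoly (\<lambda>k. cnj w ^ k) n) = real n *\<^sub>R B (hmono 0)"
    proof (induction n)
      case 0
      have "hpoly (\<lambda>k. cnj w ^ k) 0 = 0" by (rule hardy_eqI) (simp add: hfun_hpoly hfun_0)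
      thus ?case by (simp add: blinfun.zero_right)
    next
      case (Suc n)
      have "B (hpoly (\<lambda>k. cnj w ^ k) (Suc n)) = B (hpoly (\<lambda>k. cnj w ^ k) n) + B (hscale (cnj w ^ n) (hmono n))"
        by (simp only: hpoly_Suc[of "\<lambda>k. cnj w ^ k"] blinfun.add_right)
      also have "B (hscale (cnj w ^ n) (hmono n)) = B (hmono 0)" by (simp only: Bc pow[symmetric])
      finally show ?case by (simp add: Suc scaleR_add_left)
    qed
    hence "real n * norm (B (hmono 0)) = norm (B (hpoly (\<lambda>k. cnj w ^ k) n))" by simp
    also have "\<dots> \<le> norm B * norm (hpoly (\<lambda>k. cnj w ^ k) n)" by (rule norm_blinfun)
    also have "norm (hpoly (\<lambda>k. cnj w ^ k) n) = sqrt (real n)"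
    proof -
      have "(norm (hpoly (\<lambda>k. cnj w ^ k) n))\<^sup>2 = real n" by (simp add: norm_hpoly norm_power w)
      thus ?thesis by (metis norm_ge_zero real_sqrt_unique)
    qed
    finally show ?thesis .
  qed
  have B0: "norm (B (hmono 0)) \<le> norm B / sqrt (real n)" if "0 < n" for n
  proof -
    have "(sqrt n * norm (B (hmono 0))) * sqrt n = (sqrt n * sqrt n) * norm (B (hmono 0))" by (simp only: mult_ac)
    also have "\<dots> = real n * norm (B (hmono 0))" by simp
    also note bound[of n]
    finally have "(sqrt n * norm (B (hmono 0))) * sqrt n \<le> norm B * sqrt n" .
    hence "sqrt n * norm (B (hmono 0)) \<le> norm B" by (rule mult_right_le_imp_le) (use that in auto)
    thus ?thesis using that by (simp add: pos_le_divide_eq mult.commute)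
  qed
  have "(\<lambda>n. norm B / sqrt (real n)) \<longlonglongrightarrow> 0"
    by (intro tendsto_divide_0[OF tendsto_const] filterlim_at_top_imp_at_infinity filterlim_compose[OF sqrt_at_top filterlim_real_sequentially])
  hence "norm (B (hmono 0)) \<le> 0"
    by (rule LIMSEQ_le_const) (use B0 in \<open>auto intro!: exI[of _ 1]\<close>)
  hence "B (hmono 0) = 0" by simp
  have "norm (B (hmono k)) = 0" for k
  proof -
    have "norm (B (hmono 0)) = norm (B (hmono k))" unfolding pow[of k] by (simp add: norm_hscale norm_power w)
    thus ?thesis using \<open>B (hmono 0) = 0\<close> by simp
  qed
  hence "B (hscale (hcoeff f k) (hmono k)) = 0" for k by (simp add: Bc lin0)
  with bounded_linear.sums[OF blinfun.bounded_linear_right hardy_expansion, of B f]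
  show ?thesis by (simp add: sums_iff)
qed

lemma dense_q_multiples:
  fixes B :: "hardy \<Rightarrow>\<^sub>L hardy"
  assumes Bc: "\<And>c f. B (hscale c f) = hscale c (B f)"
    and B: "\<And>f. B (hmult q f) = 0"
  shows "B f = 0"
proof -
  let ?a = "hmult (factor a)" and ?b = "hmult (factor b)"
  have fc: "hmult (factor w) (hscale c f) = hscale c (hmult (factor w) f)" for w c f
    by (rule hardy_eqI) (simp only: hfun_hscale hfun_hmult[OF factor_bounded], rule mult.left_commute)
  have q: "hmult q f = ?a (?a (?b (?b f)))" for f
    by (rule hardy_eqI) (simp only: hfun_hmult[OF factor_bounded] hfun_hmult[OF q_bounded], simp add: factor_def q_def power2_eq_square mult_ac)
  have 1: "(B o\<^sub>L ?a o\<^sub>L ?a o\<^sub>L ?b) f = 0" for f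
    by (rule dense_factor_multiples[OF b]) (simp_all only: blinfun_apply_blinfun_compose Bc fc B[unfolded q])
  have 2: "(B o\<^sub>L ?a o\<^sub>L ?a) f = 0" for f
    by (rule dense_factor_multiples[OF b])
       (use 1 in \<open>simp_all only: blinfun_apply_blinfun_compose Bc fc\<close>)
  have 3: "(B o\<^sub>L ?a) f = 0" for f
    by (rule dense_factor_multiples[OF a])
       (use 2 in \<open>simp_all only: blinfun_apply_blinfun_compose Bc fc\<close>)
  show ?thesis
    by (rule dense_factor_multiples[OF a])
       (use 3 in \<open>simp_all only: blinfun_apply_blinfun_compose Bc fc\<close>)
qed

text \<open>
  On multiples of \<open>q\<close> the operator \<open>P\<close> is multiplication by a holomorphic function, and its
  idempotence forces that function to be constantly 0 or 1. Multiples of \<open>q\<close> are dense.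
\<close>

lemma projection_zero_or_id:
  fixes P :: "hardy \<Rightarrow>\<^sub>L hardy"
  assumes idem: "\<And>f. P (P f) = P f" and Pc: "\<And>c f. P (hscale c f) = hscale c (P f)" and \<tau>: "\<tau> \<noteq> 0"
    and Pe: "\<And>t f. 0 \<le> t \<Longrightarrow> t \<le> 2 * pi \<Longrightarrow> P (hmult (e (t / \<tau>)) f) = hmult (e (t / \<tau>)) (P f)"
  shows "(\<forall>f. P f = 0) \<or> (\<forall>f. P f = f)"
proof -
  define k where "k = P (hmult q (hmono 0))"
  have Pq: "hfun (P (hmult q f)) z = hfun f z * hfun k z" if z: "z \<in> \<D>" for f z
  proof -
    have "bounded_linear (\<lambda>f. hfun (P f) z)"
    proof (rule bounded_linear_intro[where K = "norm P / sqrt (1 - (cmod z)\<^sup>2)"])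
      have z1: "0 < sqrt (1 - (cmod z)\<^sup>2)" using z by (simp add: power_less_one_iff abs_square_less_1)
      show "norm (hfun (P f) z) \<le> norm f * (norm P / sqrt (1 - (cmod z)\<^sup>2))" for f
        using order.trans[OF norm_hfun_le[OF z] norm_blinfun, of P f] z1 by (simp add: pos_le_divide_eq mult.commute)
    qed (simp_all add: blinfun.bilinear_simps hfun_simps scaleR_conv_of_real)
    from evaluation_on_q_multiples[OF this _ z \<tau>, of f] show ?thesis
      unfolding k_def by (simp add: Pc Pe hfun_hscale hfun_hmult[OF e_bounded_holomorphic z])
  qed
  have k2: "hfun k z * (hfun k z - q z) = 0" if z: "z \<in> \<D>" for z
  proof -
    have "P (hmult q (hmult q (hmono 0))) = hmult q k"
      by (rule hardy_eqI) (simp only: Pq hfun_hmult[OF q_bounded] hfun_hmono, simp)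
    hence "P (hmult q k) = hmult q k" using idem by metis
    thus ?thesis using Pq[OF z, of k] hfun_hmult[OF q_bounded z, of k] by auto
  qed
  show ?thesis
  proof (cases "\<exists>z\<in>\<D>. hfun k z \<noteq> 0")
    case False
    have "P (hmult q f) = 0" for f
      by (rule hardy_eqI) (use False in \<open>simp add: Pq hfun_0 del: mem_ball_0\<close>)
    hence "P f = 0" for f by (rule dense_q_multiples[OF Pc])
    thus ?thesis by blast
  next
    case True
    then obtain z1 where z1: "z1 \<in> \<D>" "hfun k z1 \<noteq> 0" by blast
    define U where "U = {z \<in> \<D>. hfun k z \<noteq> 0}"
    have "U = \<D> \<inter> hfun k -` (- {0})" by (auto simp: U_def)
    hence "open U"
      using continuous_open_preimage[OF holomorphic_on_imp_continuous_on[OF hfun_holomorphic[of k]] open_ball open_Compl[OF closed_singleton]]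
      by simp
    have kq: "hfun k z = q z" if "z \<in> \<D>" for z
    proof -
      have "hfun k z - q z = 0"
      proof (rule analytic_continuation_open[of U \<D> "\<lambda>z. hfun k z - q z" "\<lambda>_. 0"])
        show "U \<noteq> {}" using z1 by (auto simp: U_def)
        show "hfun k z - q z = 0" if "z \<in> U" for z using k2[of z] that by (auto simp: U_def)
      qed (use that \<open>open U\<close> in \<open>auto simp: U_def intro!: holomorphic_intros hfun_holomorphic q_holomorphic\<close>)
      thus ?thesis by simp
    qed
    have "(P - id_blinfun) (hmult q f) = 0" for f
      by (rule hardy_eqI) (simp only: blinfun.diff_left blinfun_apply_id_blinfun hfun_diff hfun_0 Pq kq hfun_hmult[OF q_bounded], simp)
    hence "(P - id_blinfun) f = 0" for f
      by (rule dense_q_multiples[rotated]) (simp add: blinfun.diff_left blinfun.diff_right Pc)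
    thus ?thesis by (simp add: blinfun.diff_left)
  qed
qed

end

section \<open>Fixed points of hyperbolic automorphisms\<close>

lemma disc_automorphism_imp_disc_bijection:
  assumes "disc_automorphism \<phi>" shows "disc_bijection \<phi>"
proof -
  have "\<phi> holomorphic_on cball 0 1"
    using assms by (simp add: disc_automorphism_def analytic_imp_holomorphic)
  hence "\<phi> holomorphic_on \<D>" by (rule holomorphic_on_subset) auto
  thus ?thesis using assms by (simp add: disc_bijection_def disc_automorphism_def)
qed

lemma continuous_agree_on_closed_disc:
  fixes f g :: "complex \<Rightarrow> complex"
  assumes "continuous_on (cball 0 1) f" "continuous_on (cball 0 1) g" "\<And>z. z \<in> \<D> \<Longrightarrow> f z = g z" "z \<in> cball 0 1"
  shows "f z = g z"
proof -
  have cl: "closure \<D> = cball 0 1" by (rule closure_ball) simp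
  have "f z - g z = 0"
  proof (rule continuous_constant_on_closure[of \<D> "\<lambda>z. f z - g z" 0 z])
    show "continuous_on (closure \<D>) (\<lambda>z. f z - g z)" unfolding cl by (intro continuous_on_diff assms)
    show "z \<in> closure \<D>" unfolding cl by fact
  qed (simp add: assms(3))
  thus ?thesis by simp
qed

lemma disc_automorphism_moebius:
  assumes \<phi>: "disc_automorphism \<phi>"
  obtains \<alpha> c where "cmod \<alpha> < 1" "cmod c = 1"
    "\<And>z. z \<in> cball 0 1 \<Longrightarrow> \<phi> z = c * (z - \<alpha>) / (1 - cnj \<alpha> * z)"
    "\<And>z. z \<in> cball 0 1 \<Longrightarrow> deriv \<phi> z = c * (1 - cnj \<alpha> * \<alpha>) / (1 - cnj \<alpha> * z)\<^sup>2"
proof -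
  have an: "\<phi> analytic_on cball 0 1" using \<phi> by (auto simp: disc_automorphism_def)
  then obtain S where S: "open S" "cball 0 1 \<subseteq> S" "\<phi> holomorphic_on S" by (auto simp: analytic_on_holomorphic)
  obtain \<alpha> c where \<alpha>: "cmod \<alpha> < 1" and c: "cmod c = 1"
    and \<phi>eq: "\<And>z. z \<in> \<D> \<Longrightarrow> \<phi> z = c * (z - \<alpha>) / (1 - cnj \<alpha> * z)"
    using disc_bijection_moebius[OF disc_automorphism_imp_disc_bijection[OF \<phi>]] by blast
  have nz: "1 - cnj \<alpha> * z \<noteq> 0" if "z \<in> cball 0 1" for z using moebius_denominator_nonzero[OF \<alpha>, of z] that by simp
  have cont: "continuous_on (cball 0 1) \<phi>" "continuous_on (cball 0 1) (deriv \<phi>)"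
    using S holomorphic_deriv[OF S(3,1)] by (meson continuous_on_subset holomorphic_on_imp_continuous_on)+
  have d\<phi>: "deriv \<phi> z = c * (1 - cnj \<alpha> * \<alpha>) / (1 - cnj \<alpha> * z)\<^sup>2" if z: "z \<in> \<D>" for z
  proof (rule DERIV_imp_deriv)
    have nzz: "1 - cnj \<alpha> * z \<noteq> 0" using nz z by simp
    have "((\<lambda>z. c * (z - \<alpha>) / (1 - cnj \<alpha> * z)) has_field_derivative
        ((c * (1 - 0)) * (1 - cnj \<alpha> * z) - (c * (z - \<alpha>)) * (0 - cnj \<alpha> * 1)) / ((1 - cnj \<alpha> * z) * (1 - cnj \<alpha> * z))) (at z)"
      by (intro DERIV_divide DERIV_cmult DERIV_diff DERIV_ident DERIV_const nzz)
    also have "((c * (1 - 0)) * (1 - cnj \<alpha> * z) - (c * (z - \<alpha>)) * (0 - cnj \<alpha> * 1)) / ((1 - cnj \<alpha> * z) * (1 - cnj \<alpha> * z))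
        = c * (1 - cnj \<alpha> * \<alpha>) / (1 - cnj \<alpha> * z)\<^sup>2"
      by (simp add: power2_eq_square algebra_simps)
    finally show "(\<phi> has_field_derivative c * (1 - cnj \<alpha> * \<alpha>) / (1 - cnj \<alpha> * z)\<^sup>2) (at z)"
      by (rule has_field_derivative_transform_within_open[of _ _ _ \<D>]) (use z \<phi>eq in auto)
  qed
  show ?thesis
  proof (rule that[OF \<alpha> c])
    fix z :: complex assume z: "z \<in> cball 0 1"
    show "\<phi> z = c * (z - \<alpha>) / (1 - cnj \<alpha> * z)"
      by (rule continuous_agree_on_closed_disc[OF cont(1) _ \<phi>eq z]) (intro continuous_intros ballI nz)
    show "deriv \<phi> z = c * (1 - cnj \<alpha> * \<alpha>) / (1 - cnj \<alpha> * z)\<^sup>2"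
      by (rule continuous_agree_on_closed_disc[OF cont(2) _ d\<phi> z]) (intro continuous_intros ballI power_not_zero nz)
  qed
qed

text \<open>
  At a fixed point on the circle the rotation factor \<open>c\<close> is determined by the argument of the
  denominator; this makes the derivative there positive.
\<close>

lemma moebius_fixed_point:
  assumes w: "cmod w = 1" and d0: "1 - cnj \<alpha> * w \<noteq> 0" and fp: "c * (w - \<alpha>) / (1 - cnj \<alpha> * w) = w"
  shows "c * cnj (1 - cnj \<alpha> * w) = 1 - cnj \<alpha> * w"
proof -
  let ?d = "1 - cnj \<alpha> * w"
  have ww: "w * cnj w = 1" using w by (simp flip: complex_norm_square)
  have "w * cnj ?d = w - \<alpha>" using ww by (simp add: algebra_simps)
  moreover have "c * (w - \<alpha>) = w * ?d" using fp d0 by (simp add: divide_eq_eq)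
  ultimately have "w * (c * cnj ?d) = w * ?d" by (metis mult.left_commute)
  moreover have "w \<noteq> 0" using w by auto
  ultimately show ?thesis by (metis mult_left_cancel)
qed

text \<open>
  The quotient in the third claim is the modulus of the derivative in the disc, and at the
  fixed point the derivative is positive.
\<close>

lemma automorphism_boundary_fixed_point:
  assumes \<phi>: "disc_automorphism \<phi>" and w: "w \<in> \<T>" and fix_w: "\<phi> w = w"
  shows "(\<phi> \<longlongrightarrow> w) (at w within \<D>)"
    and "0 < Re (deriv \<phi> w)"
    and "((\<lambda>z. (1 - (cmod (\<phi> z))\<^sup>2) / (1 - (cmod z)\<^sup>2)) \<longlongrightarrow> Re (deriv \<phi> w)) (at w within \<D>)"
proof -
  obtain \<alpha> c where \<alpha>: "cmod \<alpha> < 1" and c: "cmod c = 1"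
    and \<phi>eq: "\<And>z. z \<in> cball 0 1 \<Longrightarrow> \<phi> z = c * (z - \<alpha>) / (1 - cnj \<alpha> * z)"
    and deq: "\<And>z. z \<in> cball 0 1 \<Longrightarrow> deriv \<phi> z = c * (1 - cnj \<alpha> * \<alpha>) / (1 - cnj \<alpha> * z)\<^sup>2"
    using disc_automorphism_moebius[OF \<phi>] by blast
  have wc: "w \<in> cball 0 1" using w by simp
  have nz: "1 - cnj \<alpha> * z \<noteq> 0" if "z \<in> cball 0 1" for z using moebius_denominator_nonzero[OF \<alpha>, of z] that by simp
  show "(\<phi> \<longlongrightarrow> w) (at w within \<D>)"
  proof -
    have "((\<lambda>z. c * (z - \<alpha>) / (1 - cnj \<alpha> * z)) \<longlongrightarrow> c * (w - \<alpha>) / (1 - cnj \<alpha> * w)) (at w within \<D>)"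
      using nz[OF wc] by (intro tendsto_intros)
    moreover have "c * (w - \<alpha>) / (1 - cnj \<alpha> * w) = w" using \<phi>eq[OF wc] fix_w by simp
    moreover have "eventually (\<lambda>z. c * (z - \<alpha>) / (1 - cnj \<alpha> * z) = \<phi> z) (at w within \<D>)"
      unfolding eventually_at_topological by (intro exI[of _ UNIV]) (auto simp: \<phi>eq)
    ultimately show ?thesis using Lim_transform_eventually by fastforce
  qed
  let ?d = "1 - cnj \<alpha> * w"
  have d0: "?d \<noteq> 0" using nz w by simp
  have cd: "c * cnj ?d = ?d"
    using w d0 \<phi>eq[OF wc] fix_w by (intro moebius_fixed_point) auto
  have dval: "deriv \<phi> w = of_real ((1 - (cmod \<alpha>)\<^sup>2) / (cmod ?d)\<^sup>2)"
  proof -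
    have "c \<noteq> 0" using c by auto
    have "deriv \<phi> w = c * (1 - cnj \<alpha> * \<alpha>) / (?d * (c * cnj ?d))" unfolding cd deq[OF wc] by (simp add: power2_eq_square)
    also have "\<dots> = (1 - \<alpha> * cnj \<alpha>) / (?d * cnj ?d)" using \<open>c \<noteq> 0\<close> by (simp add: mult_ac)
    also have "\<dots> = of_real ((1 - (cmod \<alpha>)\<^sup>2) / (cmod ?d)\<^sup>2)"
      by (simp only: of_real_divide of_real_diff of_real_1 complex_norm_square)
    finally show ?thesis .
  qed
  have \<alpha>2: "(cmod \<alpha>)\<^sup>2 < 1" using \<alpha> by (simp add: power_less_one_iff abs_square_less_1)
  show "0 < Re (deriv \<phi> w)" unfolding dval using \<alpha>2 d0 by simp
  have "((\<lambda>z. (1 - (cmod \<alpha>)\<^sup>2) / (cmod (1 - cnj \<alpha> * z))\<^sup>2) \<longlongrightarrow> (1 - (cmod \<alpha>)\<^sup>2) / (cmod ?d)\<^sup>2) (at w within \<D>)"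
    using d0 by (intro tendsto_intros) auto
  moreover have "eventually (\<lambda>z. (1 - (cmod \<alpha>)\<^sup>2) / (cmod (1 - cnj \<alpha> * z))\<^sup>2 = (1 - (cmod (\<phi> z))\<^sup>2) / (1 - (cmod z)\<^sup>2)) (at w within \<D>)"
    unfolding eventually_at_topological
  proof (intro exI[of _ UNIV] conjI ballI impI)
    fix z assume z: "z \<in> \<D>"
    have "1 - (cmod z)\<^sup>2 \<noteq> 0" using z by (simp add: abs_square_eq_1)
    moreover have zc: "z \<in> cball 0 1" using z by simp
    ultimately show "(1 - (cmod \<alpha>)\<^sup>2) / (cmod (1 - cnj \<alpha> * z))\<^sup>2 = (1 - (cmod (\<phi> z))\<^sup>2) / (1 - (cmod z)\<^sup>2)"
      unfolding \<phi>eq[OF zc] using moebius_norm_identity[OF \<alpha> c, of z] z by simp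
  qed auto
  ultimately show "((\<lambda>z. (1 - (cmod (\<phi> z))\<^sup>2) / (1 - (cmod z)\<^sup>2)) \<longlongrightarrow> Re (deriv \<phi> w)) (at w within \<D>)"
    unfolding dval Re_complex_of_real by (rule Lim_transform_eventually)
qed

text \<open>
  The multiplier is the quotient of the denominators of \<open>\<phi>\<close> at \<open>b\<close> and at \<open>a\<close>. It is real because
  \<open>\<phi>\<close> fixes \<open>a\<close> and \<open>b\<close>, positive because \<open>u\<close> omits the negative half axis, and less than 1 because
  the iterates of 0, where \<open>u\<close> takes the powers of the multiplier as values, tend to the zero
  \<open>a\<close> of \<open>u\<close>.
\<close>

lemma (in boundary_pair) hyperbolic_multiplier:
  assumes \<phi>: "disc_automorphism \<phi>" and fix_a: "\<phi> a = a" and fix_b: "\<phi> b = b" and dw: "denjoy_wolff_point \<phi> a"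
  obtains s where "0 < s" "s < 1" "\<And>z. z \<in> \<D> \<Longrightarrow> u (\<phi> z) = of_real s * u z"
proof -
  obtain \<alpha> c where \<alpha>: "cmod \<alpha> < 1" and c: "cmod c = 1"
    and \<phi>eq: "\<And>z. z \<in> cball 0 1 \<Longrightarrow> \<phi> z = c * (z - \<alpha>) / (1 - cnj \<alpha> * z)"
    using disc_automorphism_moebius[OF \<phi>] by metis
  have nz: "1 - cnj \<alpha> * z \<noteq> 0" if "z \<in> cball 0 1" for z using moebius_denominator_nonzero[OF \<alpha>, of z] that by simp
  let ?da = "1 - cnj \<alpha> * a" and ?db = "1 - cnj \<alpha> * b"
  have d0: "?da \<noteq> 0" "?db \<noteq> 0" using nz a b by simp_all
  have c0: "c \<noteq> 0" using c by auto
  have "1 - cnj \<alpha> * \<alpha> \<noteq> 0" using nz[of \<alpha>] \<alpha> by simp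
  define \<sigma> where "\<sigma> = ?db / ?da"
  (* The difference of two values of a Moebius map factors; dividing the factorisations for a and b leaves a constant. *)
  have factor: "1 - cnj w * \<phi> z = c * (1 - cnj \<alpha> * \<alpha>) * (1 - cnj w * z) / ((1 - cnj \<alpha> * w) * (1 - cnj \<alpha> * z))"
    if w: "cmod w = 1" "\<phi> w = w" and z: "z \<in> \<D>" for w z
  proof -
    have ww: "cnj w * w = 1" using w(1) by (metis complex_norm_square mult.commute of_real_1 power_one)
    have dw: "1 - cnj \<alpha> * w \<noteq> 0" and dz: "1 - cnj \<alpha> * z \<noteq> 0" using nz w(1) z by simp_all
    have "1 - cnj w * \<phi> z = cnj w * (\<phi> w - \<phi> z)" using ww w(2) by (simp add: right_diff_distrib)
    also have "\<phi> w - \<phi> z = c * (1 - cnj \<alpha> * \<alpha>) * (w - z) / ((1 - cnj \<alpha> * w) * (1 - cnj \<alpha> * z))"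
    proof -
      have "\<phi> w - \<phi> z = (c * (w - \<alpha>) * (1 - cnj \<alpha> * z) - c * (z - \<alpha>) * (1 - cnj \<alpha> * w)) / ((1 - cnj \<alpha> * w) * (1 - cnj \<alpha> * z))"
        using \<phi>eq[of w] \<phi>eq[of z] w(1) z dw dz by (simp add: diff_frac_eq)
      also have "c * (w - \<alpha>) * (1 - cnj \<alpha> * z) - c * (z - \<alpha>) * (1 - cnj \<alpha> * w) = c * (1 - cnj \<alpha> * \<alpha>) * (w - z)"
        by (simp add: algebra_simps)
      finally show ?thesis .
    qed
    also have "cnj w * (c * (1 - cnj \<alpha> * \<alpha>) * (w - z) / ((1 - cnj \<alpha> * w) * (1 - cnj \<alpha> * z)))
        = c * (1 - cnj \<alpha> * \<alpha>) * (cnj w * w - cnj w * z) / ((1 - cnj \<alpha> * w) * (1 - cnj \<alpha> * z))"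
      by (simp add: right_diff_distrib mult_ac)
    finally show ?thesis by (simp only: ww)
  qed
  have mult: "u (\<phi> z) = \<sigma> * u z" if z: "z \<in> \<D>" for z
    unfolding u_def factor[OF a fix_a z] factor[OF b fix_b z] \<sigma>_def
    using d0 c0 \<open>1 - cnj \<alpha> * \<alpha> \<noteq> 0\<close> nz[of z] z factor_nonzero[OF b z] by simp
  have "c * (a - \<alpha>) / ?da = a" "c * (b - \<alpha>) / ?db = b"
    using \<phi>eq[of a] \<phi>eq[of b] fix_a fix_b a b by simp_all
  hence fp: "c * cnj ?da = ?da" "c * cnj ?db = ?db"
    using moebius_fixed_point[OF a d0(1)] moebius_fixed_point[OF b d0(2)] by blast+
  have "cnj \<sigma> = (c * cnj ?db) / (c * cnj ?da)" using c0 by (simp add: \<sigma>_def)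
  also have "\<dots> = \<sigma>" unfolding fp \<sigma>_def ..
  finally have real: "\<sigma> = of_real (Re \<sigma>)" by (simp add: complex_eq_iff)
  have \<phi>D: "\<phi> z \<in> \<D>" if "z \<in> \<D>" for z
    using disc_bijection_in_disc[OF disc_automorphism_imp_disc_bijection[OF \<phi>] that] .
  have u0: "u 0 = 1" by (simp add: u_def)
  (* \<sigma> is itself a value of u, namely at \<phi> 0. *)
  have "\<sigma> \<notin> \<real>\<^sub>\<le>\<^sub>0" using u_notin_nonpos[OF \<phi>D[of 0]] mult[of 0] u0 by simp
  hence pos: "0 < Re \<sigma>" using real by (metis complex_nonpos_Reals_iff Im_complex_of_real not_le)
  have it: "(\<phi> ^^ n) 0 \<in> \<D> \<and> u ((\<phi> ^^ n) 0) = \<sigma> ^ n" for n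
    by (induction n) (use \<phi>D mult u0 in auto)
  have "compact {0::complex} \<and> {0::complex} \<subseteq> \<D>" by simp
  hence "uniform_limit {0} (\<lambda>n. \<phi> ^^ n) (\<lambda>_. a) sequentially"
    using dw unfolding denjoy_wolff_point_def by blast
  hence "(\<lambda>n. (\<phi> ^^ n) 0) \<longlonglongrightarrow> a" by (rule tendsto_uniform_limitI) simp
  hence "(\<lambda>n. u ((\<phi> ^^ n) 0)) \<longlonglongrightarrow> (1 - cnj a * a) / (1 - cnj b * a)"
    unfolding u_def
  proof (intro tendsto_intros)
    show "1 - cnj b * a \<noteq> 0"
    proof
      assume "1 - cnj b * a = 0"
      hence "b * (cnj b * a) = b" by simp
      moreover have "b * cnj b = 1" using b by (simp flip: complex_norm_square)
      ultimately show False using ab by (metis mult.assoc mult_1)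
    qed
  qed
  moreover have "cnj a * a = 1" using a by (metis complex_norm_square mult.commute of_real_1 power_one)
  ultimately have "(\<lambda>n. \<sigma> ^ n) \<longlonglongrightarrow> 0" using it by simp
  hence lim: "(\<lambda>n. cmod (\<sigma> ^ n)) \<longlonglongrightarrow> 0" by (rule tendsto_norm_zero)
  have "cmod \<sigma> < 1"
  proof (rule ccontr)
    assume "\<not> cmod \<sigma> < 1"
    hence "1 \<le> cmod (\<sigma> ^ n)" for n by (simp add: norm_power one_le_power)
    hence "(1::real) \<le> 0" by (intro LIMSEQ_le_const[OF lim]) blast
    thus False by simp
  qed
  moreover have "cmod \<sigma> = Re \<sigma>" using pos by (subst real) simp
  ultimately show ?thesis using that[of "Re \<sigma>"] pos mult real by metis
qed

section \<open>Invertibility on the Hardy space\<close>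

lemma neumann_inverse:
  fixes A :: "'a::banach \<Rightarrow>\<^sub>L 'a"
  assumes A: "\<And>n f. norm ((blinfun_apply A ^^ n) f) \<le> K * r ^ n * norm f" and r: "0 \<le> r" "r < 1" and K: "0 \<le> K"
  obtains B :: "'a \<Rightarrow>\<^sub>L 'a" where "\<And>f. B (f - A f) = f" "\<And>f. B f - A (B f) = f"
proof -
  define Ap where "Ap n = ((\<lambda>B. A o\<^sub>L B) ^^ n) id_blinfun" for n
  have Ap: "Ap n f = (blinfun_apply A ^^ n) f" for n f
    unfolding Ap_def by (induction n) simp_all
  have le: "norm (Ap n) \<le> K * r ^ n" for n
    using A r K by (intro norm_blinfun_bound) (auto simp: Ap)
  have "summable (\<lambda>n. K * r ^ n)"
    using r by (intro summable_mult[OF summable_geometric]) simp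
  hence "summable Ap" by (rule summable_comparison_test'[where N = 0]) (rule le)
  hence "Ap sums suminf Ap" by (rule summable_sums)
  from bounded_linear.sums[OF blinfun.bounded_linear_left this]
  have s: "(\<lambda>n. (blinfun_apply A ^^ n) f) sums suminf Ap f" for f by (simp only: Ap)
  let ?B = "suminf Ap"
  have B1: "?B f - A (?B f) = f" for f
  proof -
    have "(\<lambda>n. (blinfun_apply A ^^ Suc n) f) sums A (?B f)"
      using bounded_linear.sums[OF blinfun.bounded_linear_right[of A] s[of f]] by simp
    hence "(\<lambda>n. (blinfun_apply A ^^ n) f) sums (A (?B f) + f)"
      using sums_Suc_iff[of "\<lambda>n. (blinfun_apply A ^^ n) f"] by simp
    hence "?B f = A (?B f) + f" by (rule sums_unique2[OF s])
    thus ?thesis by (metis add_diff_cancel_left')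
  qed
  have BA: "?B (A f) = A (?B f)" for f
  proof -
    have "(\<lambda>n. (blinfun_apply A ^^ n) (A f)) sums A (?B f)"
      using bounded_linear.sums[OF blinfun.bounded_linear_right[of A] s[of f]] by (simp add: funpow_swap1)
    thus ?thesis by (rule sums_unique2[OF s])
  qed
  show ?thesis using that[of ?B] B1 BA by (simp add: blinfun.diff_right)
qed

definition invertible_operator :: "(hardy \<Rightarrow>\<^sub>L hardy) \<Rightarrow> bool" where
  "invertible_operator T \<longleftrightarrow> (\<exists>B :: hardy \<Rightarrow>\<^sub>L hardy. (\<forall>f. B (T f) = f) \<and> (\<forall>f. T (B f) = f))"

lemma hardy_bounded_operatorI:
  fixes B :: "hardy \<Rightarrow>\<^sub>L hardy"
  assumes S: "\<And>f. S (hfun f) = hfun (B f)" and Bc: "\<And>c f. B (hscale c f) = hscale c (B f)"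
  shows "hardy_bounded_operator S"
proof -
  have S': "S f = hfun (B (Hardy f))" if "f \<in> H\<^sup>2" for f using S[of "Hardy f"] that by (simp add: Hardy_inverse)
  show ?thesis unfolding hardy_bounded_operator_def
  proof (intro conjI ballI allI)
    fix f assume f: "f \<in> H\<^sup>2"
    show "S f \<in> H\<^sup>2" unfolding S'[OF f] by (rule hfun)
    fix g assume g: "g \<in> H\<^sup>2"
    have "Hardy (\<lambda>z. f z + g z) = Hardy f + Hardy g"
      using f g by (simp add: plus_hardy_def Hardy_inverse)
    thus "S (\<lambda>z. f z + g z) = (\<lambda>z. S f z + S g z)"
      using S' f g hardy_add(1)[OF f g] by (simp add: blinfun.add_right hfun_add fun_eq_iff)
  next
    fix c f assume f: "f \<in> H\<^sup>2"
    have "hfun (hscale c (Hardy f)) = (\<lambda>z. c * f z)" by (simp add: hfun_hscale Hardy_inverse f fun_eq_iff)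
    hence "S (\<lambda>z. c * f z) = hfun (hscale c (B (Hardy f)))" using S[of "hscale c (Hardy f)"] Bc by simp
    thus "S (\<lambda>z. c * f z) = (\<lambda>z. c * S f z)" by (simp add: hfun_hscale S'[OF f] fun_eq_iff)
  next
    have "hardy_norm (S f) \<le> norm B * hardy_norm f" if "f \<in> H\<^sup>2" for f
      using norm_blinfun[of B "Hardy f"] that by (simp add: norm_hardy_def S' Hardy_inverse)
    thus "\<exists>K. \<forall>f\<in>H\<^sup>2. hardy_norm (S f) \<le> K * hardy_norm f" by blast
  qed
qed

text \<open>
  An inverse of a map commuting with complex scalars commutes with them as well, so a bounded
  real-linear inverse suffices.
\<close>

lemma hardy_invertible_iff:
  fixes T :: "hardy \<Rightarrow>\<^sub>L hardy"
  assumes S: "\<And>f. S (hfun f) = hfun (T f)" and Tc: "\<And>c f. T (hscale c f) = hscale c (T f)"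
  shows "hardy_invertible S \<longleftrightarrow> invertible_operator T"
proof
  assume "hardy_invertible S"
  then obtain R where R: "hardy_bounded_operator R" "\<And>f. f \<in> H\<^sup>2 \<Longrightarrow> R (S f) = f" "\<And>f. f \<in> H\<^sup>2 \<Longrightarrow> S (R f) = f"
    by (auto simp: hardy_invertible_def)
  have mem: "R (hfun f) \<in> H\<^sup>2" for f using R(1) hfun by (auto simp: hardy_bounded_operator_def)
  let ?R = "\<lambda>f. Hardy (R (hfun f))"
  have hR: "hfun (?R f) = R (hfun f)" for f by (rule Hardy_inverse[OF mem])
  obtain K where K: "\<And>f. f \<in> H\<^sup>2 \<Longrightarrow> hardy_norm (R f) \<le> K * hardy_norm f"
    using R(1) unfolding hardy_bounded_operator_def by blast
  have add: "R (\<lambda>z. f z + g z) = (\<lambda>z. R f z + R g z)" if "f \<in> H\<^sup>2" "g \<in> H\<^sup>2" for f g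
    using R(1) that by (simp add: hardy_bounded_operator_def)
  have scale: "R (\<lambda>z. c * f z) = (\<lambda>z. c * R f z)" if "f \<in> H\<^sup>2" for c f
    using R(1) that by (simp add: hardy_bounded_operator_def)
  have "bounded_linear ?R"
  proof (rule bounded_linear_intro[where K = K])
    fix f g :: hardy and r :: real
    have "hfun (f + g) = (\<lambda>z. hfun f z + hfun g z)" by (simp add: hfun_add fun_eq_iff)
    thus "?R (f + g) = ?R f + ?R g"
      by (intro hardy_eqI) (subst hR, simp only: hfun_add hR add[OF hfun hfun])
    have "hfun (r *\<^sub>R f) = (\<lambda>z. of_real r * hfun f z)" by (simp add: hfun_scaleR fun_eq_iff)
    thus "?R (r *\<^sub>R f) = r *\<^sub>R ?R f"
      by (intro hardy_eqI) (subst hR, simp only: hfun_scaleR hR scale[OF hfun])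
    show "norm (?R f) \<le> norm f * K" using K[OF hfun, of f] by (simp add: norm_hardy_def hR mult.commute)
  qed
  hence ap: "blinfun_apply (Blinfun ?R) = ?R" by (rule bounded_linear_Blinfun_apply)
  have "?R (T f) = f" for f
    unfolding S[symmetric] R(2)[OF hfun] by (rule hfun_inverse)
  moreover have "T (?R f) = f" for f
  proof (rule hfun_inject[THEN iffD1])
    show "hfun (T (?R f)) = hfun f" unfolding S[symmetric] hR by (rule R(3)[OF hfun])
  qed
  ultimately have "(\<forall>f. Blinfun ?R (T f) = f) \<and> (\<forall>f. T (Blinfun ?R f) = f)" unfolding ap by blast
  thus "invertible_operator T" unfolding invertible_operator_def by blast
next
  assume "invertible_operator T"
  then obtain B :: "hardy \<Rightarrow>\<^sub>L hardy" where B: "\<And>f. B (T f) = f" "\<And>f. T (B f) = f" by (auto simp: invertible_operator_def)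
  have Bc: "B (hscale c f) = hscale c (B f)" for c f
    by (rule inverse_commute[of B T "hscale c", symmetric]) (simp_all add: B Tc)
  let ?R = "\<lambda>f. hfun (B (Hardy f))"
  have "?R (hfun f) = hfun (B f)" for f by (simp add: hfun_inverse)
  hence "hardy_bounded_operator ?R" by (rule hardy_bounded_operatorI[OF _ Bc])
  moreover have "hardy_bounded_operator S" by (rule hardy_bounded_operatorI[OF S Tc])
  moreover have "?R (S f) = f" "S (?R f) = f" if "f \<in> H\<^sup>2" for f
    using S[of "Hardy f"] S[of "B (Hardy f)"] that by (simp_all add: Hardy_inverse hfun_inverse B)
  ultimately show "hardy_invertible S" unfolding hardy_invertible_def by blast
qed

section \<open>Powers of the operator\<close>

text \<open>
  Factors at points near \<open>a\<close> or \<open>b\<close> are at most \<open>r\<close>. Along an orbit \<open>\<bar>u\<bar>\<close> decreases geometrically,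
  so the number of remaining points is bounded independently of the orbit, and they
  contribute a constant factor.
\<close>

lemma (in boundary_pair) orbit_product_bound:
  fixes \<phi> :: "complex \<Rightarrow> complex" and W :: "complex \<Rightarrow> real"
  assumes \<phi>D: "\<And>z. z \<in> \<D> \<Longrightarrow> \<phi> z \<in> \<D>" and s: "0 < s" "s < 1"
    and mult: "\<And>z. z \<in> \<D> \<Longrightarrow> u (\<phi> z) = of_real s * u z"
    and W: "\<And>z. z \<in> \<D> \<Longrightarrow> 0 \<le> W z" "\<And>z. z \<in> \<D> \<Longrightarrow> W z \<le> M"
    and \<delta>: "0 < \<delta>" and r: "0 < r"
    and near: "\<And>z. z \<in> \<D> \<Longrightarrow> dist z a < \<delta> \<or> dist z b < \<delta> \<Longrightarrow> W z \<le> r"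
  obtains K where "0 \<le> K" "\<And>n z. z \<in> \<D> \<Longrightarrow> (\<Prod>j<n. W ((\<phi> ^^ j) z)) \<le> K * r ^ n"
proof -
  (* x is the largest ratio by which a factor of the product can exceed r. *)
  define x where "x = max M r / r"
  have x1: "1 \<le> x" using r by (simp add: x_def)
  have "0 < \<delta>\<^sup>2 / 4" using \<delta> by simp
  (* The orbit is far from both fixed points only while the modulus of u lies between \<delta> / 2 and
       2 / \<delta>; after N steps it has left that interval. *)
  then obtain N where N: "s ^ N < \<delta>\<^sup>2 / 4" using s(2) by (rule real_arch_pow_inv[THEN exE])
  have it: "(\<phi> ^^ j) z \<in> \<D> \<and> cmod (u ((\<phi> ^^ j) z)) = s ^ j * cmod (u z)" if "z \<in> \<D>" for j z
    using that s by (induction j) (use \<phi>D in \<open>auto simp: mult norm_mult\<close>)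
  have dist_eq: "dist z w = cmod (1 - cnj w * z)" if "cmod w = 1" for w z
  proof -
    have "w * (1 - cnj w * z) = w - (w * cnj w) * z" by (simp add: algebra_simps)
    also have "w * cnj w = 1" using that by (simp flip: complex_norm_square)
    finally have "cmod w * cmod (1 - cnj w * z) = cmod (w - z)" by (simp flip: norm_mult)
    thus ?thesis using that by (simp add: dist_norm norm_minus_commute)
  qed
  have far: "W y \<le> r" if y: "y \<in> \<D>" and out: "\<not> (\<delta> / 2 \<le> cmod (u y) \<and> cmod (u y) \<le> 2 / \<delta>)" for y
  proof (rule near[OF y])
    have A: "cmod (1 - cnj a * y) \<le> 2" "cmod (1 - cnj b * y) \<le> 2" using factor_le a b y by auto
    have nz: "0 < cmod (1 - cnj b * y)" using factor_nonzero[OF b y] by simp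
    have uy: "cmod (u y) = cmod (1 - cnj a * y) / cmod (1 - cnj b * y)" by (simp add: u_def norm_divide)
    show "dist y a < \<delta> \<or> dist y b < \<delta>"
    proof (cases "cmod (u y) < \<delta> / 2")
      case True
      hence "cmod (1 - cnj a * y) < \<delta> / 2 * cmod (1 - cnj b * y)" using nz uy by (simp add: divide_less_eq)
      also have "\<dots> \<le> \<delta> / 2 * 2" using A \<delta> by (intro mult_left_mono) auto
      finally show ?thesis by (simp add: dist_eq[OF a])
    next
      case False
      hence "2 / \<delta> < cmod (1 - cnj a * y) / cmod (1 - cnj b * y)" using out uy by auto
      hence "2 * cmod (1 - cnj b * y) < cmod (1 - cnj a * y) * \<delta>" using nz \<delta> by (simp add: divide_simps)
      also have "\<dots> \<le> 2 * \<delta>" using A \<delta> by (intro mult_right_mono) auto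
      finally show ?thesis by (simp add: dist_eq[OF b])
    qed
  qed
  have main: "(\<Prod>j<n. W ((\<phi> ^^ j) z)) \<le> x ^ N * r ^ n" if z: "z \<in> \<D>" for n z
  proof -
    define J where "J = {j \<in> {..<n}. \<delta> / 2 \<le> s ^ j * cmod (u z) \<and> s ^ j * cmod (u z) \<le> 2 / \<delta>}"
    have finJ: "finite J" by (simp add: J_def)
    have cJ: "card J \<le> N"
    proof (cases "J = {}")
      case False
      define m where "m = Min J"
      have m: "m \<in> J" "\<And>j. j \<in> J \<Longrightarrow> m \<le> j" using False finJ by (auto simp: m_def)
      have "j < m + N" if j: "j \<in> J" for j
      proof (rule ccontr)
        assume "\<not> j < m + N"
        then obtain i where i: "j = m + (N + i)" by (metis add.assoc le_Suc_ex not_less)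
        have "s ^ j * cmod (u z) = s ^ (N + i) * (s ^ m * cmod (u z))" by (simp add: i power_add mult_ac)
        also have "\<dots> \<le> s ^ N * (2 / \<delta>)"
          using m(1) s \<delta> by (intro mult_mono power_decreasing) (auto simp: J_def)
        also have "\<dots> < \<delta>\<^sup>2 / 4 * (2 / \<delta>)" using N \<delta> by (intro mult_strict_right_mono) auto
        also have "\<dots> = \<delta> / 2" using \<delta> by (simp add: power2_eq_square)
        finally show False using j by (simp add: J_def)
      qed
      hence "J \<subseteq> {m..<m + N}" using m(2) by auto
      hence "card J \<le> card {m..<m + N}" by (intro card_mono) auto
      thus ?thesis by simp
    qed simp
    have "(\<Prod>j<n. W ((\<phi> ^^ j) z)) \<le> (\<Prod>j<n. r * (if j \<in> J then x else 1))"
    proof (rule prod_mono, safe)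
      fix j assume j: "j < n"
      note y = it[OF z, of j]
      show "0 \<le> W ((\<phi> ^^ j) z)" using W(1) y by blast
      show "W ((\<phi> ^^ j) z) \<le> r * (if j \<in> J then x else 1)"
      proof (cases "j \<in> J")
        case True
        have "W ((\<phi> ^^ j) z) \<le> M" using W(2) y by blast
        also have "\<dots> \<le> r * x" using r by (simp add: x_def)
        finally show ?thesis using True by simp
      next
        case False
        thus ?thesis using far[of "(\<phi> ^^ j) z"] y j by (auto simp: J_def)
      qed
    qed
    also have "\<dots> = r ^ n * x ^ card J"
    proof -
      have "(\<Prod>j<n. if j \<in> J then x else 1) = (\<Prod>j\<in>{j \<in> {..<n}. j \<in> J}. x)"
        by (rule prod.inter_filter[symmetric]) simp
      also have "{j \<in> {..<n}. j \<in> J} = J" by (auto simp: J_def)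
      finally show ?thesis by (simp add: prod.distrib)
    qed
    also have "\<dots> \<le> r ^ n * x ^ N" using r x1 cJ by (intro mult_left_mono power_increasing) auto
    finally show ?thesis by (simp add: mult.commute)
  qed
  show ?thesis by (rule that[of "x ^ N"]) (use x1 main in auto)
qed

locale hyperbolic_composition = boundary_pair +
  fixes \<phi> \<psi> :: "complex \<Rightarrow> complex" and s :: real
  assumes \<phi>: "disc_bijection \<phi>" and \<psi>: "\<psi> \<in> H\<^sup>\<infinity>"
    and s: "0 < s" "s < 1"
    and multiplier: "\<And>z. z \<in> \<D> \<Longrightarrow> u (\<phi> z) = of_real s * u z"
begin

definition T :: "hardy \<Rightarrow>\<^sub>L hardy" where "T = wcop \<psi> \<phi>"

text \<open>
  The denominator is \<open>\<bar>\<phi>' z\<bar>\<close>; it telescopes in products along an orbit.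
\<close>

definition W :: "complex \<Rightarrow> real" where
  "W z = (cmod (\<psi> z))\<^sup>2 / ((1 - (cmod (\<phi> z))\<^sup>2) / (1 - (cmod z)\<^sup>2))"

definition \<psi>_prod :: "nat \<Rightarrow> complex \<Rightarrow> complex" where
  "\<psi>_prod n z = (\<Prod>j<n. \<psi> ((\<phi> ^^ j) z))"

lemma iterate_in_disc: "z \<in> \<D> \<Longrightarrow> (\<phi> ^^ n) z \<in> \<D>"
  by (rule disc_bijection_in_disc[OF disc_bijection_funpow[OF \<phi>]])

lemma W_nonneg: "z \<in> \<D> \<Longrightarrow> 0 \<le> W z"
  unfolding W_def using disc_pos disc_bijection_in_disc[OF \<phi>] by (intro divide_nonneg_nonneg) (auto simp: less_imp_le)

lemma prod_W: "z \<in> \<D> \<Longrightarrow> (\<Prod>j<n. W ((\<phi> ^^ j) z)) * (1 - (cmod ((\<phi> ^^ n) z))\<^sup>2) = (cmod (\<psi>_prod n z))\<^sup>2 * (1 - (cmod z)\<^sup>2)"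
proof (induction n)
  case (Suc n)
  let ?y = "(\<phi> ^^ n) z"
  have p: "1 - (cmod ?y)\<^sup>2 \<noteq> 0" "1 - (cmod (\<phi> ?y))\<^sup>2 \<noteq> 0"
    using disc_pos[OF iterate_in_disc[OF Suc.prems, of n]] disc_pos[OF iterate_in_disc[OF Suc.prems, of "Suc n"]] by auto
  have "W ?y * (1 - (cmod (\<phi> ?y))\<^sup>2) = (cmod (\<psi> ?y))\<^sup>2 * (1 - (cmod ?y)\<^sup>2)"
    unfolding W_def using p by simp
  moreover have "(\<Prod>j<n. W ((\<phi> ^^ j) z)) * (1 - (cmod ?y)\<^sup>2) = (cmod (\<psi>_prod n z))\<^sup>2 * (1 - (cmod z)\<^sup>2)"
    by (rule Suc.IH[OF Suc.prems])
  moreover have "(p * w) * x = (q * g) * h" if "w * x = g * y" "p * y = q * h" for p w x q g h y :: real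
    using that by (metis mult.assoc mult.commute)
  ultimately have "((\<Prod>j<n. W ((\<phi> ^^ j) z)) * W ?y) * (1 - (cmod (\<phi> ?y))\<^sup>2)
      = ((cmod (\<psi>_prod n z))\<^sup>2 * (cmod (\<psi> ?y))\<^sup>2) * (1 - (cmod z)\<^sup>2)" by blast
  thus ?case by (simp add: \<psi>_prod_def norm_mult power_mult_distrib)
qed (simp add: \<psi>_prod_def)

lemma \<psi>_prod_bounded: "\<psi>_prod n \<in> H\<^sup>\<infinity>"
proof (induction n)
  case 0
  show ?case by (simp add: \<psi>_prod_def[abs_def] bounded_holomorphic_const)
next
  case (Suc n)
  have "(\<lambda>z. \<psi> ((\<phi> ^^ n) z)) \<in> H\<^sup>\<infinity>"
  proof -
    obtain C where C: "\<forall>z\<in>\<D>. cmod (\<psi> z) \<le> C" using bounded_holomorphic_bound[OF \<psi>] by blast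
    show ?thesis
    proof (rule bounded_holomorphicI)
      have "(\<phi> ^^ n) holomorphic_on \<D>" "(\<phi> ^^ n) ` \<D> \<subseteq> \<D>"
        using disc_bijection_funpow[OF \<phi>, of n] by (auto simp: disc_bijection_def bij_betw_def)
      moreover have "\<psi> holomorphic_on \<D>" using \<psi> by (simp add: bounded_holomorphic_def)
      ultimately show "(\<lambda>z. \<psi> ((\<phi> ^^ n) z)) holomorphic_on \<D>"
        using holomorphic_on_compose_gen[of "\<phi> ^^ n" \<D> \<psi> \<D>] by (simp add: o_def)
      show "cmod (\<psi> ((\<phi> ^^ n) z)) \<le> C" if "z \<in> \<D>" for z using C iterate_in_disc[OF that] by blast
    qed
  qed
  from bounded_holomorphic_mult[OF Suc this] show ?case by (simp add: \<psi>_prod_def[abs_def])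
qed

lemma T_power: "(blinfun_apply T ^^ n) f = wcop (\<psi>_prod n) (\<phi> ^^ n) f"
proof (induction n)
  case 0
  show ?case
    by (rule hardy_eqI)
       (simp only: hfun_wcop[OF \<psi>_prod_bounded disc_bijection_funpow[OF \<phi>]], simp add: \<psi>_prod_def)
next
  case (Suc n)
  show ?case
  proof (rule hardy_eqI)
    fix z assume z: "z \<in> \<D>"
    have "hfun ((blinfun_apply T ^^ Suc n) f) z = \<psi> z * hfun (wcop (\<psi>_prod n) (\<phi> ^^ n) f) (\<phi> z)"
      by (simp only: funpow.simps o_apply Suc) (simp only: T_def hfun_wcop[OF \<psi> \<phi> z])
    also have "\<dots> = (\<psi> z * \<psi>_prod n (\<phi> z)) * hfun f ((\<phi> ^^ n) (\<phi> z))"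
      by (simp only: hfun_wcop[OF \<psi>_prod_bounded disc_bijection_funpow[OF \<phi>] disc_bijection_in_disc[OF \<phi> z]] mult.assoc)
    also have "\<psi> z * \<psi>_prod n (\<phi> z) = \<psi>_prod (Suc n) z"
      unfolding \<psi>_prod_def prod.lessThan_Suc_shift by (simp add: funpow_swap1)
    also have "(\<phi> ^^ n) (\<phi> z) = (\<phi> ^^ Suc n) z" by (simp add: funpow_swap1)
    finally show "hfun ((blinfun_apply T ^^ Suc n) f) z = hfun (wcop (\<psi>_prod (Suc n)) (\<phi> ^^ Suc n) f) z"
      by (simp only: hfun_wcop[OF \<psi>_prod_bounded disc_bijection_funpow[OF \<phi>] z])
  qed
qed

lemma T_power_norm_le:
  assumes B: "0 \<le> B" "\<And>z. z \<in> \<D> \<Longrightarrow> (\<Prod>j<n. W ((\<phi> ^^ j) z)) \<le> B\<^sup>2"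
  shows "norm ((blinfun_apply T ^^ n) f) \<le> B * norm f"
proof -
  have "norm (wcop (\<psi>_prod n) (\<phi> ^^ n)) \<le> B"
  proof (rule norm_wcop_le[OF \<psi>_prod_bounded disc_bijection_funpow[OF \<phi>] B(1)])
    fix z assume z: "z \<in> \<D>"
    show "(cmod (\<psi>_prod n z))\<^sup>2 * (1 - (cmod z)\<^sup>2) \<le> B\<^sup>2 * (1 - (cmod ((\<phi> ^^ n) z))\<^sup>2)"
      unfolding prod_W[OF z, symmetric]
      using B(2)[OF z] disc_pos[OF iterate_in_disc[OF z, of n]] by (intro mult_right_mono) auto
  qed
  thus ?thesis unfolding T_power by (intro order.trans[OF norm_blinfun mult_right_mono]) auto
qed

text \<open>
  Test on the reproducing kernel of the \<open>n\<close>-th iterate of \<open>z\<close>, and evaluate the image at \<open>z\<close>.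
\<close>

lemma T_power_norm_lower:
  assumes C: "\<And>f. norm ((blinfun_apply T ^^ n) f) \<le> C * norm f" and z: "z \<in> \<D>"
  shows "(\<Prod>j<n. W ((\<phi> ^^ j) z)) \<le> C\<^sup>2"
proof -
  let ?w = "(\<phi> ^^ n) z"
  have w: "?w \<in> \<D>" by (rule iterate_in_disc[OF z])
  let ?x = "1 - (cmod ?w)\<^sup>2" and ?y = "1 - (cmod z)\<^sup>2"
  have x: "0 < ?x" and y: "0 < ?y" using disc_pos w z by blast+
  obtain k where k: "\<And>z. z \<in> \<D> \<Longrightarrow> hfun k z = 1 / (1 - cnj ?w * z)" "(norm k)\<^sup>2 = 1 / ?x"
    by (rule hardy_kernel[OF w]) blast
  have "cnj ?w * ?w = of_real ((cmod ?w)\<^sup>2)" by (metis complex_norm_square mult.commute)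
  hence kw: "hfun k ?w = of_real (1 / ?x)" by (simp add: k(1)[OF w])
  have "hfun ((blinfun_apply T ^^ n) k) z = \<psi>_prod n z * hfun k ?w"
    unfolding T_power by (rule hfun_wcop[OF \<psi>_prod_bounded disc_bijection_funpow[OF \<phi>] z])
  hence "cmod (\<psi>_prod n z) * (1 / ?x) * sqrt ?y \<le> C * norm k"
    using order.trans[OF norm_hfun_le[OF z] C, of k] x by (simp add: norm_mult kw del: of_real_divide)
  hence "(cmod (\<psi>_prod n z) * (1 / ?x) * sqrt ?y)\<^sup>2 \<le> (C * norm k)\<^sup>2"
    using x y by (intro power_mono) auto
  hence "(cmod (\<psi>_prod n z))\<^sup>2 * (1 / ?x)\<^sup>2 * ?y \<le> C\<^sup>2 * (1 / ?x)"
    using y by (simp only: power_mult_distrib k(2) real_sqrt_pow2 less_imp_le)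
  hence "(1 / ?x) * ((cmod (\<psi>_prod n z))\<^sup>2 * ?y) * (1 / ?x) \<le> C\<^sup>2 * (1 / ?x)"
    by (simp only: power2_eq_square mult_ac)
  hence "(1 / ?x) * ((cmod (\<psi>_prod n z))\<^sup>2 * ?y) \<le> C\<^sup>2"
    using x by (simp only: mult_le_cancel_right_pos zero_less_divide_1_iff)
  thus ?thesis unfolding prod_W[OF z, symmetric] using x by simp
qed

lemma T_scale: "T (hscale c f) = hscale c (T f)"
  by (rule hardy_eqI) (simp only: T_def hfun_wcop[OF \<psi> \<phi>] hfun_hscale, rule mult.left_commute)

lemma resolvent_scale:
  fixes R :: "hardy \<Rightarrow>\<^sub>L hardy"
  assumes R: "\<And>f. R (T f - hscale \<mu> f) = f" "\<And>f. T (R f) - hscale \<mu> (R f) = f"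
  shows "R (hscale c f) = hscale c (R f)"
proof (rule inverse_commute[of R "\<lambda>f. T f - hscale \<mu> f" "hscale c", symmetric])
  show "hscale c (T f - hscale \<mu> f) = T (hscale c f) - hscale \<mu> (hscale c f)" for f
    by (simp only: blinfun.diff_right T_scale hscale_commute[of c \<mu>])
qed (rule R)+

lemma e_multiplier:
  assumes z: "z \<in> \<D>"
  shows "e \<theta> (\<phi> z) = cis (\<theta> * ln s) * e \<theta> z"
proof -
  have "\<zeta> (\<phi> z) = of_real (ln s) + \<zeta> z"
    unfolding \<zeta>_def multiplier[OF z] using s(1) u_nonzero[OF z] by (simp add: Ln_times_of_real Ln_of_real)
  thus ?thesis by (simp add: e_def cis_conv_exp exp_add ring_distribs mult_ac)
qed

lemma e_add: "e (x + y) z = e x z * e y z"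
  by (simp add: e_def exp_add ring_distribs)

lemma e_zero: "e 0 z = 1"
  by (simp add: e_def)

text \<open>
  With \<open>A = T / \<mu>\<close>, multiplication by \<open>e (x / ln s)\<close> conjugates \<open>A\<close> to \<open>cis x A\<close>, so one inverse
  yields the inverses of all \<open>I - cis x A\<close>. Conjugation with \<open>e \<theta>\<close> only rotates this family,
  hence its Riesz projection commutes with all multiplications by \<open>e \<theta>\<close> and is 0 or the
  identity.
\<close>

theorem resolvent_dichotomy:
  assumes \<mu>: "\<mu> \<noteq> 0" and inv: "invertible_operator (T - hscale \<mu>)"
  shows "invertible_operator T \<or> (\<exists>C. \<forall>n f. norm ((blinfun_apply T ^^ n) f) \<le> C * cmod \<mu> ^ n * norm f)"
proof -
  define A where "A = hscale (1 / \<mu>) o\<^sub>L T"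
  have A: "A f = hscale (1 / \<mu>) (T f)" for f by (simp add: A_def)
  have Ac: "A (hscale c f) = hscale c (A f)" for c f
    by (simp only: A T_scale hscale_mult[symmetric] mult.commute)
  obtain R :: "hardy \<Rightarrow>\<^sub>L hardy" where R: "\<And>f. R (T f - hscale \<mu> f) = f" "\<And>f. T (R f) - hscale \<mu> (R f) = f"
    using inv by (auto simp: invertible_operator_def blinfun.diff_left)
  have IA: "f - A f = hscale (- 1 / \<mu>) (T f - hscale \<mu> f)" for f
    by (rule hardy_eqI) (use \<mu> in \<open>simp add: hfun_diff hfun_hscale A divide_simps\<close>)
  note Rc = resolvent_scale[OF R]
  define S where "S = hscale (- \<mu>) o\<^sub>L R"
  have cancel: "hscale (- \<mu>) (hscale (- 1 / \<mu>) f) = f" "hscale (- 1 / \<mu>) (hscale (- \<mu>) f) = f" for f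
    using \<mu> by (simp_all add: hscale_one flip: hscale_mult)
  have S1: "S (f - A f) = f" for f
    by (simp only: IA S_def blinfun_apply_blinfun_compose Rc R cancel)
  have S2: "S f - A (S f) = f" for f
  proof -
    have "T (S f) - hscale \<mu> (S f) = hscale (- \<mu>) (T (R f) - hscale \<mu> (R f))"
      by (simp only: S_def blinfun_apply_blinfun_compose T_scale blinfun.diff_right hscale_commute[of \<mu> "- \<mu>"])
    thus ?thesis by (simp only: IA R cancel)
  qed
  define \<tau> where "\<tau> = ln s"
  have \<tau>: "\<tau> \<noteq> 0" using s by (simp add: \<tau>_def)
  let ?M = "\<lambda>\<theta>. hmult (e \<theta>)"
  have M: "hfun (?M \<theta> f) z = e \<theta> z * hfun f z" if "z \<in> \<D>" for \<theta> f z
    by (rule hfun_hmult[OF e_bounded_holomorphic that])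
  have M_add: "?M (x + y) f = ?M x (?M y f)" for x y f
    by (rule hardy_eqI) (simp only: M e_add mult.assoc)
  have M_zero: "?M 0 f = f" for f
    by (rule hardy_eqI) (simp only: M e_zero mult_1)
  have M_c: "?M \<theta> (hscale c f) = hscale c (?M \<theta> f)" for \<theta> c f
    by (rule hardy_eqI) (simp only: M hfun_hscale, rule mult.left_commute)
  have AM: "A (?M (x / \<tau>) f) = ?M (x / \<tau>) (hscale (cis x) (A f))" for x f
  proof (rule hardy_eqI)
    fix z assume z: "z \<in> \<D>"
    have "e (x / \<tau>) (\<phi> z) = cis x * e (x / \<tau>) z" using e_multiplier[OF z, of "x / \<tau>"] \<tau> by (simp add: \<tau>_def)
    thus "hfun (A (?M (x / \<tau>) f)) z = hfun (?M (x / \<tau>) (hscale (cis x) (A f))) z"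
      by (simp only: A T_def hfun_hscale hfun_wcop[OF \<psi> \<phi> z] M[OF z] M[OF disc_bijection_in_disc[OF \<phi> z]]) simp
  qed
  (* The inverse S of I - A is carried around the whole circle by conjugation. *)
  define G where "G x = ?M (- x / \<tau>) o\<^sub>L S o\<^sub>L ?M (x / \<tau>)" for x
  have MM: "?M (- x / \<tau>) (?M (x / \<tau>) f) = f" "?M (x / \<tau>) (?M (- x / \<tau>) f) = f" for x f
    by (simp_all add: M_zero flip: M_add)
  interpret circle_resolvent hscale A G
  proof (rule circle_resolvent.intro)
    show "bounded_linear hscale" by (rule bounded_linear_hscale)
    fix x f
    show "G x (f - hscale (cis x) (A f)) = f"
      unfolding G_def blinfun_apply_blinfun_compose blinfun.diff_right[of "?M (x / \<tau>)"] AM[symmetric] S1 MM ..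
    have eq: "hscale (cis x) (A (?M (- x / \<tau>) g)) = ?M (- x / \<tau>) (A g)" for g
    proof -
      have "?M (- x / \<tau>) (A (?M (x / \<tau>) (?M (- x / \<tau>) g))) = hscale (cis x) (A (?M (- x / \<tau>) g))"
        unfolding AM[of x] by (rule MM(1))
      thus ?thesis by (simp only: MM(2))
    qed
    show "G x f - hscale (cis x) (A (G x f)) = f"
      unfolding G_def blinfun_apply_blinfun_compose eq blinfun.diff_right[symmetric] S2 MM ..
  qed (rule hscale_one hscale_mult Ac)+
  have "(\<forall>f. proj f = 0) \<or> (\<forall>f. proj f = f)"
  proof (rule projection_zero_or_id[OF proj_idem proj_c \<tau>])
    fix t f assume t: "0 \<le> t" "t \<le> 2 * pi"
    show "proj (?M (t / \<tau>) f) = ?M (t / \<tau>) (proj f)"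
    proof (rule proj_commute_shift[OF t])
      fix x f
      have "?M (t / \<tau>) (?M (- (x + t) / \<tau>) g) = ?M (- x / \<tau>) g" for g
        by (simp add: diff_divide_distrib add_divide_distrib flip: M_add)
      moreover have "?M (x / \<tau>) (?M (t / \<tau>) f) = ?M ((x + t) / \<tau>) f"
        by (simp add: add_divide_distrib M_add)
      ultimately show "G x (?M (t / \<tau>) f) = ?M (t / \<tau>) (G (x + t) f)"
        unfolding G_def blinfun_apply_blinfun_compose by simp
    qed
  qed
  thus ?thesis
  proof
    assume "\<forall>f. proj f = 0"
    then obtain B :: "hardy \<Rightarrow>\<^sub>L hardy" where B: "\<And>f. A (B f) = f" "\<And>f. B (A f) = f" "\<And>c f. B (hscale c f) = hscale c (B f)"
      using proj_zero_imp_invertible by blast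
    have TA: "T f = hscale \<mu> (A f)" for f using \<mu> by (simp add: A hscale_one flip: hscale_mult)
    have "(B o\<^sub>L hscale (1 / \<mu>)) (T f) = f" "T ((B o\<^sub>L hscale (1 / \<mu>)) f) = f" for f
      using \<mu> by (simp_all add: TA Ac B hscale_one flip: hscale_mult)
    thus ?thesis unfolding invertible_operator_def by blast
  next
    assume "\<forall>f. proj f = f"
    then obtain C where C: "\<And>n f. norm ((blinfun_apply A ^^ n) f) \<le> C * norm f"
      using proj_id_imp_power_bounded by blast
    have "(blinfun_apply T ^^ n) f = hscale (\<mu> ^ n) ((blinfun_apply A ^^ n) f)" for n f
    proof (induction n)
      case (Suc n)
      have "T (hscale (\<mu> ^ n) g) = hscale (\<mu> ^ Suc n) (A g)" for g
        using \<mu> by (simp add: A T_scale flip: hscale_mult)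
      thus ?case by (simp only: funpow.simps o_apply Suc)
    qed (simp add: hscale_one)
    hence "norm ((blinfun_apply T ^^ n) f) \<le> C * cmod \<mu> ^ n * norm f" for n f
      using mult_left_mono[OF C[of n f], of "cmod \<mu> ^ n"] by (simp add: norm_hscale norm_power mult_ac)
    thus ?thesis by blast
  qed
qed

end

section \<open>The spectrum\<close>

lemma iterated_product_limit:
  assumes \<phi>D: "\<And>z. z \<in> \<D> \<Longrightarrow> \<phi> z \<in> \<D>" and c: "c \<in> \<T>"
    and \<phi>: "(\<phi> \<longlongrightarrow> c) (at c within \<D>)" and W: "(W \<longlongrightarrow> l) (at c within \<D>)"
  shows "((\<lambda>z. \<Prod>j<n. W ((\<phi> ^^ j) z) :: real) \<longlongrightarrow> l ^ n) (at c within \<D>)"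
proof -
  have D: "eventually (\<lambda>z. z \<in> \<D>) (at c within \<D>)"
    by (simp add: eventually_at_filter)
  have it: "(\<phi> ^^ j) z \<in> \<D>" if "z \<in> \<D>" for j z using that \<phi>D by (induction j) auto
  have lim: "filterlim (\<phi> ^^ j) (at c within \<D>) (at c within \<D>)" for j
  proof (induction j)
    case 0 show ?case by (simp add: filterlim_ident id_def)
  next
    case (Suc j)
    have "filterlim \<phi> (at c within \<D>) (at c within \<D>)"
    proof (rule filterlim_at[THEN iffD2], intro conjI \<phi>)
      show "\<forall>\<^sub>F z in at c within \<D>. \<phi> z \<in> \<D> \<and> \<phi> z \<noteq> c"
        using D by eventually_elim (use \<phi>D c in fastforce)
    qed
    from filterlim_compose[OF this Suc] show ?case by (simp add: o_def)
  qed
  have "((\<lambda>z. \<Prod>j<n. W ((\<phi> ^^ j) z)) \<longlongrightarrow> (\<Prod>j<n. l)) (at c within \<D>)"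
    by (intro tendsto_prod filterlim_compose[OF W lim])
  thus ?thesis by simp
qed

lemma boundary_nontrivial: "c \<in> \<T> \<Longrightarrow> at c within \<D> \<noteq> bot"
  by (subst trivial_limit_within) (simp add: islimpt_ball)

lemma geometric_domination:
  fixes x y C :: real
  assumes "\<And>n. x ^ n \<le> C * y ^ n" "0 \<le> x" "0 < y"
  shows "x \<le> y"
proof (rule ccontr)
  assume "\<not> x \<le> y"
  hence "1 < x / y" using assms(3) by simp
  then obtain n where "C < (x / y) ^ n" using real_arch_pow by blast
  hence "C * y ^ n < x ^ n" using assms(3) by (simp add: power_divide less_divide_eq)
  thus False using assms(1)[of n] by simp
qed

context hyperbolic_composition
begin

text \<open>
  For fixed \<open>n\<close> the product of \<open>W\<close> over \<open>n\<close> orbit points tends to \<open>l ^ n\<close> when the starting point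
  tends to \<open>c\<close>.
\<close>

lemma power_bound_imp_boundary_le:
  assumes C: "\<And>n f. norm ((blinfun_apply T ^^ n) f) \<le> C * r ^ n * norm f" and r: "0 < r"
    and c: "c \<in> \<T>" and \<phi>c: "(\<phi> \<longlongrightarrow> c) (at c within \<D>)" and W: "(W \<longlongrightarrow> l) (at c within \<D>)"
  shows "l \<le> r\<^sup>2"
proof -
  have D: "eventually (\<lambda>z. z \<in> \<D>) (at c within \<D>)"
    by (simp add: eventually_at_filter)
  have l0: "0 \<le> l"
    by (rule tendsto_lowerbound[OF W _ boundary_nontrivial[OF c]], rule eventually_mono[OF D]) (rule W_nonneg)
  have "l ^ n \<le> C\<^sup>2 * (r\<^sup>2) ^ n" for n
  proof (rule tendsto_upperbound[OF iterated_product_limit[OF _ c \<phi>c W] _ boundary_nontrivial[OF c]])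
    show "\<forall>\<^sub>F z in at c within \<D>. (\<Prod>j<n. W ((\<phi> ^^ j) z)) \<le> C\<^sup>2 * (r\<^sup>2) ^ n"
    proof (rule eventually_mono[OF D])
      fix z assume "z \<in> \<D>"
      from T_power_norm_lower[OF C this, of n]
      show "(\<Prod>j<n. W ((\<phi> ^^ j) z)) \<le> C\<^sup>2 * (r\<^sup>2) ^ n"
        by (simp add: power_mult_distrib mult.commute flip: power_mult)
    qed
  qed (rule disc_bijection_in_disc[OF \<phi>])
  thus ?thesis by (rule geometric_domination[OF _ l0]) (use r in simp)
qed

lemma W_bounded: obtains M where "\<And>z. z \<in> \<D> \<Longrightarrow> W z \<le> M"
proof -
  obtain C where C: "\<forall>z\<in>\<D>. cmod (\<psi> z) \<le> C" using bounded_holomorphic_bound[OF \<psi>] by blast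
  obtain \<delta> where \<delta>: "0 < \<delta>" "\<And>z. z \<in> \<D> \<Longrightarrow> \<delta> * (1 - (cmod z)\<^sup>2) \<le> 1 - (cmod (\<phi> z))\<^sup>2"
    using disc_bijection_distortion[OF \<phi>] by blast
  have "W z \<le> C\<^sup>2 / \<delta>" if z: "z \<in> \<D>" for z
  proof -
    have "\<delta> \<le> (1 - (cmod (\<phi> z))\<^sup>2) / (1 - (cmod z)\<^sup>2)"
      using \<delta>(2)[OF z] disc_pos[OF z] by (simp add: pos_le_divide_eq)
    thus ?thesis unfolding W_def using C z \<delta>(1) by (intro frac_le power_mono) auto
  qed
  thus ?thesis by (rule that)
qed

lemma T_power_upper:
  assumes Wa: "(W \<longlongrightarrow> la) (at a within \<D>)" "la < r\<^sup>2" and Wb: "(W \<longlongrightarrow> lb) (at b within \<D>)" "lb < r\<^sup>2"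
    and r: "0 < r"
  obtains K where "0 \<le> K" "\<And>n f. norm ((blinfun_apply T ^^ n) f) \<le> K * r ^ n * norm f"
proof -
  have "eventually (\<lambda>z. W z < r\<^sup>2) (at a within \<D>)" by (rule order_tendstoD(2)[OF Wa])
  then obtain da where da: "0 < da" "\<forall>z\<in>\<D>. z \<noteq> a \<and> dist z a < da \<longrightarrow> W z < r\<^sup>2"
    unfolding eventually_at by blast
  have "eventually (\<lambda>z. W z < r\<^sup>2) (at b within \<D>)" by (rule order_tendstoD(2)[OF Wb])
  then obtain db where db: "0 < db" "\<forall>z\<in>\<D>. z \<noteq> b \<and> dist z b < db \<longrightarrow> W z < r\<^sup>2"
    unfolding eventually_at by blast
  obtain M where M: "\<And>z. z \<in> \<D> \<Longrightarrow> W z \<le> M" by (rule W_bounded) blast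
  have near: "W z \<le> r\<^sup>2" if z: "z \<in> \<D>" and d: "dist z a < min da db \<or> dist z b < min da db" for z
  proof -
    have "z \<noteq> a" "z \<noteq> b" using z a b by auto
    hence "W z < r\<^sup>2" using d da(2) db(2) z by (metis min_less_iff_conj)
    thus ?thesis by simp
  qed
  have pos: "0 < min da db" "0 < r\<^sup>2" using da(1) db(1) r by simp_all
  obtain K where K: "0 \<le> K" "\<And>n z. z \<in> \<D> \<Longrightarrow> (\<Prod>j<n. W ((\<phi> ^^ j) z)) \<le> K * (r\<^sup>2) ^ n"
    by (rule orbit_product_bound[OF disc_bijection_in_disc[OF \<phi>] s multiplier W_nonneg M pos near]) blast+
  show ?thesis
  proof (rule that)
    show "0 \<le> sqrt K" using K by simp
    show "norm ((blinfun_apply T ^^ n) f) \<le> sqrt K * r ^ n * norm f" for n f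
    proof (rule T_power_norm_le)
      show "0 \<le> sqrt K * r ^ n" using K r by simp
      have "(sqrt K * r ^ n)\<^sup>2 = K * (r\<^sup>2) ^ n" using K by (simp add: power_mult_distrib mult.commute flip: power_mult)
      thus "(\<Prod>j<n. W ((\<phi> ^^ j) z)) \<le> (sqrt K * r ^ n)\<^sup>2" if "z \<in> \<D>" for z using K(2)[OF that, of n] by simp
    qed
  qed
qed

lemma scaled_power: "(blinfun_apply (hscale x o\<^sub>L T) ^^ n) f = hscale (x ^ n) ((blinfun_apply T ^^ n) f)"
proof (induction n)
  case (Suc n)
  have "(blinfun_apply (hscale x o\<^sub>L T) ^^ Suc n) f = (hscale x o\<^sub>L T) (hscale (x ^ n) ((blinfun_apply T ^^ n) f))"
    by (simp only: funpow.simps o_apply Suc)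
  also have "\<dots> = hscale (x ^ Suc n) ((blinfun_apply T ^^ Suc n) f)"
    by (simp add: T_scale flip: hscale_mult)
  finally show ?case .
qed (simp add: hscale_one)

lemma invertible_outside:
  assumes T: "\<And>n f. norm ((blinfun_apply T ^^ n) f) \<le> K * r ^ n * norm f" "0 \<le> K" "0 < r" and \<mu>: "r < cmod \<mu>"
  shows "invertible_operator (T - hscale \<mu>)"
proof -
  have \<mu>0: "\<mu> \<noteq> 0" using \<mu> T(3) by auto
  let ?A = "hscale (1 / \<mu>) o\<^sub>L T"
  have le: "norm ((blinfun_apply ?A ^^ n) f) \<le> K * (r / cmod \<mu>) ^ n * norm f" for n f
  proof -
    have "norm ((blinfun_apply ?A ^^ n) f) = norm ((blinfun_apply T ^^ n) f) / cmod \<mu> ^ n"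
      unfolding scaled_power by (simp add: norm_hscale norm_power norm_divide power_divide)
    also have "\<dots> \<le> K * r ^ n * norm f / cmod \<mu> ^ n" by (intro divide_right_mono T) auto
    finally show ?thesis by (simp add: power_divide)
  qed
  have "0 \<le> r / cmod \<mu>" "r / cmod \<mu> < 1" using T(3) \<mu> by (simp_all add: divide_less_eq)
  then obtain B :: "hardy \<Rightarrow>\<^sub>L hardy" where B: "\<And>f. B (f - ?A f) = f" "\<And>f. B f - ?A (B f) = f"
    using neumann_inverse[OF le _ _ T(2)] by blast
  note B' = B[unfolded blinfun_apply_blinfun_compose]
  have IA: "T f - hscale \<mu> f = hscale (- \<mu>) (f - ?A f)" for f
    by (rule hardy_eqI) (use \<mu>0 in \<open>simp add: hfun_diff hfun_hscale algebra_simps\<close>)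
  have Bc: "B (hscale c f) = hscale c (B f)" for c f
  proof (rule inverse_commute[of B "\<lambda>f. f - ?A f" "hscale c", symmetric])
    show "hscale c (f - ?A f) = hscale c f - ?A (hscale c f)" for f
      by (simp only: blinfun.diff_right blinfun_apply_blinfun_compose T_scale hscale_commute[of c "1 / \<mu>"])
  qed (rule B)+
  have cancel: "hscale (- 1 / \<mu>) (hscale (- \<mu>) f) = f" "hscale (- \<mu>) (hscale (- 1 / \<mu>) f) = f" for f
    using \<mu>0 by (simp_all add: hscale_one flip: hscale_mult)
  have "(hscale (- 1 / \<mu>) o\<^sub>L B) ((T - hscale \<mu>) f) = f" for f
    by (simp only: blinfun_apply_blinfun_compose blinfun.diff_left IA Bc cancel B')
  moreover have "(T - hscale \<mu>) ((hscale (- 1 / \<mu>) o\<^sub>L B) f) = f" for f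
  proof -
    have "(hscale (- 1 / \<mu>) o\<^sub>L B) f = B (hscale (- 1 / \<mu>) f)" by (simp only: blinfun_apply_blinfun_compose Bc)
    thus ?thesis unfolding blinfun.diff_left IA by (simp only: B cancel)
  qed
  ultimately show ?thesis unfolding invertible_operator_def by blast
qed

lemma resolvent_set_open:
  assumes inv: "invertible_operator (T - hscale \<mu>)"
  obtains \<epsilon> where "0 < \<epsilon>" "\<And>\<nu>. dist \<nu> \<mu> < \<epsilon> \<Longrightarrow> invertible_operator (T - hscale \<nu>)"
proof -
  obtain R :: "hardy \<Rightarrow>\<^sub>L hardy" where R: "\<And>f. R (T f - hscale \<mu> f) = f" "\<And>f. T (R f) - hscale \<mu> (R f) = f"
    using inv by (auto simp: invertible_operator_def blinfun.diff_left)
  note Rc = resolvent_scale[OF R]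
  define \<epsilon> where "\<epsilon> = 1 / (2 * (norm R + 1))"
  have \<epsilon>: "0 < \<epsilon>" unfolding \<epsilon>_def by (intro divide_pos_pos mult_pos_pos) (auto intro: add_nonneg_pos)
  show ?thesis
  proof (rule that[OF \<epsilon>])
    fix \<nu> assume \<nu>: "dist \<nu> \<mu> < \<epsilon>"
    define x where "x = \<nu> - \<mu>"
    let ?A = "hscale x o\<^sub>L R"
    have x: "cmod x * (norm R + 1) \<le> 1 / 2"
    proof -
      have "cmod x * (norm R + 1) \<le> \<epsilon> * (norm R + 1)" using \<nu> by (intro mult_right_mono) (auto simp: x_def dist_norm)
      also have "\<dots> = 1 / 2" using norm_ge_zero[of R] by (simp add: \<epsilon>_def add_nonneg_eq_0_iff)
      finally show ?thesis .
    qed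
    have A1: "norm (?A f) \<le> (1 / 2) * norm f" for f
    proof -
      have "norm (?A f) \<le> cmod x * (norm R * norm f)"
        by (simp add: norm_hscale mult_left_mono norm_blinfun)
      also have "\<dots> \<le> (cmod x * (norm R + 1)) * norm f" by (simp add: mult_left_mono mult_right_mono algebra_simps)
      also have "\<dots> \<le> (1 / 2) * norm f" using x by (intro mult_right_mono) auto
      finally show ?thesis .
    qed
    have le: "norm ((blinfun_apply ?A ^^ n) f) \<le> 1 * (1 / 2) ^ n * norm f" for n f
    proof (induction n)
      case (Suc n)
      have "norm ((blinfun_apply ?A ^^ Suc n) f) \<le> (1 / 2) * norm ((blinfun_apply ?A ^^ n) f)"
        unfolding funpow.simps o_apply by (rule A1)
      also have "\<dots> \<le> (1 / 2) * (1 * (1 / 2) ^ n * norm f)" by (rule mult_left_mono[OF Suc]) simp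
      also have "\<dots> = 1 * (1 / 2) ^ Suc n * norm f" by simp
      finally show ?case .
    qed simp
    have "0 \<le> (1 / 2 :: real)" "1 / 2 < (1 :: real)" "0 \<le> (1 :: real)" by simp_all
    then obtain B :: "hardy \<Rightarrow>\<^sub>L hardy" where B: "\<And>f. B (f - ?A f) = f" "\<And>f. B f - ?A (B f) = f"
      using neumann_inverse[OF le] by blast
    have step: "T (R f) - hscale \<nu> (R f) = f - ?A f" for f
    proof -
      have "T (R f) - hscale \<nu> (R f) = (T (R f) - hscale \<mu> (R f)) - hscale x (R f)"
        by (rule hardy_eqI) (simp add: x_def hfun_diff hfun_add hfun_hscale algebra_simps)
      thus ?thesis by (simp add: R)
    qed
    have step': "R (T f - hscale \<nu> f) = f - ?A f" for f
    proof -
      have eq: "T f - hscale \<nu> f = (T f - hscale \<mu> f) - hscale x f"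
        by (rule hardy_eqI) (simp add: x_def hfun_diff hfun_add hfun_hscale algebra_simps)
      show ?thesis
        unfolding eq blinfun.diff_right[of R "T f - hscale \<mu> f"] R Rc blinfun_apply_blinfun_compose ..
    qed
    have left: "(B o\<^sub>L R) ((T - hscale \<nu>) f) = f" for f
      unfolding blinfun_apply_blinfun_compose[of B R] blinfun.diff_left step' by (rule B)
    have right: "(T - hscale \<nu>) ((R o\<^sub>L B) f) = f" for f
      unfolding blinfun_apply_blinfun_compose[of R B] blinfun.diff_left step by (rule B)
    have "(R o\<^sub>L B) f = (B o\<^sub>L R) f" for f by (metis left right)
    thus "invertible_operator (T - hscale \<nu>)"
      unfolding invertible_operator_def using left right by metis
  qed
qed

text \<open>
  The dichotomy shows that resolvent points have modulus at least \<open>sqrt (max la lb)\<close>; equality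
  is impossible because the resolvent set is open.
\<close>

theorem invertible_iff_outside_disc:
  assumes \<phi>a: "(\<phi> \<longlongrightarrow> a) (at a within \<D>)" and Wa: "(W \<longlongrightarrow> la) (at a within \<D>)"
    and \<phi>b: "(\<phi> \<longlongrightarrow> b) (at b within \<D>)" and Wb: "(W \<longlongrightarrow> lb) (at b within \<D>)"
    and T: "\<not> invertible_operator T"
  shows "invertible_operator (T - hscale \<mu>) \<longleftrightarrow> sqrt (max la lb) < cmod \<mu>"
proof -
  have aT: "a \<in> \<T>" and bT: "b \<in> \<T>" using a b by simp_all
  have D: "eventually (\<lambda>z. z \<in> \<D>) (at c within \<D>)" for c
    by (simp add: eventually_at_filter)
  have la: "0 \<le> la"
    by (rule tendsto_lowerbound[OF Wa _ boundary_nontrivial[OF aT]], rule eventually_mono[OF D]) (rule W_nonneg)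
  have lb: "0 \<le> lb"
    by (rule tendsto_lowerbound[OF Wb _ boundary_nontrivial[OF bT]], rule eventually_mono[OF D]) (rule W_nonneg)
  define \<rho> where "\<rho> = sqrt (max la lb)"
  have \<rho>0: "0 \<le> \<rho>" and \<rho>2: "\<rho>\<^sup>2 = max la lb" using la lb by (simp_all add: \<rho>_def)
  have T0: "\<not> invertible_operator (T - hscale 0)"
  proof -
    have "hscale 0 = 0" by (rule blinfun_eqI, rule hardy_eqI) (simp add: hfun_hscale hfun_0)
    thus ?thesis using T by simp
  qed
  have below: "\<rho> \<le> cmod \<nu>" if inv: "invertible_operator (T - hscale \<nu>)" for \<nu>
  proof -
    have \<nu>: "\<nu> \<noteq> 0" using inv T0 by auto
    from resolvent_dichotomy[OF \<nu> inv] T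
    obtain C where C: "\<And>n f. norm ((blinfun_apply T ^^ n) f) \<le> C * cmod \<nu> ^ n * norm f" by blast
    have "max la lb \<le> (cmod \<nu>)\<^sup>2"
      using power_bound_imp_boundary_le[OF C _ aT \<phi>a Wa] power_bound_imp_boundary_le[OF C _ bT \<phi>b Wb] \<nu> by simp
    thus ?thesis unfolding \<rho>2[symmetric] by (rule power2_le_imp_le) simp
  qed
  show ?thesis unfolding \<rho>_def[symmetric]
  proof
    assume inv: "invertible_operator (T - hscale \<mu>)"
    have \<mu>: "\<mu> \<noteq> 0" using inv T0 by auto
    obtain \<epsilon> where \<epsilon>: "0 < \<epsilon>" "\<And>\<nu>. dist \<nu> \<mu> < \<epsilon> \<Longrightarrow> invertible_operator (T - hscale \<nu>)"
      by (rule resolvent_set_open[OF inv]) blast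
    (* Shrinking \<mu> slightly stays in the resolvent set, which excludes equality. *)
    define t where "t = min (1 / 2) (\<epsilon> / (2 * cmod \<mu>))"
    have t: "0 < t" "t < 1" "t * cmod \<mu> < \<epsilon>"
    proof -
      show "0 < t" "t < 1" using \<epsilon>(1) \<mu> by (auto simp: t_def)
      have "t * cmod \<mu> \<le> \<epsilon> / (2 * cmod \<mu>) * cmod \<mu>" by (intro mult_right_mono) (auto simp: t_def)
      also have "\<dots> < \<epsilon>" using \<epsilon>(1) \<mu> by simp
      finally show "t * cmod \<mu> < \<epsilon>" .
    qed
    have "dist (of_real (1 - t) * \<mu>) \<mu> = t * cmod \<mu>"
    proof -
      have "of_real (1 - t) * \<mu> - \<mu> = - (of_real t * \<mu>)" by (simp add: algebra_simps)
      thus ?thesis using t(1) by (simp add: dist_norm norm_mult)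
    qed
    hence "\<rho> \<le> cmod (of_real (1 - t) * \<mu>)" using t by (intro below \<epsilon>(2)) simp
    also have "\<dots> = (1 - t) * cmod \<mu>" using t by (simp only: norm_mult norm_of_real)
    also have "\<dots> < 1 * cmod \<mu>" using t \<mu> by (intro mult_strict_right_mono) auto
    finally show "\<rho> < cmod \<mu>" by simp
  next
    assume \<rho>: "\<rho> < cmod \<mu>"
    then obtain r where r: "\<rho> < r" "r < cmod \<mu>" using dense by blast
    have "max la lb < r\<^sup>2" unfolding \<rho>2[symmetric] using r \<rho>0 by (intro power_strict_mono) auto
    moreover have r0: "0 < r" using r \<rho>0 by linarith
    ultimately obtain K where K: "0 \<le> K" "\<And>n f. norm ((blinfun_apply T ^^ n) f) \<le> K * r ^ n * norm f"
      using T_power_upper[OF Wa _ Wb, of r] by auto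
    show "invertible_operator (T - hscale \<mu>)" by (rule invertible_outside[OF K(2) K(1) r0 r(2)])
  qed
qed

end

theorem theorem3p2p4:
  fixes \<phi> \<psi> :: "complex \<Rightarrow> complex" and a b :: complex
  assumes "hyperbolic_automorphism \<phi>"
    and "a \<in> \<T>" and "denjoy_wolff_point \<phi> a"
    and "b \<in> \<T>" and "\<phi> b = b" and "b \<noteq> a"
    and "\<psi> \<in> H\<^sup>\<infinity>" and "\<exists>z\<in>\<D>. \<psi> z \<noteq> 0"
    and "continuous_at_boundary \<psi> a" and "continuous_at_boundary \<psi> b"
    and "\<not> hardy_invertible (weighted_composition \<psi> \<phi>)"
  shows "hardy_spectrum (weighted_composition \<psi> \<phi>) =
    {\<mu>. cmod \<mu> \<le> max (cmod (boundary_value \<psi> a) * Re (deriv \<phi> a) powr (- 1 / 2))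
                      (cmod (boundary_value \<psi> b) * Re (deriv \<phi> b) powr (- 1 / 2))}"
proof -
  have aut: "disc_automorphism \<phi>" using assms(1) by (simp add: hyperbolic_automorphism_def)
  have bij: "disc_bijection \<phi>" by (rule disc_automorphism_imp_disc_bijection[OF aut])
  have fix_a: "\<phi> a = a" using assms(3) by (simp add: denjoy_wolff_point_def)
  interpret bp: boundary_pair a b by unfold_locales (use assms in auto)
  obtain s where s: "0 < s" "s < 1" "\<And>z. z \<in> \<D> \<Longrightarrow> bp.u (\<phi> z) = of_real s * bp.u z"
    using bp.hyperbolic_multiplier[OF aut fix_a assms(5) assms(3)] by blast
  interpret hyperbolic_composition a b \<phi> \<psi> s
    by unfold_locales (use assms s bij in auto)
  have limit: "(W \<longlongrightarrow> (cmod (boundary_value \<psi> c))\<^sup>2 / Re (deriv \<phi> c)) (at c within \<D>)"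
    if c: "c \<in> \<T>" "\<phi> c = c" "continuous_at_boundary \<psi> c" for c
  proof -
    obtain l where l: "(\<psi> \<longlongrightarrow> l) (at c within \<D>)" using c(3) by (auto simp: continuous_at_boundary_def)
    have "boundary_value \<psi> c = l"
      unfolding boundary_value_def by (rule tendsto_Lim[OF boundary_nontrivial[OF c(1)] l])
    with l automorphism_boundary_fixed_point(2,3)[OF aut c(1,2)] show ?thesis
      unfolding W_def[abs_def] by (intro tendsto_intros) auto
  qed
  have sq: "sqrt (x\<^sup>2 / d) = x * d powr (- 1 / 2)" if "0 \<le> x" "0 < d" for x d :: real
  proof -
    have "- 1 / 2 = - (1 / 2 :: real)" by simp
    hence "d powr (- 1 / 2) = inverse (sqrt d)"
      using that(2) by (metis powr_minus powr_half_sqrt less_imp_le)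
    moreover have "sqrt (x\<^sup>2 / d) = x / sqrt d"
      using that(1) by (simp add: real_sqrt_divide)
    ultimately show ?thesis by (simp only: divide_inverse[of x])
  qed
  define R where "R c = cmod (boundary_value \<psi> c) * Re (deriv \<phi> c) powr (- 1 / 2)" for c
  have Req: "sqrt ((cmod (boundary_value \<psi> c))\<^sup>2 / Re (deriv \<phi> c)) = R c" if "c \<in> \<T>" "\<phi> c = c" for c
    unfolding R_def using automorphism_boundary_fixed_point(2)[OF aut that] by (intro sq) auto
  have opT: "weighted_composition \<psi> \<phi> (hfun f) = hfun (T f)" for f
    by (simp only: T_def hfun_wcop_eq[OF assms(7) bij])
  have "hardy_invertible (weighted_composition \<psi> \<phi>) \<longleftrightarrow> invertible_operator T"
    by (rule hardy_invertible_iff[OF opT T_scale])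
  hence T: "\<not> invertible_operator T" using assms(11) by simp
  have "hardy_invertible (\<lambda>f z. weighted_composition \<psi> \<phi> f z - \<mu> * f z) \<longleftrightarrow> max (R a) (R b) < cmod \<mu>" for \<mu>
  proof -
    have "hardy_invertible (\<lambda>f z. weighted_composition \<psi> \<phi> f z - \<mu> * f z) \<longleftrightarrow> invertible_operator (T - hscale \<mu>)"
    proof (rule hardy_invertible_iff)
      show "(\<lambda>z. weighted_composition \<psi> \<phi> (hfun f) z - \<mu> * hfun f z) = hfun ((T - hscale \<mu>) f)" for f
        by (simp add: opT blinfun.diff_left hfun_diff hfun_hscale fun_eq_iff)
      show "(T - hscale \<mu>) (hscale c f) = hscale c ((T - hscale \<mu>) f)" for c f
        by (simp only: blinfun.diff_left blinfun.diff_right T_scale hscale_commute[of c \<mu>])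
    qed
    also have "\<dots> \<longleftrightarrow> sqrt (max ((cmod (boundary_value \<psi> a))\<^sup>2 / Re (deriv \<phi> a)) ((cmod (boundary_value \<psi> b))\<^sup>2 / Re (deriv \<phi> b))) < cmod \<mu>"
      by (rule invertible_iff_outside_disc[OF
            automorphism_boundary_fixed_point(1)[OF aut assms(2) fix_a] limit[OF assms(2) fix_a assms(9)]
            automorphism_boundary_fixed_point(1)[OF aut assms(4,5)] limit[OF assms(4,5,10)] T])
    also have "sqrt (max x y) = max (sqrt x) (sqrt y)" for x y by (simp add: max_def)
    finally show ?thesis by (simp only: Req[OF assms(2) fix_a] Req[OF assms(4,5)])
  qed
  thus ?thesis unfolding hardy_spectrum_def R_def[symmetric] by (auto simp: not_less)
qed

end
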